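(* Let $n\ge 1$ and let $T\in(0,\infty]$. The bilinear operator $B$ given by $$B(u,v)(t,\cdot)=\int_0^t e^{(t-s)\Delta}\,\mathbb{P}\,\mathrm{div}\,\big((u\otimes v)(s,\cdot)\big)\,ds,\qquad 0<t<T,$$ is continuous from $(\mathcal{E}_T)^n\times(\mathcal{E}_T)^n$ to $(\mathcal{E}_T)^n$; that is, $B(u,v)\in(\mathcal{E}_T)^n$ for all $u,v\in(\mathcal{E}_T)^n$ and there is a constant $C>0$ such that $\|B(u,v)\|_{(\mathcal{E}_T)^n}\le C\,\|u\|_{(\mathcal{E}_T)^n}\|v\|_{(\mathcal{E}_T)^n}$ for all $u,v\in(\mathcal{E}_T)^n$.
   Context: **The path space.** For $T\in(0,\infty]$, $\mathcal{E}_T$ is the space of (classes modulo a.e. equality of) measurable functions $u:(0,T)\times\mathbb{R}^n\to\mathbb{C}$ belonging to $L^2_{\mathrm{uloc},x}L^2_t((0,T)\times\mathbb{R}^n)$ and satisfying $\|u\|_{\mathcal{E}_T}<\infty$, where $$\|u\|_{\mathcal{E}_T}=\sup_{0<t<T}\|t^{1/2}u(t,\cdot)\|_{L^\infty(\mathbb{R}^n)}+\sup_{x\in\mathbb{R}^n}\sup_{0<t<T}\Big(t^{-n/2}\int_0^t\int_{B(x,\sqrt t)}|u(s,y)|^2\,dy\,ds\Big)^{1/2},$$ the supremum over $t$ in the first term being an essential supremum, and $B(x,r)$ denoting the Euclidean ball in $\mathbb{R}^n$. For $T<\infty$, $u\in L^2_{\mathrm{uloc},x}L^2_t((0,T)\times\mathbb{R}^n)$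 means $\sup_{x\in\mathbb{R}^n}\int_0^T\int_{B(x,1)}|u(s,y)|^2\,dy\,ds<\infty$; for $T=\infty$ it means that this holds with $T$ replaced by every finite $T'>0$. The space $(\mathcal{E}_T)^n$ consists of $\mathbb{C}^n$-valued functions with all components in $\mathcal{E}_T$, with the same norm (with $|\cdot|$ the Euclidean norm on $\mathbb{C}^n$). **The operators.** $(u\otimes v)_{lk}=u_l v_k$. For a matrix-valued function $\alpha=(\alpha_{lk})$, $(\mathrm{div}\,\alpha)_k=\sum_{l=1}^n\partial_l\alpha_{lk}$. $e^{\tau\Delta}$ is the heat semigroup on $\mathbb{R}^n$. $\mathbb{P}$ is the Leray projection, i.e. the matrix Fourier multiplier with symbol $\big(\delta_{jk}-\xi_j\xi_k/|\xi|^2\big)_{j,k=1}^n$. For $\tau>0$, $e^{\tau\Delta}\mathbb{P}\,\mathrm{div}$ is understood as the convolution operator $$\big(e^{\tau\Delta}\mathbb{P}\,\mathrm{div}\,\alpha\big)_j(x)=\sum_{k,l=1}^n\int_{\mathbb{R}^n}(\partial_l K^{jk}_\tau)(x-y)\,\alpha_{lk}(y)\,dy,$$ where $K_\tau^{jk}$ (the Oseen kernel) is the inverse Fourier transform of $e^{-\tau|\xi|^2}\big(\delta_{jk}-\xi_j\xi_k/|\xi|^2\big)$. It is smooth and satisfies $|\nabla K_\tau^{jk}(x)|\le C\tau^{-1/2-n/2}(1+\tau^{-1/2}|x|)^{-n-1}$. *)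

theory Defs
  imports "HOL-Analysis.Analysis" "HOL-Probability.Essential_Supremum"
begin

text \<open>
  Functions on \<open>(0,T) \<times> \<real>\<^sup>n\<close> are represented by functions on \<^typ>\<open>real \<times> (real ^ 'n)\<close>, where
  \<open>n = CARD('n)\<close> and \<open>T\<close> is an extended real; only their values on the slab below matter.
  Classes modulo a.e. equality are represented by arbitrary Lebesgue measurable representatives.
\<close>

definition time_interval :: "ereal \<Rightarrow> real set" where
  "time_interval T = {t. 0 < t \<and> ereal t < T}"

definition ennreal_sqrt :: "ennreal \<Rightarrow> ennreal" where
  "ennreal_sqrt a = (if a = top then top else ennreal (sqrt (enn2real a)))"

definition uloc_L2_upto :: "real \<Rightarrow> (real \<times> (real ^ 'n::finite) \<Rightarrow> 'b::real_normed_vector) \<Rightarrow> bool" where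
  "uloc_L2_upto T' u \<longleftrightarrow>
     (SUP x. \<integral>\<^sup>+ s\<in>{0<..<T'}. (\<integral>\<^sup>+ y\<in>ball x 1. ennreal ((norm (u (s, y)))\<^sup>2) \<partial>lebesgue) \<partial>lebesgue) < top"

definition uloc_L2 :: "ereal \<Rightarrow> (real \<times> (real ^ 'n::finite) \<Rightarrow> 'b::real_normed_vector) \<Rightarrow> bool" where
  "uloc_L2 T u \<longleftrightarrow>
     (if T = \<infinity> then \<forall>T'>0. uloc_L2_upto T' u else uloc_L2_upto (real_of_ereal T) u)"

text \<open>
  The norm is extended-real valued, hence defined for every function. As \<^const>\<open>esssup\<close> is
  \<open>top\<close> on non-measurable functions, and almost every time slice of a measurable function is
  measurable, exceptional slices are harmless because the supremum over \<open>t\<close> is essential.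
\<close>

definition path_norm :: "ereal \<Rightarrow> (real \<times> (real ^ 'n::finite) \<Rightarrow> 'b::real_normed_vector) \<Rightarrow> ennreal" where
  "path_norm T u =
     esssup (lebesgue_on (time_interval T))
       (\<lambda>t. esssup lebesgue (\<lambda>x. ennreal (norm (sqrt t *\<^sub>R u (t, x)))))
     + (SUP x. SUP t\<in>time_interval T.
          ennreal_sqrt (ennreal (t powr (- real CARD('n) / 2)) *
            (\<integral>\<^sup>+ s\<in>{0<..<t}.
               (\<integral>\<^sup>+ y\<in>ball x (sqrt t). ennreal ((norm (u (s, y)))\<^sup>2) \<partial>lebesgue) \<partial>lebesgue)))"

definition path_space :: "ereal \<Rightarrow> (real \<times> (real ^ 'n::finite) \<Rightarrow> complex) set" where
  "path_space T = {u. u \<in> borel_measurable (lebesgue_on (time_interval T \<times> UNIV))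
                      \<and> uloc_L2 T u \<and> path_norm T u < top}"

definition path_space_vec :: "ereal \<Rightarrow> (real \<times> (real ^ 'n::finite) \<Rightarrow> complex ^ 'n) set" where
  "path_space_vec T = {u. \<forall>j. (\<lambda>p. u p $ j) \<in> path_space T}"

definition tensor :: "complex ^ 'n::finite \<Rightarrow> complex ^ 'n \<Rightarrow> complex ^ 'n ^ 'n" where
  "tensor a b = (\<chi> l k. a $ l * b $ k)"

text \<open>
  The Fourier convention is the one for which the heat semigroup \<open>e\<^bsup>\<tau>\<Delta>\<^esup>\<close> has symbol
  \<open>exp (- \<tau> |\<xi>|\<^sup>2)\<close>, i.e. \<open>f\<close> is recovered from its transform \<open>g\<close> by
  \<open>f x = (2\<pi>)\<^bsup>-n\<^esup> \<integral> exp (\<i> x \<bullet> \<xi>) g \<xi> d\<xi>\<close>. The value of the symbol at \<open>\<xi> = 0\<close> is irrelevant.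
\<close>

definition leray_symbol :: "'n::finite \<Rightarrow> 'n \<Rightarrow> real ^ 'n \<Rightarrow> real" where
  "leray_symbol j k \<xi> = (if j = k then 1 else 0) - \<xi> $ j * \<xi> $ k / (norm \<xi>)\<^sup>2"

definition oseen_kernel :: "real \<Rightarrow> 'n::finite \<Rightarrow> 'n \<Rightarrow> real ^ 'n \<Rightarrow> complex" where
  "oseen_kernel \<tau> j k x =
     complex_of_real (1 / (2 * pi) ^ CARD('n)) *
     (LINT \<xi>|lborel. exp (\<i> * complex_of_real (x \<bullet> \<xi>)) *
        complex_of_real (exp (- \<tau> * (norm \<xi>)\<^sup>2) * leray_symbol j k \<xi>))"

definition partial_deriv :: "'n::finite \<Rightarrow> (real ^ 'n \<Rightarrow> complex) \<Rightarrow> real ^ 'n \<Rightarrow> complex" where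
  "partial_deriv l f x = vector_derivative (\<lambda>h::real. f (x + h *\<^sub>R axis l 1)) (at 0)"

definition heat_leray_div ::
  "real \<Rightarrow> (real ^ 'n::finite \<Rightarrow> complex ^ 'n ^ 'n) \<Rightarrow> real ^ 'n \<Rightarrow> complex ^ 'n" where
  "heat_leray_div \<tau> \<alpha> x =
     (\<chi> j. \<Sum>k\<in>UNIV. \<Sum>l\<in>UNIV.
        LINT y|lebesgue. partial_deriv l (oseen_kernel \<tau> j k) (x - y) * \<alpha> y $ l $ k)"

definition bilinear_op ::
  "(real \<times> (real ^ 'n::finite) \<Rightarrow> complex ^ 'n) \<Rightarrow> (real \<times> (real ^ 'n) \<Rightarrow> complex ^ 'n) \<Rightarrow>
   real \<times> (real ^ 'n) \<Rightarrow> complex ^ 'n" where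
  "bilinear_op u v = (\<lambda>(t, x).
     LINT s:{0<..<t}|lebesgue. heat_leray_div (t - s) (\<lambda>y. tensor (u (s, y)) (v (s, y))) x)"

text \<open>
  The Bochner integral is \<open>0\<close> on non-integrable functions, so that the convergence of the integrals
  defining \<^const>\<open>bilinear_op\<close> has to be expressed separately.
\<close>

definition heat_leray_div_converges ::
  "real \<Rightarrow> (real ^ 'n::finite \<Rightarrow> complex ^ 'n ^ 'n) \<Rightarrow> real ^ 'n \<Rightarrow> bool" where
  "heat_leray_div_converges \<tau> \<alpha> x \<longleftrightarrow>
     (\<forall>j k l. integrable lebesgue
        (\<lambda>y. partial_deriv l (oseen_kernel \<tau> j k) (x - y) * \<alpha> y $ l $ k))"

definition bilinear_op_converges ::
  "(real \<times> (real ^ 'n::finite) \<Rightarrow> complex ^ 'n) \<Rightarrow> (real \<times> (real ^ 'n) \<Rightarrow> complex ^ 'n) \<Rightarrow>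
   real \<Rightarrow> real ^ 'n \<Rightarrow> bool" where
  "bilinear_op_converges u v t x \<longleftrightarrow>
     (AE s in lebesgue_on {0<..<t}.
        heat_leray_div_converges (t - s) (\<lambda>y. tensor (u (s, y)) (v (s, y))) x) \<and>
     set_integrable lebesgue {0<..<t}
       (\<lambda>s. heat_leray_div (t - s) (\<lambda>y. tensor (u (s, y)) (v (s, y))) x)"

end

theory Submission
  imports Defs "HOL-Probability.Characteristic_Functions"
begin

text \<open>
  \<open>B(u,v)\<close> depends on \<open>u\<close> and \<open>v\<close> only through the products \<open>F = u\<^sub>l v\<^sub>k\<close>. If \<open>M\<close> is the
  product of the norms, then \<open>|F(s,y)| \<le> M / s\<close> almost everywhere, and by the Cauchy-Schwarz inequality
  the integral of \<open>|F|\<close> over \<open>(0,t) \<times> B(x,\<surd>t)\<close> is at most \<open>M t^(n/2)\<close>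
  (\<open>source_bound_product\<close>). These two bounds are all that is used about the source, and it
  remains to estimate the linear Duhamel integral
  \<open>V(t,x) = \<integral>\<^sub>0\<^sup>t \<integral> \<kappa>(t-s, x-y) F(s,y) dy ds\<close> for \<open>\<kappa> = \<partial>\<^sub>l K\<^sup>j\<^sup>k\<close>.

  The kernel. Because \<open>exp(-\<tau>|\<xi>|^2) / |\<xi>|^2\<close> is the integral of \<open>exp(-s|\<xi>|^2)\<close> over \<open>s > \<tau>\<close>,
  \<open>\<kappa>(\<tau>,\<cdot>)\<close> is a first derivative of the heat kernel plus an integral over \<open>s > \<tau>\<close> of third derivatives.
  Gaussian bounds for these yield \<open>|\<kappa>(\<tau>,x)| \<le> C (\<surd>\<tau> + |x|)^(-n-1)\<close> (\<open>norm_oseen_gradient_le\<close>).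

  The pointwise bound. For \<open>s < t/2\<close> the kernel is comparable with \<open>(\<surd>t + |x-y|)^(-n-1)\<close>, and
  averaging over balls of radius \<open>\<surd>t\<close> turns the Carleson bound into the estimate \<open>C M / \<surd>t\<close>. For
  \<open>s > t/2\<close> one has \<open>|F| \<le> 2M/t\<close>, and the kernel has \<open>L\<^sup>1\<close> norm \<open>C (t-s)^(-1/2)\<close>, which is
  integrable in \<open>s\<close> (\<open>nn_integral_source_parabolic_weight\<close>).

  The \<open>L\<^sup>2\<close> bound on \<open>(0,R) \<times> B(a,\<surd>R)\<close>. The part of \<open>F\<close> outside \<open>B(a,2\<surd>R)\<close> is seen from
  distance at least \<open>\<surd>R\<close> and contributes \<open>C M / \<surd>R\<close> pointwise (\<open>norm_duhamel_tail_le\<close>). Let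
  \<open>F\<^sub>1\<close> be the part inside. The symbol of \<open>\<kappa>\<close> is bounded by \<open>|\<xi>| exp(-\<tau>|\<xi>|^2)\<close>, so Plancherel reduces the estimate to
  the gradient of the heat flow driven by \<open>F\<^sub>1\<close>. Expanding the square and integrating first in time,
  \<open>|\<xi>|^2 \<integral> exp(-(2t-s-\<sigma>)|\<xi>|^2) dt = exp(-|s-\<sigma>||\<xi>|^2) / 2\<close> over \<open>t > max(s,\<sigma>)\<close>, which is half the
  Fourier transform of the heat kernel at time \<open>|s-\<sigma>|\<close>. Back in physical space
  one is left with the bilinear form of \<open>|F\<^sub>1|\<close> with this positive kernel
  (\<open>nn_integral_heat_transform_le\<close>). By symmetry only \<open>s \<le> \<sigma>\<close> matters, and there the splitting at
  \<open>\<sigma>/2\<close> bounds the inner integral by \<open>C M\<close> (\<open>nn_integral_source_heat_fourier\<close>). What remains is \<open>C M\<close>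
  times the \<open>L\<^sup>1\<close> norm of \<open>F\<^sub>1\<close>, hence at most \<open>C M^2 R^(n/2)\<close>. All exchanges of integrals are
  made for kernels delayed by \<open>\<epsilon> > 0\<close>, which converge absolutely; Fatou's lemma removes the delay.

  Finally, \<open>u\<close> and \<open>v\<close> are replaced by Borel representatives, for which \<open>B(u,v)\<close> is a sum of Duhamel
  integrals at every point \<open>(t,x)\<close> (\<open>bilinear_op_eq_duhamel\<close>).
\<close>

section \<open>Measurability and iterated integrals\<close>

type_synonym 'n spacetime = "real \<times> (real ^ 'n)"

abbreviation before :: "real \<Rightarrow> real \<times> 'a \<Rightarrow> 'b::zero_neq_one" where
  "before t p \<equiv> indicator {0<..<t} (fst p)"

lemma borel_measurable_cis [measurable]: "cis \<in> borel_measurable borel"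
  by (intro borel_measurable_continuous_onI) (auto simp: cis_conv_exp intro!: continuous_intros)

lemma borel_measurable_cnj [measurable]: "cnj \<in> borel_measurable borel"
  by (intro borel_measurable_continuous_onI continuous_intros)

lemma pred_mem_Ioo [measurable (raw)]:
  fixes f g :: "'a \<Rightarrow> real"
  assumes [measurable]: "f \<in> borel_measurable M" "g \<in> borel_measurable M"
  shows "Measurable.pred M (\<lambda>x. g x \<in> {0<..<f x})"
  unfolding greaterThanLessThan_iff by measurable

lemma borel_measurable_fst_borel [measurable (raw)]:
  fixes f :: "'a \<Rightarrow> 'b::second_countable_topology \<times> 'c::second_countable_topology"
  assumes "f \<in> borel_measurable M"
  shows "(\<lambda>x. fst (f x)) \<in> borel_measurable M"
  by (rule measurable_compose[OF assms]) (intro borel_measurable_continuous_onI continuous_intros)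

lemma borel_measurable_snd_borel [measurable (raw)]:
  fixes f :: "'a \<Rightarrow> 'b::second_countable_topology \<times> 'c::second_countable_topology"
  assumes "f \<in> borel_measurable M"
  shows "(\<lambda>x. snd (f x)) \<in> borel_measurable M"
  by (rule measurable_compose[OF assms]) (intro borel_measurable_continuous_onI continuous_intros)

lemma borel_mem_ball_pair [measurable]:
  "{p :: ('a::euclidean_space) \<times> 'a. snd p \<in> ball (fst p) \<rho>} \<in> sets borel"
  unfolding mem_ball by (intro borel_open open_Collect_less continuous_intros)

lemma norm_integral_le_nn_integral:
  fixes f :: "'a \<Rightarrow> 'b::{banach, second_countable_topology}"
  shows "ennreal (norm (integral\<^sup>L M f)) \<le> (\<integral>\<^sup>+x. ennreal (norm (f x)) \<partial>M)"
  by (cases "integrable M f") (auto simp: integral_norm_bound_ennreal not_integrable_integral_eq)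

lemma nn_integral_lborel_pair_snd:
  fixes f :: "'a::euclidean_space \<times> 'b::euclidean_space \<Rightarrow> ennreal"
  assumes "f \<in> borel_measurable borel"
  shows "(\<integral>\<^sup>+p. f p \<partial>lborel) = (\<integral>\<^sup>+y. \<integral>\<^sup>+s. f (s, y) \<partial>lborel \<partial>lborel)"
  using lborel_pair.nn_integral_snd[of f] assms by (simp add: lborel_prod)

lemma nn_integral_lborel_pair_fst:
  fixes f :: "'a::euclidean_space \<times> 'b::euclidean_space \<Rightarrow> ennreal"
  assumes "f \<in> borel_measurable borel"
  shows "(\<integral>\<^sup>+p. f p \<partial>lborel) = (\<integral>\<^sup>+s. \<integral>\<^sup>+y. f (s, y) \<partial>lborel \<partial>lborel)"
  using lborel.nn_integral_fst[of f lborel] assms by (simp add: lborel_prod)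

lemma nn_integral_lborel_reflect:
  fixes f :: "'a::euclidean_space \<Rightarrow> ennreal"
  assumes [measurable]: "f \<in> borel_measurable borel"
  shows "(\<integral>\<^sup>+y. f (z - y) \<partial>lborel) = (\<integral>\<^sup>+y. f y \<partial>lborel)"
proof -
  have "(\<integral>\<^sup>+y. f y \<partial>lborel) = (\<integral>\<^sup>+y. f y \<partial>density (distr lborel borel (\<lambda>x. z + (-1) *\<^sub>R x)) (\<lambda>_. ennreal (\<bar>-1\<bar> ^ DIM('a))))"
    using lborel_affine[of "-1" z] by simp
  also have "\<dots> = (\<integral>\<^sup>+y. f (z - y) \<partial>lborel)"
    by (simp add: nn_integral_density nn_integral_distr)
  finally show ?thesis by simp
qed

section \<open>Fourier integrals of Gaussians\<close>

text \<open>
  The mean value inequality bounds the difference quotients by the same \<open>g\<close> that dominates the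
  derivative, so dominated convergence applies along every sequence of increments.
\<close>
lemma has_vector_derivative_integral:
  fixes f f' :: "real \<Rightarrow> 'a \<Rightarrow> 'b::{banach, second_countable_topology}"
  assumes int: "\<And>h. integrable M (f h)"
    and deriv: "\<And>h x. x \<in> space M \<Longrightarrow> ((\<lambda>h. f h x) has_vector_derivative f' h x) (at h)"
    and bound: "\<And>h x. x \<in> space M \<Longrightarrow> norm (f' h x) \<le> g x"
    and g: "integrable M g"
    and meas: "\<And>h. f' h \<in> borel_measurable M"
  shows "((\<lambda>h. \<integral>x. f h x \<partial>M) has_vector_derivative (\<integral>x. f' a x \<partial>M)) (at a)"
proof -
  have quot: "norm ((1 / (y - a)) *\<^sub>R u - w) = norm (u - (y - a) *\<^sub>R w) / norm (y - a)" if "y \<noteq> a" for y and u w :: 'b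
  proof -
    have "(1 / (y - a)) *\<^sub>R u - w = (1 / (y - a)) *\<^sub>R (u - (y - a) *\<^sub>R w)"
      using that by (simp add: scaleR_right_diff_distrib)
    then show ?thesis by (simp add: divide_inverse)
  qed
  have "((\<lambda>y. norm ((\<integral>x. f y x \<partial>M) - (\<integral>x. f a x \<partial>M) - (y - a) *\<^sub>R (\<integral>x. f' a x \<partial>M)) / norm (y - a)) \<longlongrightarrow> 0) (at a)"
    unfolding tendsto_at_iff_sequentially comp_def
  proof safe
    fix X :: "nat \<Rightarrow> real" assume X: "\<forall>i. X i \<in> UNIV - {a}" "X \<longlonglongrightarrow> a"
    have int': "integrable M (f' a)"
      by (rule Bochner_Integration.integrable_bound[OF g meas]) (auto intro!: AE_I2 order.trans[OF bound])
    let ?q = "\<lambda>i x. (1 / (X i - a)) *\<^sub>R (f (X i) x - f a x)"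
    have "(\<lambda>i. \<integral>x. ?q i x \<partial>M) \<longlonglongrightarrow> (\<integral>x. f' a x \<partial>M)"
    proof (rule integral_dominated_convergence[where w=g])
      show "AE x in M. (\<lambda>i. ?q i x) \<longlonglongrightarrow> f' a x"
      proof (rule AE_I2)
        fix x assume x: "x \<in> space M"
        have "((\<lambda>y. norm (f y x - f a x - (y - a) *\<^sub>R f' a x) / norm (y - a)) \<longlongrightarrow> 0) (at a)"
          using deriv[OF x, of a] by (simp add: has_vector_derivative_def has_derivative_iff_norm)
        then have "((\<lambda>y. norm ((1 / (y - a)) *\<^sub>R (f y x - f a x) - f' a x)) \<longlongrightarrow> 0) (at a)"
          by (rule Lim_transform_eventually) (auto simp: eventually_at_filter quot)
        then have "((\<lambda>y. (1 / (y - a)) *\<^sub>R (f y x - f a x)) \<longlongrightarrow> f' a x) (at a)"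
          by (simp only: tendsto_norm_zero_iff LIM_zero_iff)
        then show "(\<lambda>i. ?q i x) \<longlonglongrightarrow> f' a x"
          unfolding tendsto_at_iff_sequentially comp_def using X by blast
      qed
      show "AE x in M. norm (?q i x) \<le> g x" for i
      proof (rule AE_I2)
        fix x assume x: "x \<in> space M"
        have "norm (f (X i) x - f a x) \<le> g x * norm (X i - a)"
        proof (rule differentiable_bound[where S=UNIV and f'="\<lambda>h r. r *\<^sub>R f' h x"])
          fix h
          show "((\<lambda>h. f h x) has_derivative (\<lambda>r. r *\<^sub>R f' h x)) (at h)"
            using deriv[OF x] by (simp add: has_vector_derivative_def)
          show "onorm (\<lambda>r. r *\<^sub>R f' h x) \<le> g x"
            by (rule onorm_bound) (use bound[OF x, of h] order.trans[OF norm_ge_zero bound[OF x, of h]] in \<open>auto simp: mult.commute intro!: mult_left_mono mult_right_mono\<close>)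
        qed auto
        moreover have "X i \<noteq> a" using X by auto
        moreover have "norm (?q i x) = norm (f (X i) x - f a x) / norm (X i - a)"
          by simp
        ultimately show "norm (?q i x) \<le> g x"
          by (simp add: pos_divide_le_eq)
      qed
    qed (use g meas borel_measurable_integrable[OF int] in auto)
    moreover have "(\<integral>x. ?q i x \<partial>M) = (1 / (X i - a)) *\<^sub>R ((\<integral>x. f (X i) x \<partial>M) - (\<integral>x. f a x \<partial>M))" for i
      using int by simp
    ultimately have "(\<lambda>i. (1 / (X i - a)) *\<^sub>R ((\<integral>x. f (X i) x \<partial>M) - (\<integral>x. f a x \<partial>M))) \<longlonglongrightarrow> (\<integral>x. f' a x \<partial>M)"
      by (simp only:)
    then have "(\<lambda>i. norm ((1 / (X i - a)) *\<^sub>R ((\<integral>x. f (X i) x \<partial>M) - (\<integral>x. f a x \<partial>M)) - (\<integral>x. f' a x \<partial>M))) \<longlonglongrightarrow> 0"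
      by (intro tendsto_norm_zero) (simp add: LIM_zero)
    moreover have "X i \<noteq> a" for i using X by auto
    ultimately show "(\<lambda>i. norm ((\<integral>x. f (X i) x \<partial>M) - (\<integral>x. f a x \<partial>M) - (X i - a) *\<^sub>R (\<integral>x. f' a x \<partial>M)) / norm (X i - a)) \<longlonglongrightarrow> 0"
      by (simp only: quot not_False_eq_True)
  qed
  then show ?thesis
    unfolding has_vector_derivative_def has_derivative_iff_norm
    by (simp add: bounded_linear_scaleR_left)
qed

abbreviation gauss :: "real \<Rightarrow> 'a::real_normed_vector \<Rightarrow> real" where
  "gauss s \<xi> \<equiv> exp (- s * (norm \<xi>)\<^sup>2)"

text \<open>
  Up to the factor \<open>\<i>^a\<close> this is the \<open>a\<close>-th derivative of the Fourier transform of
  \<open>exp (- r\<^sup>2 / 2)\<close>.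
\<close>
definition gauss_fourier :: "nat \<Rightarrow> real \<Rightarrow> complex" where
  "gauss_fourier a x = (LINT r|lborel. complex_of_real (r ^ a * exp (- r\<^sup>2 / 2)) * cis (x * r))"

lemma integrable_power_gauss: "integrable lborel (\<lambda>r::real. r ^ a * exp (- r\<^sup>2 / 2))"
proof -
  have "integrable lborel (\<lambda>r. sqrt (2 * pi) * (std_normal_density r * r ^ a))"
    by (intro integrable_mult_right integrable_std_normal_moment)
  then show ?thesis
    by (simp add: normal_density_def mult_ac)
qed

lemma integrable_cis_mult:
  assumes "integrable lborel (f :: 'a::euclidean_space \<Rightarrow> real)" "g \<in> borel_measurable borel"
  shows "integrable lborel (\<lambda>r. complex_of_real (f r) * cis (g r))"
proof (rule Bochner_Integration.integrable_bound[OF integrable_norm[OF assms(1)]])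
  have [measurable]: "f \<in> borel_measurable borel" "g \<in> borel_measurable borel"
    using assms by auto
  have [measurable]: "cis \<in> borel_measurable borel"
    by (intro borel_measurable_continuous_onI) (auto simp: cis_conv_exp intro!: continuous_intros)
  show "(\<lambda>r. complex_of_real (f r) * cis (g r)) \<in> borel_measurable lborel" by measurable
qed (auto simp: norm_mult)

lemma has_vector_derivative_gauss_fourier:
  "((\<lambda>x. gauss_fourier a x) has_vector_derivative \<i> * gauss_fourier (Suc a) x) (at x)"
proof -
  have eq: "\<i> * gauss_fourier (Suc a) x =
      (LINT r|lborel. \<i> * (complex_of_real (r ^ Suc a * exp (- r\<^sup>2 / 2)) * cis (x * r)))" for x
    by (simp add: gauss_fourier_def)
  show ?thesis unfolding eq unfolding gauss_fourier_def
  proof (rule has_vector_derivative_integral[where g = "\<lambda>r. \<bar>r ^ Suc a * exp (- r\<^sup>2 / 2)\<bar>"])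
    show "integrable lborel (\<lambda>r. complex_of_real (r ^ a * exp (- r\<^sup>2 / 2)) * cis (h * r))" for h
      by (intro integrable_cis_mult integrable_power_gauss) auto
    show "integrable lborel (\<lambda>r::real. \<bar>r ^ Suc a * exp (- r\<^sup>2 / 2)\<bar>)"
      using integrable_abs[OF integrable_power_gauss[of "Suc a"]] by simp
    show "(\<lambda>r. \<i> * (complex_of_real (r ^ Suc a * exp (- r\<^sup>2 / 2)) * cis (h * r))) \<in> borel_measurable lborel" for h
      using borel_measurable_integrable[OF integrable_cis_mult[OF integrable_power_gauss[of "Suc a"], of "\<lambda>r. h * r"]]
      by auto
    fix h r :: real
    show "((\<lambda>h. complex_of_real (r ^ a * exp (- r\<^sup>2 / 2)) * cis (h * r)) has_vector_derivative
         \<i> * (complex_of_real (r ^ Suc a * exp (- r\<^sup>2 / 2)) * cis (h * r))) (at h)"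
      unfolding cis_conv_exp
      by (rule derivative_eq_intros refl has_vector_derivative_real_field | simp)+
    show "norm (\<i> * (complex_of_real (r ^ Suc a * exp (- r\<^sup>2 / 2)) * cis (h * r))) \<le> \<bar>r ^ Suc a * exp (- r\<^sup>2 / 2)\<bar>"
      by (simp add: norm_mult norm_power abs_mult power_abs)
  qed
qed

lemma gauss_fourier_0: "gauss_fourier 0 x = complex_of_real (sqrt (2 * pi) * exp (- x\<^sup>2 / 2))"
proof -
  have "complex_of_real (exp (- (x^2) / 2)) = char std_normal_distribution x"
    by (simp add: char_std_normal_distribution)
  also have "\<dots> = (LINT r|lborel. std_normal_density r *\<^sub>R iexp (x * r))"
    unfolding char_def by (subst integral_density) (auto simp: normal_density_nonneg)
  also have "\<dots> = (LINT r|lborel. complex_of_real (1 / sqrt (2 * pi)) * (complex_of_real (r ^ 0 * exp (- r\<^sup>2 / 2)) * cis (x * r)))"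
    by (intro Bochner_Integration.integral_cong) (auto simp: normal_density_def cis_conv_exp scaleR_conv_of_real)
  also have "\<dots> = complex_of_real (1 / sqrt (2 * pi)) * gauss_fourier 0 x"
    unfolding gauss_fourier_def by (rule integral_mult_right_zero)
  finally show ?thesis
    by (simp add: field_simps of_real_divide)
qed

text \<open>
  Differentiation multiplies the integrand by \<open>\<i> r\<close>, so these are Hermite functions. Their
  decay only depends on the shape \<open>polynomial times Gaussian\<close>, which differentiation preserves.
\<close>
lemma gauss_fourier_poly:
  "\<exists>p::complex poly. \<forall>x. gauss_fourier a x = poly p (of_real x) * of_real (exp (- x\<^sup>2 / 2))"
proof (induction a)
  case 0
  show ?case
    by (rule exI[of _ "[:of_real (sqrt (2 * pi)):]"]) (simp add: gauss_fourier_0)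
next
  case (Suc a)
  then obtain p where p: "\<And>x. gauss_fourier a x = poly p (of_real x) * of_real (exp (- x\<^sup>2 / 2))" by auto
  let ?q = "smult (- \<i>) (pderiv p - [:0, 1:] * p)"
  have "gauss_fourier (Suc a) x = poly ?q (of_real x) * of_real (exp (- x\<^sup>2 / 2))" for x
  proof -
    have fd: "((\<lambda>z. poly p z * exp (- z\<^sup>2 / 2)) has_field_derivative
        ((poly (pderiv p) (of_real x) - of_real x * poly p (of_real x)) * exp (- (of_real x)\<^sup>2 / 2)))
        (at (complex_of_real x))"
      by (rule derivative_eq_intros refl poly_DERIV | simp add: algebra_simps)+
    have "((\<lambda>y. poly p (of_real y) * exp (- (of_real y)\<^sup>2 / 2)) has_vector_derivative
        ((poly (pderiv p) (of_real x) - of_real x * poly p (of_real x)) * exp (- (of_real x)\<^sup>2 / 2))) (at x)"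
      by (rule has_vector_derivative_real_field[OF fd])
    moreover have "(\<lambda>y. poly p (of_real y) * exp (- (of_real y)\<^sup>2 / 2)) = gauss_fourier a"
      by (rule ext) (simp add: p exp_of_real[symmetric])
    ultimately have "\<i> * gauss_fourier (Suc a) x = ((poly (pderiv p) (of_real x) - of_real x * poly p (of_real x)) * exp (- (of_real x)\<^sup>2 / 2))"
      using has_vector_derivative_gauss_fourier[of a x] vector_derivative_unique_at by metis
    then have "(- \<i>) * (\<i> * gauss_fourier (Suc a) x) = (- \<i>) * ((poly (pderiv p) (of_real x) - of_real x * poly p (of_real x)) * exp (- (of_real x)\<^sup>2 / 2))"
      by simp
    then show ?thesis by (simp add: exp_of_real[symmetric])
  qed
  then show ?case by blast
qed

lemma power_mult_exp_minus_le:
  fixes y :: real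
  assumes "y \<ge> 0"
  shows "y ^ k * exp (- y) \<le> fact k"
proof -
  have "(\<Sum>i\<in>{k}. y ^ i /\<^sub>R fact i) \<le> exp y"
    unfolding exp_def using assms by (intro sum_le_suminf summable_exp_generic) auto
  then have "y ^ k / fact k \<le> exp y" by (simp add: divide_inverse mult.commute)
  then show ?thesis
    by (simp add: exp_minus field_simps)
qed

lemma power_le_one_plus_power_square:
  fixes y :: real
  assumes "y \<ge> 0"
  shows "y ^ k \<le> 1 + (y\<^sup>2) ^ k"
proof (cases "y \<le> 1")
  case True
  then have "y ^ k \<le> 1" using assms by (simp add: power_le_one)
  moreover have "0 \<le> (y\<^sup>2) ^ k" by simp
  ultimately show ?thesis by linarith
next
  case False
  then have "y ^ k \<le> y ^ (2 * k)" by (intro power_increasing) auto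
  then show ?thesis by (simp add: power_mult)
qed

lemma abs_power_gauss_bound: "\<exists>C. \<forall>x::real. \<bar>x\<bar> ^ k * exp (- x\<^sup>2 / 4) \<le> C"
proof -
  have "\<bar>x\<bar> ^ k * exp (- x\<^sup>2 / 4) \<le> 1 + 4 ^ k * fact k" for x :: real
  proof -
    have "\<bar>x\<bar> ^ k \<le> 1 + (x\<^sup>2) ^ k"
      using power_le_one_plus_power_square[of "\<bar>x\<bar>" k] by simp
    then have "\<bar>x\<bar> ^ k * exp (- x\<^sup>2 / 4) \<le> (1 + (x\<^sup>2) ^ k) * exp (- x\<^sup>2 / 4)"
      by (intro mult_right_mono) auto
    also have "\<dots> = exp (- x\<^sup>2 / 4) + 4 ^ k * ((x\<^sup>2 / 4) ^ k * exp (- (x\<^sup>2 / 4)))"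
      by (simp add: distrib_right power_divide)
    also have "\<dots> \<le> 1 + 4 ^ k * fact k"
      by (intro add_mono mult_left_mono power_mult_exp_minus_le) auto
    finally show ?thesis .
  qed
  then show ?thesis by blast
qed

text \<open>
  The additional power \<open>m\<close> absorbs the factor \<open>x\<close> that appears in each step of the induction on
  the polynomial.
\<close>
lemma poly_gauss_bound:
  "\<exists>C. \<forall>x::real. \<bar>x\<bar> ^ m * norm (poly (p::complex poly) (of_real x)) * exp (- x\<^sup>2 / 4) \<le> C"
proof (induction p arbitrary: m)
  case 0
  then show ?case by auto
next
  case (pCons a p)
  obtain C1 where C1: "\<And>x::real. \<bar>x\<bar> ^ m * exp (- x\<^sup>2 / 4) \<le> C1" using abs_power_gauss_bound by metis
  obtain C2 where C2: "\<And>x::real. \<bar>x\<bar> ^ Suc m * norm (poly p (of_real x)) * exp (- x\<^sup>2 / 4) \<le> C2"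
    using pCons.IH[of "Suc m"] by metis
  have "\<bar>x\<bar> ^ m * norm (poly (pCons a p) (of_real x)) * exp (- x\<^sup>2 / 4) \<le> norm a * C1 + C2" for x :: real
  proof -
    have "norm (poly (pCons a p) (of_real x)) \<le> norm a + \<bar>x\<bar> * norm (poly p (of_real x))"
      by (simp, metis norm_triangle_ineq norm_mult norm_of_real)
    then have "\<bar>x\<bar> ^ m * norm (poly (pCons a p) (of_real x)) * exp (- x\<^sup>2 / 4)
      \<le> \<bar>x\<bar> ^ m * (norm a + \<bar>x\<bar> * norm (poly p (of_real x))) * exp (- x\<^sup>2 / 4)"
      by (intro mult_right_mono mult_left_mono) auto
    also have "\<dots> = norm a * (\<bar>x\<bar> ^ m * exp (- x\<^sup>2 / 4)) + \<bar>x\<bar> ^ Suc m * norm (poly p (of_real x)) * exp (- x\<^sup>2 / 4)"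
      by (simp add: algebra_simps)
    also have "\<dots> \<le> norm a * C1 + C2" by (intro add_mono mult_left_mono C1 C2) auto
    finally show ?thesis .
  qed
  then show ?case by blast
qed

text \<open>
  Half of the Gaussian is spent on the polynomial.
\<close>
lemma gauss_fourier_bound: "\<exists>C>0. \<forall>x. norm (gauss_fourier a x) \<le> C * exp (- x\<^sup>2 / 4)"
proof -
  obtain p where p: "\<And>x. gauss_fourier a x = poly p (of_real x) * of_real (exp (- x\<^sup>2 / 2))"
    using gauss_fourier_poly[of a] by metis
  obtain C where C: "\<And>x::real. \<bar>x\<bar> ^ 0 * norm (poly p (of_real x)) * exp (- x\<^sup>2 / 4) \<le> C"
    using poly_gauss_bound by metis
  have "norm (gauss_fourier a x) \<le> (\<bar>C\<bar> + 1) * exp (- x\<^sup>2 / 4)" for x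
  proof -
    have e: "exp (- x\<^sup>2 / 2) = exp (- x\<^sup>2 / 4) * exp (- x\<^sup>2 / 4)"
      by (simp add: exp_add[symmetric])
    have "norm (gauss_fourier a x) = (\<bar>x\<bar> ^ 0 * norm (poly p (of_real x)) * exp (- x\<^sup>2 / 4)) * exp (- x\<^sup>2 / 4)"
      unfolding p e by (simp add: norm_mult)
    also have "\<dots> \<le> (\<bar>C\<bar> + 1) * exp (- x\<^sup>2 / 4)"
      using C[of x] by (intro mult_right_mono) auto
    finally show ?thesis .
  qed
  then show ?thesis by (intro exI[of _ "\<bar>C\<bar> + 1"]) auto
qed

lemma gauss_fourier_scaled:
  assumes "s > 0"
  shows "(LINT r|lborel. complex_of_real (r ^ a * exp (- s * r\<^sup>2)) * cis (x * r))
    = complex_of_real ((1 / sqrt (2 * s)) ^ Suc a) * gauss_fourier a (x / sqrt (2 * s))"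
proof -
  define c where "c = 1 / sqrt (2 * s)"
  have c: "c > 0" "c\<^sup>2 = 1 / (2 * s)" using assms by (auto simp: c_def power_divide)
  have "(LINT r|lborel. complex_of_real (r ^ a * exp (- s * r\<^sup>2)) * cis (x * r))
     = \<bar>c\<bar> *\<^sub>R (LINT r|lborel. complex_of_real ((0 + c * r) ^ a * exp (- s * (0 + c * r)\<^sup>2)) * cis (x * (0 + c * r)))"
    using c by (intro lborel_integral_real_affine) auto
  also have "(\<lambda>r. complex_of_real ((0 + c * r) ^ a * exp (- s * (0 + c * r)\<^sup>2)) * cis (x * (0 + c * r)))
     = (\<lambda>r. complex_of_real (c ^ a) * (complex_of_real (r ^ a * exp (- r\<^sup>2 / 2)) * cis (x * c * r)))"
    using c assms by (auto simp: power_mult_distrib mult_ac)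
  also have "(LINT r|lborel. complex_of_real (c ^ a) * (complex_of_real (r ^ a * exp (- r\<^sup>2 / 2)) * cis (x * c * r)))
    = complex_of_real (c ^ a) * gauss_fourier a (x * c)"
    unfolding gauss_fourier_def by (rule integral_mult_right_zero)
  finally show ?thesis
    using c by (simp add: scaleR_conv_of_real c_def)
qed

lemma integrable_power_gauss_scaled:
  assumes "s > 0"
  shows "integrable lborel (\<lambda>r::real. r ^ a * exp (- s * r\<^sup>2))"
proof -
  define c where "c = sqrt (2 * s)"
  have c: "c > 0" "c\<^sup>2 = 2 * s" using assms by (auto simp: c_def)
  have "integrable lborel (\<lambda>r. (0 + c * r) ^ a * exp (- (0 + c * r)\<^sup>2 / 2))"
    using c by (intro lborel_integrable_real_affine integrable_power_gauss) auto
  then have "integrable lborel (\<lambda>r. (1 / c ^ a) * ((0 + c * r) ^ a * exp (- (0 + c * r)\<^sup>2 / 2)))"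
    by (rule integrable_mult_right)
  also have "(\<lambda>r. (1 / c ^ a) * ((0 + c * r) ^ a * exp (- (0 + c * r)\<^sup>2 / 2))) = (\<lambda>r::real. r ^ a * exp (- s * r\<^sup>2))"
    using c by (auto simp: power_mult_distrib)
  finally show ?thesis .
qed

text \<open>
  Lebesgue measure on \<open>real ^ 'n\<close> is the image of the product measure indexed by the basis vectors,
  and these are the vectors \<open>axis i 1\<close>.
\<close>
lemma
  fixes f :: "'n::finite \<Rightarrow> real \<Rightarrow> complex"
  assumes int: "\<And>i. integrable lborel (f i)"
  shows integral_prod_components:
      "(LINT x|lborel. (\<Prod>i\<in>UNIV. f i ((x :: real ^ 'n) $ i))) = (\<Prod>i\<in>UNIV. LINT r|lborel. f i r)"
    and integrable_prod_components:
      "integrable lborel (\<lambda>x :: real ^ 'n. \<Prod>i\<in>UNIV. f i (x $ i))"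
proof -
  interpret product_sigma_finite "\<lambda>_ :: real ^ 'n. lborel :: real measure" ..
  define g where "g b = f (SOME i. b = axis i 1)" for b :: "real ^ 'n"
  have inj: "inj (\<lambda>i::'n. axis i (1::real))" by (auto simp: inj_on_def axis_eq_axis)
  have B: "(Basis :: (real ^ 'n) set) = range (\<lambda>i. axis i 1)"
    by (auto simp: Basis_vec_def)
  have g: "g (axis i 1) = f i" for i
    unfolding g_def by (rule arg_cong[of _ _ f], rule some_equality) (auto simp: axis_eq_axis)
  have eq: "(\<Prod>i\<in>UNIV. h i (axis i 1)) = (\<Prod>b\<in>Basis. h (SOME i. b = axis i 1) b)" for h :: "'n \<Rightarrow> real ^ 'n \<Rightarrow> complex"
    unfolding B by (subst prod.reindex[OF inj]) (auto intro!: prod.cong arg_cong[where f="\<lambda>i. h i _"] some_equality[symmetric] simp: axis_eq_axis)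
  have eq1: "(\<Prod>i\<in>UNIV. f i (x $ i)) = (\<Prod>b\<in>Basis. g b (x \<bullet> b))" for x
    using eq[of "\<lambda>i b. f i (x \<bullet> b)"] by (simp add: g_def inner_axis)
  have eq2: "(\<Prod>i\<in>UNIV. LINT r|lborel. f i r) = (\<Prod>b\<in>Basis. LINT r|lborel. g b r)"
    using eq[of "\<lambda>i b. LINT r|lborel. f i r"] by (simp add: g_def)
  have int': "b \<in> Basis \<Longrightarrow> integrable lborel (g b)" for b using int by (auto simp: g_def)
  have [measurable]: "b \<in> Basis \<Longrightarrow> g b \<in> borel_measurable borel" for b using borel_measurable_integrable[OF int'] by auto
  have m1: "(\<lambda>f. \<Sum>b\<in>Basis. f b *\<^sub>R b) \<in> (\<Pi>\<^sub>M b\<in>(Basis::(real^'n) set). lborel) \<rightarrow>\<^sub>M borel" by measurable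
  have m2: "(\<lambda>x::real^'n. \<Prod>b\<in>Basis. g b (x \<bullet> b)) \<in> borel_measurable borel" by measurable
  show "(LINT x|lborel. (\<Prod>i\<in>UNIV. f i ((x :: real ^ 'n) $ i))) = (\<Prod>i\<in>UNIV. LINT r|lborel. f i r)"
    unfolding eq1 eq2
    apply (subst lborel_eq)
    apply (subst integral_distr[OF m1 m2])
    using product_integral_prod[OF finite_Basis int'] by simp
  show "integrable lborel (\<lambda>x :: real ^ 'n. \<Prod>i\<in>UNIV. f i (x $ i))"
    unfolding eq1
    apply (subst lborel_eq)
    apply (subst integrable_distr_eq[OF m1 m2])
    using product_integrable_prod[OF finite_Basis int'] by simp
qed

lemma norm_power2_eq_sum_components: "(norm (x :: real ^ 'n::finite))\<^sup>2 = (\<Sum>i\<in>UNIV. (x $ i)\<^sup>2)"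
  by (simp add: norm_vec_def L2_set_def sum_nonneg)

lemma gauss_monomial_prod:
  fixes \<xi> x :: "real ^ 'n::finite"
  shows "complex_of_real ((\<Prod>i\<in>UNIV. \<xi> $ i ^ \<alpha> i) * gauss s \<xi>) * cis (x \<bullet> \<xi>)
    = (\<Prod>i\<in>UNIV. complex_of_real (\<xi> $ i ^ \<alpha> i * exp (- s * (\<xi> $ i)\<^sup>2)) * cis (x $ i * \<xi> $ i))"
proof -
  have "gauss s \<xi> = (\<Prod>i\<in>UNIV. exp (- s * (\<xi> $ i)\<^sup>2))"
    by (subst exp_sum[symmetric]) (simp_all add: norm_power2_eq_sum_components sum_distrib_left)
  moreover have "cis (x \<bullet> \<xi>) = (\<Prod>i\<in>UNIV. cis (x $ i * \<xi> $ i))"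
    unfolding cis_conv_exp by (subst exp_sum[symmetric]) (simp_all add: inner_vec_def sum_distrib_left)
  ultimately show ?thesis by (simp add: prod.distrib)
qed

lemma integrable_gauss_monomial:
  fixes x :: "real ^ 'n::finite"
  assumes "s > 0"
  shows "integrable lborel (\<lambda>\<xi>. complex_of_real ((\<Prod>i\<in>UNIV. \<xi> $ i ^ \<alpha> i) * gauss s \<xi>) * cis (x \<bullet> \<xi>))"
  unfolding gauss_monomial_prod
  by (intro integrable_prod_components integrable_cis_mult integrable_power_gauss_scaled assms) auto

lemma integral_gauss_monomial:
  fixes x :: "real ^ 'n::finite"
  assumes "s > 0"
  shows "(LINT \<xi>|lborel. complex_of_real ((\<Prod>i\<in>UNIV. \<xi> $ i ^ \<alpha> i) * gauss s \<xi>) * cis (x \<bullet> \<xi>))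
     = (\<Prod>i\<in>UNIV. complex_of_real ((1 / sqrt (2 * s)) ^ Suc (\<alpha> i)) * gauss_fourier (\<alpha> i) (x $ i / sqrt (2 * s)))"
  unfolding gauss_monomial_prod
proof (subst integral_prod_components)
  show "integrable lborel (\<lambda>r. complex_of_real (r ^ \<alpha> i * exp (- s * r\<^sup>2)) * cis (x $ i * r))" for i
    by (intro integrable_cis_mult integrable_power_gauss_scaled assms) auto
qed (simp only: gauss_fourier_scaled[OF assms])

text \<open>
  The integral factors over the coordinates. The one-dimensional bounds multiply to a Gaussian in
  \<open>norm x\<close>, and the total power of \<open>s\<close> counts one half for each coordinate and each factor
  \<open>\<xi> $ i\<close>.
\<close>
lemma gauss_monomial_bound:
  fixes \<alpha> :: "'n::finite \<Rightarrow> nat"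
  shows "\<exists>C>0. \<forall>s>0. \<forall>x::real^'n.
    norm (LINT \<xi>|lborel. complex_of_real ((\<Prod>i\<in>UNIV. \<xi> $ i ^ \<alpha> i) * gauss s \<xi>) * cis (x \<bullet> \<xi>))
      \<le> C * (1 / sqrt s) ^ ((\<Sum>i\<in>UNIV. \<alpha> i) + CARD('n)) * exp (- (norm x)\<^sup>2 / (8 * s))"
proof -
  obtain C where C: "\<And>a. C a > 0" "\<And>a x. norm (gauss_fourier a x) \<le> C a * exp (- x\<^sup>2 / 4)"
    using gauss_fourier_bound by metis
  define D where "D = (\<Prod>i\<in>UNIV. C (\<alpha> i))"
  show ?thesis
  proof (intro exI[of _ D] conjI allI impI)
    show "D > 0" unfolding D_def using C by (intro prod_pos) auto
    fix s :: real and x :: "real ^ 'n" assume s: "s > 0"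
    have "norm (LINT \<xi>|lborel. complex_of_real ((\<Prod>i\<in>UNIV. \<xi> $ i ^ \<alpha> i) * gauss s \<xi>) * cis (x \<bullet> \<xi>))
      = (\<Prod>i\<in>UNIV. (1 / sqrt (2 * s)) ^ Suc (\<alpha> i) * norm (gauss_fourier (\<alpha> i) (x $ i / sqrt (2 * s))))"
      unfolding integral_gauss_monomial[OF s] prod_norm[symmetric] using s
      by (intro prod.cong refl) (simp only: norm_mult norm_of_real, simp)
    also have "\<dots> \<le> (\<Prod>i\<in>UNIV. (1 / sqrt s) ^ Suc (\<alpha> i) * (C (\<alpha> i) * exp (- (x $ i)\<^sup>2 / (8 * s))))"
    proof (intro prod_mono conjI mult_mono power_mono)
      fix i
      show "1 / sqrt (2 * s) \<le> 1 / sqrt s" using s by (simp add: frac_le)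
      have "norm (gauss_fourier (\<alpha> i) (x $ i / sqrt (2 * s))) \<le> C (\<alpha> i) * exp (- (x $ i / sqrt (2 * s))\<^sup>2 / 4)"
        by (rule C)
      also have "- (x $ i / sqrt (2 * s))\<^sup>2 / 4 = - (x $ i)\<^sup>2 / (8 * s)"
        using s by (simp add: power_divide)
      finally show "norm (gauss_fourier (\<alpha> i) (x $ i / sqrt (2 * s))) \<le> C (\<alpha> i) * exp (- (x $ i)\<^sup>2 / (8 * s))" .
    qed (use s in auto)
    also have "\<dots> = D * (1 / sqrt s) ^ ((\<Sum>i\<in>UNIV. \<alpha> i) + CARD('n)) * exp (- (norm x)\<^sup>2 / (8 * s))"
    proof -
      have "(\<Prod>i\<in>UNIV. (1 / sqrt s) ^ Suc (\<alpha> i)) = (1 / sqrt s) ^ (\<Sum>i\<in>UNIV. Suc (\<alpha> i))"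
        by (rule power_sum[symmetric])
      also have "(\<Sum>i\<in>UNIV. Suc (\<alpha> i)) = (\<Sum>i\<in>UNIV. \<alpha> i) + CARD('n)"
        unfolding Suc_eq_plus1 by (subst sum.distrib) simp
      finally have 1: "(\<Prod>i\<in>UNIV. (1 / sqrt s) ^ Suc (\<alpha> i)) = (1 / sqrt s) ^ ((\<Sum>i\<in>UNIV. \<alpha> i) + CARD('n))" .
      have 2: "(\<Prod>i\<in>UNIV. exp (- (x $ i)\<^sup>2 / (8 * s))) = exp (- (norm x)\<^sup>2 / (8 * s))"
        by (subst exp_sum[symmetric]) (simp_all add: norm_power2_eq_sum_components sum_negf sum_divide_distrib)
      show ?thesis unfolding prod.distrib 1 2 D_def by (simp add: mult_ac)
    qed
    finally show "norm (LINT \<xi>|lborel. complex_of_real ((\<Prod>i\<in>UNIV. \<xi> $ i ^ \<alpha> i) * gauss s \<xi>) * cis (x \<bullet> \<xi>))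
      \<le> D * (1 / sqrt s) ^ ((\<Sum>i\<in>UNIV. \<alpha> i) + CARD('n)) * exp (- (norm x)\<^sup>2 / (8 * s))" .
  qed
qed

lemma fourier_gauss:
  fixes x :: "real ^ 'n::finite"
  assumes "s > 0"
  shows "(LINT \<xi>|lborel. complex_of_real (gauss s \<xi>) * cis (x \<bullet> \<xi>))
    = complex_of_real (sqrt (pi / s) ^ CARD('n) * exp (- (norm x)\<^sup>2 / (4 * s)))"
proof -
  have "(LINT \<xi>|lborel. complex_of_real (gauss s \<xi>) * cis (x \<bullet> \<xi>))
    = (\<Prod>i\<in>(UNIV::'n set). complex_of_real (sqrt (pi / s) * exp (- (x $ i)\<^sup>2 / (4 * s))))"
    using integral_gauss_monomial[OF assms, of "\<lambda>_. 0" x] assms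
    by (simp add: gauss_fourier_0 power_divide real_sqrt_mult real_sqrt_divide divide_simps)
  also have "\<dots> = complex_of_real (\<Prod>i\<in>(UNIV::'n set). sqrt (pi / s) * exp (- (x $ i)\<^sup>2 / (4 * s)))"
    by simp
  also have "(\<Prod>i\<in>(UNIV::'n set). sqrt (pi / s) * exp (- (x $ i)\<^sup>2 / (4 * s)))
     = sqrt (pi / s) ^ CARD('n) * exp (- (norm x)\<^sup>2 / (4 * s))"
    by (subst prod.distrib, subst exp_sum[symmetric]) (simp_all add: norm_power2_eq_sum_components sum_negf sum_divide_distrib)
  finally show ?thesis .
qed

lemma integrable_gauss:
  assumes "s > 0"
  shows "integrable lborel (\<lambda>\<xi>::real ^ 'n::finite. gauss s \<xi>)"
  using integrable_norm[OF integrable_gauss_monomial[OF assms, of "\<lambda>_::'n. 0" 0]] by simp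

section \<open>The gradient of the Oseen kernel\<close>

lemma integrable_norm_power_gauss:
  assumes "s > 0"
  shows "integrable lborel (\<lambda>\<xi>::real ^ 'n::finite. norm \<xi> ^ k * gauss s \<xi>)"
proof (rule Bochner_Integration.integrable_bound)
  show "integrable lborel (\<lambda>\<xi>::real ^ 'n::finite. (1 + (2 / s) ^ k * fact k) * gauss (s / 2) \<xi>)"
    using assms by (intro integrable_mult_right integrable_gauss) auto
  show "AE \<xi> in lborel. norm (norm (\<xi>::real^'n) ^ k * gauss s \<xi>)
      \<le> norm ((1 + (2 / s) ^ k * fact k) * gauss (s / 2) \<xi>)"
  proof (rule AE_I2)
    fix \<xi> :: "real ^ 'n"
    define y where "y = s / 2 * (norm \<xi>)\<^sup>2"
    have y: "y \<ge> 0" using assms by (simp add: y_def)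
    have "norm \<xi> ^ k \<le> 1 + ((norm \<xi>)\<^sup>2) ^ k"
      by (rule power_le_one_plus_power_square) simp
    also have "\<dots> = 1 + (2 / s) ^ k * y ^ k"
      using assms by (simp add: y_def power_mult_distrib[symmetric])
    finally have "norm \<xi> ^ k * exp (- y) \<le> (1 + (2 / s) ^ k * y ^ k) * exp (- y)"
      by (intro mult_right_mono) auto
    also have "\<dots> = exp (- y) + (2 / s) ^ k * (y ^ k * exp (- y))" by (simp add: algebra_simps)
    also have "\<dots> \<le> 1 + (2 / s) ^ k * fact k"
      using y assms by (intro add_mono mult_left_mono power_mult_exp_minus_le) auto
    finally have "norm \<xi> ^ k * exp (- y) * exp (- y) \<le> (1 + (2 / s) ^ k * fact k) * exp (- y)"
      by (intro mult_right_mono) auto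
    moreover have "gauss s \<xi> = exp (- y) * exp (- y)"
      by (simp add: y_def exp_add[symmetric])
    moreover have "0 \<le> 1 + (2 / s) ^ k * fact k" using assms by simp
    ultimately show "norm (norm \<xi> ^ k * gauss s \<xi>)
      \<le> norm ((1 + (2 / s) ^ k * fact k) * gauss (s / 2) \<xi>)"
      by (simp add: y_def mult.assoc)
  qed
qed auto

text \<open>
  The convolution kernel of the Fourier multiplier \<open>m(\<xi>) exp(-\<tau>|\<xi>|^2)\<close>.
\<close>
definition multiplier_kernel :: "(real ^ 'n::finite \<Rightarrow> complex) \<Rightarrow> real \<Rightarrow> real ^ 'n \<Rightarrow> complex" where
  "multiplier_kernel m \<tau> x = complex_of_real (1 / (2 * pi) ^ CARD('n)) *
     (LINT \<xi>|lborel. m \<xi> * complex_of_real (gauss \<tau> \<xi>) * cis (x \<bullet> \<xi>))"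

lemma oseen_kernel_eq_multiplier_kernel:
  "oseen_kernel \<tau> j k = multiplier_kernel (\<lambda>\<xi>. complex_of_real (leray_symbol j k \<xi>)) \<tau>"
  by (rule ext) (simp add: oseen_kernel_def multiplier_kernel_def cis_conv_exp mult_ac)

lemma integrable_multiplier_gauss:
  fixes m :: "real ^ 'n::finite \<Rightarrow> complex"
  assumes [measurable]: "m \<in> borel_measurable borel" "g \<in> borel_measurable borel"
    and m: "\<And>\<xi>. norm (m \<xi>) \<le> C * norm \<xi> ^ k" and "\<tau> > 0"
  shows "integrable lborel (\<lambda>\<xi>. m \<xi> * complex_of_real (gauss \<tau> \<xi>) * cis (g \<xi>))"
proof (rule Bochner_Integration.integrable_bound)
  show "integrable lborel (\<lambda>\<xi>::real^'n. C * (norm \<xi> ^ k * gauss \<tau> \<xi>))"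
    using assms by (intro integrable_mult_right integrable_norm_power_gauss)
  show "AE \<xi> in lborel. norm (m \<xi> * complex_of_real (gauss \<tau> \<xi>) * cis (g \<xi>))
     \<le> norm (C * (norm \<xi> ^ k * gauss \<tau> \<xi>))"
  proof (rule AE_I2)
    fix \<xi>
    have "norm (m \<xi>) \<le> \<bar>C * norm \<xi> ^ k\<bar>" using m[of \<xi>] by linarith
    then show "norm (m \<xi> * complex_of_real (gauss \<tau> \<xi>) * cis (g \<xi>))
     \<le> norm (C * (norm \<xi> ^ k * gauss \<tau> \<xi>))"
      by (simp add: norm_mult abs_mult mult.assoc[symmetric] mult_right_mono)
  qed
qed measurable

lemma partial_deriv_multiplier_kernel:
  fixes m :: "real ^ 'n::finite \<Rightarrow> complex"
  assumes [measurable]: "m \<in> borel_measurable borel"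
    and m: "\<And>\<xi>. norm (m \<xi>) \<le> C" and \<tau>: "\<tau> > 0"
  shows "partial_deriv l (multiplier_kernel m \<tau>) x = multiplier_kernel (\<lambda>\<xi>. \<i> * complex_of_real (\<xi> $ l) * m \<xi>) \<tau> x"
proof -
  have C: "C \<ge> 0" using order.trans[OF norm_ge_zero m] .
  have m1: "norm (\<i> * complex_of_real (\<xi> $ l) * m \<xi>) \<le> C * norm \<xi> ^ 1" for \<xi>
    using mult_mono[OF component_le_norm_cart[of \<xi> l] m[of \<xi>]] by (simp add: norm_mult mult.commute)
  have "((\<lambda>h. LINT \<xi>|lborel. m \<xi> * complex_of_real (gauss \<tau> \<xi>) * cis ((x + h *\<^sub>R axis l 1) \<bullet> \<xi>))
     has_vector_derivative (LINT \<xi>|lborel. \<i> * complex_of_real (\<xi> $ l) * m \<xi> * complex_of_real (gauss \<tau> \<xi>) * cis ((x + 0 *\<^sub>R axis l 1) \<bullet> \<xi>))) (at 0)"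
  proof (rule has_vector_derivative_integral[where g = "\<lambda>\<xi>. C * (norm \<xi> ^ 1 * gauss \<tau> \<xi>)"])
    show "integrable lborel (\<lambda>\<xi>. m \<xi> * complex_of_real (gauss \<tau> \<xi>) * cis ((x + h *\<^sub>R axis l 1) \<bullet> \<xi>))" for h
      using m \<tau> by (intro integrable_multiplier_gauss[where C=C and k=0]) auto
    show "integrable lborel (\<lambda>\<xi>::real^'n. C * (norm \<xi> ^ 1 * gauss \<tau> \<xi>))"
      using \<tau> by (intro integrable_mult_right integrable_norm_power_gauss)
    show "(\<lambda>\<xi>. \<i> * complex_of_real (\<xi> $ l) * m \<xi> * complex_of_real (gauss \<tau> \<xi>) * cis ((x + h *\<^sub>R axis l 1) \<bullet> \<xi>))
        \<in> borel_measurable lborel" for h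
      by measurable
    fix h and \<xi> :: "real ^ 'n"
    have "((\<lambda>h. cis (x \<bullet> \<xi> + h * \<xi> $ l)) has_vector_derivative \<i> * complex_of_real (\<xi> $ l) * cis (x \<bullet> \<xi> + h * \<xi> $ l)) (at h)"
      unfolding cis_conv_exp
      by (rule derivative_eq_intros refl has_vector_derivative_real_field | simp)+
    from has_vector_derivative_mult_right[OF this, of "m \<xi> * complex_of_real (gauss \<tau> \<xi>)"]
    show "((\<lambda>h. m \<xi> * complex_of_real (gauss \<tau> \<xi>) * cis ((x + h *\<^sub>R axis l 1) \<bullet> \<xi>)) has_vector_derivative
        \<i> * complex_of_real (\<xi> $ l) * m \<xi> * complex_of_real (gauss \<tau> \<xi>) * cis ((x + h *\<^sub>R axis l 1) \<bullet> \<xi>)) (at h)"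
      by (simp add: inner_add_left inner_axis' mult_ac)
    show "norm (\<i> * complex_of_real (\<xi> $ l) * m \<xi> * complex_of_real (gauss \<tau> \<xi>) * cis ((x + h *\<^sub>R axis l 1) \<bullet> \<xi>))
        \<le> C * (norm \<xi> ^ 1 * gauss \<tau> \<xi>)"
      using m1[of \<xi>] by (simp add: norm_mult mult.assoc[symmetric] mult_right_mono)
  qed
  then have "((\<lambda>h. multiplier_kernel m \<tau> (x + h *\<^sub>R axis l 1)) has_vector_derivative
     multiplier_kernel (\<lambda>\<xi>. \<i> * complex_of_real (\<xi> $ l) * m \<xi>) \<tau> x) (at 0)"
    unfolding multiplier_kernel_def by (intro has_vector_derivative_mult_right) simp
  then show ?thesis unfolding partial_deriv_def by (rule vector_derivative_at)
qed

lemma borel_measurable_multiplier_kernel [measurable]: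
  assumes [measurable]: "m \<in> borel_measurable borel" "f \<in> borel_measurable M" "g \<in> borel_measurable M"
  shows "(\<lambda>p. multiplier_kernel m (f p) (g p)) \<in> borel_measurable M"
  unfolding multiplier_kernel_def by measurable

lemma sqrt_plus_le_two_sqrt:
  fixes b c r :: real
  assumes "0 < r" "r / 2 \<le> c"
  shows "sqrt r + b \<le> 2 * sqrt (c + b\<^sup>2)"
proof (rule power2_le_imp_le)
  have "2 * sqrt r * b \<le> r + b\<^sup>2"
    using sum_squares_bound[of "sqrt r" b] assms by simp
  moreover have "(sqrt r + b)\<^sup>2 = r + b\<^sup>2 + 2 * sqrt r * b"
    using assms by (simp add: power2_sum)
  moreover have "(2 * sqrt (c + b\<^sup>2))\<^sup>2 = 4 * c + 4 * b\<^sup>2" "0 \<le> b\<^sup>2"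
    using assms by (simp_all add: power_mult_distrib)
  ultimately show "(sqrt r + b)\<^sup>2 \<le> (2 * sqrt (c + b\<^sup>2))\<^sup>2" using assms by linarith
qed (use assms in simp)

text \<open>
  With \<open>q = \<surd>s\<close> and \<open>Q = \<surd>(s + b\<^sup>2)\<close> the exponential is at most a multiple of \<open>(q / Q)^(2N)\<close>, since
  \<open>1 + b\<^sup>2/(8s)\<close> is at least \<open>(Q / q)^2 / 8\<close>. As \<open>q \<le> Q\<close>, this turns \<open>(1/q)^N\<close> into \<open>(1/Q)^N\<close>.
\<close>
lemma gauss_le_inverse_power:
  "\<exists>C>0. \<forall>s>0. \<forall>b::real. (1 / sqrt s) ^ N * exp (- b\<^sup>2 / (8 * s)) \<le> C * (1 / sqrt (s + b\<^sup>2)) ^ N"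
proof (intro exI[of _ "8 ^ N * (fact N * exp 1)"] conjI allI impI)
  show "0 < 8 ^ N * (fact N * exp (1::real))" by simp
  fix s b :: real assume s: "s > 0"
  define y where "y = b\<^sup>2 / (8 * s)"
  define q where "q = sqrt s"
  define Q where "Q = sqrt (s + b\<^sup>2)"
  have y: "y \<ge> 0" using s by (simp add: y_def)
  have q: "q > 0" "q\<^sup>2 = s" and Q: "Q > 0" "Q\<^sup>2 = s + b\<^sup>2" and "q \<le> Q"
    using s by (auto simp: q_def Q_def add_pos_nonneg)
  have "(1 + y) ^ N * exp (- (1 + y)) \<le> fact N"
    using y by (intro power_mult_exp_minus_le) auto
  then have "(1 + y) ^ N * exp (- y) \<le> fact N * exp 1"
    by (simp add: exp_diff exp_minus field_simps)
  moreover have "Q\<^sup>2 / (8 * q\<^sup>2) \<le> 1 + y" unfolding q Q y_def using s by (simp add: field_simps)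
  then have "(Q\<^sup>2 / (8 * q\<^sup>2)) ^ N * exp (- y) \<le> (1 + y) ^ N * exp (- y)"
    by (intro mult_right_mono power_mono) auto
  ultimately have 1: "(Q\<^sup>2 / (8 * q\<^sup>2)) ^ N * exp (- y) \<le> fact N * exp 1" by linarith
  have "(1 / q) ^ N * exp (- y) = (8 * q / Q\<^sup>2) ^ N * ((Q\<^sup>2 / (8 * q\<^sup>2)) ^ N * exp (- y))"
  proof -
    have "(8 * q / Q\<^sup>2) * (Q\<^sup>2 / (8 * q\<^sup>2)) = 1 / q"
      using q(1) Q(1) by (simp add: power2_eq_square)
    then have "(1 / q) ^ N = (8 * q / Q\<^sup>2) ^ N * (Q\<^sup>2 / (8 * q\<^sup>2)) ^ N"
      by (simp only: power_mult_distrib[symmetric])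
    then show ?thesis by (simp only: mult.assoc)
  qed
  also have "\<dots> \<le> (8 * (1 / Q)) ^ N * (fact N * exp 1)"
  proof (rule mult_mono[OF power_mono 1])
    have "q / Q\<^sup>2 \<le> 1 / Q" using q(1) Q(1) \<open>q \<le> Q\<close> by (simp add: power2_eq_square divide_simps)
    then show "8 * q / Q\<^sup>2 \<le> 8 * (1 / Q)" by simp
  qed (use q Q in auto)
  also have "\<dots> = 8 ^ N * (fact N * exp 1) * (1 / Q) ^ N" by (simp only: power_mult_distrib mult_ac)
  finally show "(1 / sqrt s) ^ N * exp (- b\<^sup>2 / (8 * s)) \<le> 8 ^ N * (fact N * exp 1) * (1 / sqrt (s + b\<^sup>2)) ^ N"
    by (simp add: q_def Q_def y_def)
qed

lemma nn_integral_inverse_power_tail: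
  fixes b \<tau> :: real
  assumes \<tau>: "\<tau> > 0"
  shows "(\<integral>\<^sup>+s. ennreal ((1 / sqrt (s + b\<^sup>2)) ^ (N + 3)) * indicator {\<tau>..} s \<partial>lborel)
     = ennreal (2 / (real N + 1) * (1 / sqrt (\<tau> + b\<^sup>2)) ^ (N + 1))"
proof -
  let ?F = "\<lambda>s. - (2 / (N + 1)) * (1 / sqrt (s + b\<^sup>2)) ^ (N + 1)"
  have pos: "s + b\<^sup>2 > 0" if "\<tau> \<le> s" for s
    using \<tau> that by (intro add_pos_nonneg) auto
  have "(\<integral>\<^sup>+s. ennreal ((1 / sqrt (s + b\<^sup>2)) ^ (N + 3)) * indicator {\<tau>..} s \<partial>lborel) = ennreal (0 - ?F \<tau>)"
  proof (rule nn_integral_FTC_atLeast)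
    show "(\<lambda>s. (1 / sqrt (s + b\<^sup>2)) ^ (N + 3)) \<in> borel_measurable borel" by measurable
    fix s assume "\<tau> \<le> s"
    note s = pos[OF this]
    then show "0 \<le> (1 / sqrt (s + b\<^sup>2)) ^ (N + 3)" by simp
    define q where "q = sqrt (s + b\<^sup>2)"
    have q: "q > 0" using s by (simp add: q_def)
    have "((\<lambda>s. 1 / sqrt (s + b\<^sup>2)) has_real_derivative - (inverse q / 2) / (q * q)) (at s)"
      unfolding q_def using s by (auto intro!: derivative_eq_intros)
    from DERIV_power[OF this, of "N + 1"]
    have "((\<lambda>s. (1 / sqrt (s + b\<^sup>2)) ^ (N + 1)) has_real_derivative real (N + 1) * (1 / q) ^ N * (- (inverse q / 2) / (q * q))) (at s)"
      by (simp add: q_def mult_ac)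
    from DERIV_cmult[OF this, of "- (2 / (N + 1))"]
    have "(?F has_real_derivative - (2 / (N + 1)) * (real (N + 1) * (1 / q) ^ N * (- (inverse q / 2) / (q * q)))) (at s)" .
    also have "- (2 / (N + 1)) * (real (N + 1) * (1 / q) ^ N * (- (inverse q / 2) / (q * q))) = (1 / q) ^ (N + 3)"
    proof -
      have "2 / real (N + 1) * real (N + 1) = 2"
        by (subst times_divide_eq_left, rule nonzero_mult_div_cancel_right) simp
      then have "2 / real (N + 1) * (real (N + 1) * (1 / q) ^ N * (inverse q / 2 / (q * q))) = 2 * ((1 / q) ^ N * (inverse q / 2 / (q * q)))"
        by (simp only: mult.assoc[symmetric])
      also have "\<dots> = (1 / q) ^ (N + 3)"
        by (simp only: power_add power3_eq_cube divide_inverse mult_1_left inverse_mult_distrib) (simp add: mult_ac)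
      finally show ?thesis by simp
    qed
    finally show "(?F has_real_derivative (1 / sqrt (s + b\<^sup>2)) ^ (N + 3)) (at s)" by (simp add: q_def)
  next
    have "((\<lambda>s. 1 / sqrt (s + b\<^sup>2)) \<longlongrightarrow> 0) at_top"
      by (rule tendsto_divide_0[OF tendsto_const])
         (auto intro!: filterlim_at_top_imp_at_infinity filterlim_compose[OF sqrt_at_top] filterlim_tendsto_add_at_top[OF tendsto_const] filterlim_ident simp: add.commute[of _ "b\<^sup>2"])
    then have "(?F \<longlongrightarrow> - (2 / (N + 1)) * 0 ^ (N + 1)) at_top"
      by (intro tendsto_mult tendsto_power tendsto_const)
    then show "(?F \<longlongrightarrow> 0) at_top" by simp
  qed
  then show ?thesis by (simp add: add.commute[of "real N" 1])
qed

lemma has_bochner_integral_exp_tail: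
  assumes "r > 0"
  shows "has_bochner_integral lborel (\<lambda>s. indicator {\<tau>..} s * exp (- s * r)) (exp (- \<tau> * r) / r :: real)"
proof (rule has_bochner_integral_nn_integral)
  have "(\<integral>\<^sup>+s. ennreal (exp (- s * r)) * indicator {\<tau>..} s \<partial>lborel) = ennreal (0 - (- exp (- \<tau> * r) / r))"
  proof (rule nn_integral_FTC_atLeast)
    show "((\<lambda>s. - exp (- s * r) / r) has_real_derivative exp (- s * r)) (at s)" for s
      using assms by (auto intro!: derivative_eq_intros)
    have "((\<lambda>s. exp (- (s * r))) \<longlongrightarrow> 0) at_top"
      using assms by (intro filterlim_compose[OF exp_at_bot] filterlim_compose[OF filterlim_uminus_at_bot_at_top] filterlim_at_top_mult_tendsto_pos[OF tendsto_const] filterlim_ident)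
    then have "((\<lambda>s. - exp (- (s * r)) / r) \<longlongrightarrow> - 0 / r) at_top"
      using assms by (intro tendsto_intros) auto
    then show "((\<lambda>s. - exp (- s * r) / r) \<longlongrightarrow> 0) at_top" by simp
  qed auto
  then show "(\<integral>\<^sup>+s. ennreal (indicator {\<tau>..} s * exp (- s * r)) \<partial>lborel) = ennreal (exp (- \<tau> * r) / r)"
    by (auto simp: ennreal_mult' ennreal_indicator mult.commute intro!: nn_integral_cong)
qed (use assms in auto)

lemma has_bochner_integral_exp_tail_open:
  assumes "r > 0"
  shows "has_bochner_integral lborel (\<lambda>s. indicator {\<tau><..} s * exp (- s * r)) (exp (- \<tau> * r) / r :: real)"
proof -
  have "AE s in lborel. s \<noteq> \<tau>" by (rule AE_lborel_singleton)
  then have "AE s in lborel. indicator {\<tau>..} s * exp (- s * r) = indicator {\<tau><..} s * exp (- s * r)"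
    by (rule AE_mp) (rule AE_I2, auto simp: indicator_def)
  from has_bochner_integral_cong_AE[THEN iffD1, OF _ _ this has_bochner_integral_exp_tail[OF assms]]
  show ?thesis by simp
qed

lemma abs_leray_symbol_le: "\<bar>leray_symbol j k \<xi>\<bar> \<le> 1"
proof (cases "\<xi> = 0")
  case True
  then show ?thesis by (simp add: leray_symbol_def)
next
  case False
  have *: "\<bar>\<xi> $ j * \<xi> $ k\<bar> \<le> (norm \<xi>)\<^sup>2"
    unfolding abs_mult power2_eq_square by (intro mult_mono component_le_norm_cart) auto
  then have 1: "\<bar>\<xi> $ j * \<xi> $ k / (norm \<xi>)\<^sup>2\<bar> \<le> 1"
    using False by (simp add: divide_le_eq)
  show ?thesis
  proof (cases "j = k")
    case True
    then have "0 \<le> \<xi> $ j * \<xi> $ k / (norm \<xi>)\<^sup>2" by simp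
    with 1 True show ?thesis unfolding leray_symbol_def by simp
  qed (use 1 in \<open>simp add: leray_symbol_def\<close>)
qed

lemma borel_measurable_leray_symbol [measurable]: "leray_symbol j k \<in> borel_measurable borel"
  unfolding leray_symbol_def[abs_def] by measurable

lemma prod_power_of_bool: "(\<Prod>i\<in>UNIV. (\<xi> :: real ^ 'n::finite) $ i ^ of_bool (i = l)) = \<xi> $ l"
proof -
  have "(\<Prod>i\<in>UNIV. \<xi> $ i ^ of_bool (i = l)) = (\<Prod>i\<in>UNIV. if i = l then \<xi> $ i else 1)"
    by (intro prod.cong) auto
  then show ?thesis by simp
qed

definition oseen_symbol :: "'n::finite \<Rightarrow> 'n \<Rightarrow> 'n \<Rightarrow> real ^ 'n \<Rightarrow> complex" where
  "oseen_symbol j k l \<xi> = \<i> * complex_of_real (\<xi> $ l) * complex_of_real (leray_symbol j k \<xi>)"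

lemma borel_measurable_oseen_symbol [measurable]: "oseen_symbol j k l \<in> borel_measurable borel"
  unfolding oseen_symbol_def[abs_def] by measurable

lemma norm_oseen_symbol_le: "norm (oseen_symbol j k l \<xi>) \<le> norm \<xi>"
  using mult_mono[OF component_le_norm_cart[of \<xi> l] abs_leray_symbol_le[of j k \<xi>]]
  by (simp add: oseen_symbol_def norm_mult)

abbreviation oseen_gradient :: "'n::finite \<Rightarrow> 'n \<Rightarrow> 'n \<Rightarrow> real \<Rightarrow> real ^ 'n \<Rightarrow> complex" where
  "oseen_gradient j k l \<equiv> multiplier_kernel (oseen_symbol j k l)"

lemma partial_deriv_oseen_kernel:
  assumes "\<tau> > 0"
  shows "partial_deriv l (oseen_kernel \<tau> j k) x = multiplier_kernel (oseen_symbol j k l) \<tau> x"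
  unfolding oseen_kernel_eq_multiplier_kernel oseen_symbol_def[abs_def]
  using assms abs_leray_symbol_le by (intro partial_deriv_multiplier_kernel) auto

text \<open>
  The factor \<open>1/|\<xi>|\<^sup>2\<close> of the Leray symbol is not smooth at the origin. Writing
  \<open>exp(-\<tau>|\<xi>|\<^sup>2) / |\<xi>|\<^sup>2\<close> as the integral of \<open>exp(-s|\<xi>|\<^sup>2)\<close> over \<open>s \<ge> \<tau>\<close> trades it for third
  derivatives of heat kernels at later times, all of which have Gaussian decay.
\<close>
lemma oseen_correction_eq_heat_tail:
  fixes x :: "real ^ 'n::finite"
  assumes \<tau>: "\<tau> > 0"
  shows "(LINT \<xi>|lborel. complex_of_real (\<xi> $ l * (\<xi> $ j * \<xi> $ k) / (norm \<xi>)\<^sup>2 * gauss \<tau> \<xi>) * cis (x \<bullet> \<xi>))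
    = (LINT s|lborel. indicator {\<tau>..} s *\<^sub>R (LINT \<xi>|lborel. complex_of_real (\<xi> $ l * (\<xi> $ j * \<xi> $ k) * gauss s \<xi>) * cis (x \<bullet> \<xi>)))"
proof -
  define c where "c \<xi> = \<xi> $ l * (\<xi> $ j * \<xi> $ k)" for \<xi> :: "real ^ 'n"
  have [measurable]: "c \<in> borel_measurable borel" unfolding c_def[abs_def] by measurable
  have c0: "c 0 = 0" by (simp add: c_def)
  have c: "\<bar>c \<xi>\<bar> \<le> norm \<xi> ^ 3" for \<xi>
  proof -
    have "\<bar>\<xi> $ l\<bar> * (\<bar>\<xi> $ j\<bar> * \<bar>\<xi> $ k\<bar>) \<le> norm \<xi> * (norm \<xi> * norm \<xi>)"
      by (intro mult_mono component_le_norm_cart) auto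
    then show ?thesis by (simp add: c_def abs_mult eval_nat_numeral)
  qed
  define f where "f \<xi> s = indicator {\<tau>..} s *\<^sub>R (complex_of_real (c \<xi> * gauss s \<xi>) * cis (x \<bullet> \<xi>))" for \<xi> :: "real ^ 'n" and s
  have norm_f: "norm (f \<xi> s) = \<bar>c \<xi>\<bar> * (indicator {\<tau>..} s * gauss s \<xi>)" for \<xi> s
    by (simp add: f_def norm_mult abs_mult)
  have tail: "has_bochner_integral lborel (\<lambda>s. \<bar>c \<xi>\<bar> * (indicator {\<tau>..} s * gauss s \<xi>)) (\<bar>c \<xi>\<bar> * (gauss \<tau> \<xi> / (norm \<xi>)\<^sup>2))" for \<xi>
  proof (cases "\<xi> = 0")
    case False
    then show ?thesis by (intro has_bochner_integral_mult_right has_bochner_integral_exp_tail) auto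
  qed (auto simp: c0 intro: has_bochner_integral_zero)
  have meas: "case_prod f \<in> borel_measurable (lborel \<Otimes>\<^sub>M lborel)"
    unfolding f_def[abs_def] by measurable
  have int: "integrable (lborel \<Otimes>\<^sub>M lborel) (case_prod f)"
  proof (rule lborel_pair.Fubini_integrable[OF meas])
    have "integrable lborel (\<lambda>\<xi>::real^'n. \<bar>c \<xi>\<bar> * (gauss \<tau> \<xi> / (norm \<xi>)\<^sup>2))"
    proof (rule Bochner_Integration.integrable_bound[OF integrable_norm_power_gauss[OF \<tau>, of 1]])
      show "AE \<xi> in lborel. norm (\<bar>c \<xi>\<bar> * (gauss \<tau> \<xi> / (norm \<xi>)\<^sup>2)) \<le> norm (norm \<xi> ^ 1 * gauss \<tau> \<xi>)"
      proof (rule AE_I2)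
        fix \<xi> :: "real ^ 'n"
        have "\<bar>c \<xi>\<bar> / (norm \<xi>)\<^sup>2 \<le> norm \<xi>"
          using c[of \<xi>] by (cases "\<xi> = 0") (simp_all add: c0 divide_le_eq eval_nat_numeral)
        then have "\<bar>c \<xi>\<bar> / (norm \<xi>)\<^sup>2 * gauss \<tau> \<xi> \<le> norm \<xi> * gauss \<tau> \<xi>"
          by (rule mult_right_mono) simp
        then show "norm (\<bar>c \<xi>\<bar> * (gauss \<tau> \<xi> / (norm \<xi>)\<^sup>2)) \<le> norm (norm \<xi> ^ 1 * gauss \<tau> \<xi>)"
          by simp
      qed
    qed measurable
    then show "integrable lborel (\<lambda>\<xi>. LINT s|lborel. norm (case_prod f (\<xi>, s)))"
      unfolding prod.case norm_f has_bochner_integral_integral_eq[OF tail] .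
    have "integrable lborel (\<lambda>s. f \<xi> s)" for \<xi>
      using tail[of \<xi>, THEN integrable.intros] unfolding norm_f[symmetric]
      by (rule integrable_norm_cancel) (simp add: f_def)
    then show "AE \<xi> in lborel. integrable lborel (\<lambda>s. case_prod f (\<xi>, s))" by simp
  qed
  have "(LINT s|lborel. f \<xi> s) = complex_of_real (c \<xi> / (norm \<xi>)\<^sup>2 * gauss \<tau> \<xi>) * cis (x \<bullet> \<xi>)" for \<xi>
  proof (cases "\<xi> = 0")
    case False
    have "(\<lambda>s. f \<xi> s) = (\<lambda>s. complex_of_real (indicator {\<tau>..} s * gauss s \<xi>) * (complex_of_real (c \<xi>) * cis (x \<bullet> \<xi>)))"
      by (auto simp: f_def scaleR_conv_of_real mult_ac)
    then have "(LINT s|lborel. f \<xi> s) = complex_of_real (LINT s|lborel. indicator {\<tau>..} s * gauss s \<xi>) * (complex_of_real (c \<xi>) * cis (x \<bullet> \<xi>))"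
      by (simp only: integral_mult_left_zero integral_complex_of_real)
    also have "(LINT s|lborel. indicator {\<tau>..} s * gauss s \<xi>) = gauss \<tau> \<xi> / (norm \<xi>)\<^sup>2"
      using False by (intro has_bochner_integral_integral_eq has_bochner_integral_exp_tail) auto
    finally show ?thesis by (simp add: mult_ac)
  qed (simp add: f_def c0)
  then have "(LINT \<xi>|lborel. complex_of_real (c \<xi> / (norm \<xi>)\<^sup>2 * gauss \<tau> \<xi>) * cis (x \<bullet> \<xi>)) = (LINT \<xi>|lborel. LINT s|lborel. f \<xi> s)"
    by simp
  also have "\<dots> = (LINT s|lborel. LINT \<xi>|lborel. f \<xi> s)"
    using lborel_pair.Fubini_integral[OF int] by simp
  also have "\<dots> = (LINT s|lborel. indicator {\<tau>..} s *\<^sub>R (LINT \<xi>|lborel. complex_of_real (c \<xi> * gauss s \<xi>) * cis (x \<bullet> \<xi>)))"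
    unfolding f_def by simp
  finally show ?thesis unfolding c_def .
qed

text \<open>
  The term with \<open>\<delta>\<^sub>j\<^sub>k\<close> is a derivative of the heat kernel and decays like a Gaussian. In the other term
  the times \<open>s\<close> of order \<open>|x|\<^sup>2\<close> dominate, and integrating \<open>(s + |x|\<^sup>2)^(-(n+3)/2)\<close> over \<open>s \<ge> \<tau>\<close> leaves
  the decay of order \<open>n + 1\<close>.
\<close>
lemma norm_oseen_gradient_le:
  "\<exists>C>0. \<forall>\<tau>>0. \<forall>x::real^'n::finite. norm (multiplier_kernel (oseen_symbol j k l) \<tau> x) \<le> C / (sqrt \<tau> + norm x) ^ (CARD('n) + 1)"
proof -
  let ?n = "CARD('n)"
  define I1 where "I1 s x = (LINT \<xi>|lborel. complex_of_real (\<xi> $ l * gauss s \<xi>) * cis (x \<bullet> \<xi>))" for s and x :: "real ^ 'n"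
  define I3 where "I3 s x = (LINT \<xi>|lborel. complex_of_real (\<xi> $ l * (\<xi> $ j * \<xi> $ k) * gauss s \<xi>) * cis (x \<bullet> \<xi>))" for s and x :: "real ^ 'n"
  have sum1: "(\<Sum>i\<in>UNIV. of_bool (i = l)) = (1::nat)" for l :: 'n by (simp add: of_bool_def)
  have I1_bound: "\<exists>C>0. \<forall>s>0. \<forall>x. norm (I1 s x) \<le> C * (1 / sqrt s) ^ (?n + 1) * exp (- (norm x)\<^sup>2 / (8 * s))"
    using gauss_monomial_bound[of "\<lambda>i. of_bool (i = l)"]
    unfolding prod_power_of_bool sum1 I1_def[symmetric] add.commute[of 1 ?n] .
  then obtain C1 where C1: "C1 > 0" "\<And>s x. s > 0 \<Longrightarrow> norm (I1 s x) \<le> C1 * (1 / sqrt s) ^ (?n + 1) * exp (- (norm x)\<^sup>2 / (8 * s))"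
    by metis
  let ?\<alpha> = "\<lambda>i. of_bool (i = l) + (of_bool (i = j) + of_bool (i = k)) :: nat"
  have "(\<Prod>i\<in>UNIV. \<xi> $ i ^ ?\<alpha> i) = \<xi> $ l * (\<xi> $ j * \<xi> $ k)" for \<xi> :: "real ^ 'n"
    unfolding power_add prod.distrib prod_power_of_bool ..
  moreover have "(\<Sum>i\<in>UNIV. ?\<alpha> i) + ?n = ?n + 3"
    unfolding sum.distrib sum1 by simp
  ultimately have I3_bound: "\<exists>C>0. \<forall>s>0. \<forall>x. norm (I3 s x) \<le> C * (1 / sqrt s) ^ (?n + 3) * exp (- (norm x)\<^sup>2 / (8 * s))"
    using gauss_monomial_bound[of ?\<alpha>] by (simp only: I3_def)
  then obtain C3 where C3: "C3 > 0" "\<And>s x. s > 0 \<Longrightarrow> norm (I3 s x) \<le> C3 * (1 / sqrt s) ^ (?n + 3) * exp (- (norm x)\<^sup>2 / (8 * s))"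
    by metis
  obtain D1 where D1: "D1 > 0" "\<And>s b. s > 0 \<Longrightarrow> (1 / sqrt s) ^ (?n + 1) * exp (- b\<^sup>2 / (8 * s)) \<le> D1 * (1 / sqrt (s + b\<^sup>2)) ^ (?n + 1)"
    using gauss_le_inverse_power[of "?n + 1"] by metis
  obtain D3 where D3: "D3 > 0" "\<And>s b. s > 0 \<Longrightarrow> (1 / sqrt s) ^ (?n + 3) * exp (- b\<^sup>2 / (8 * s)) \<le> D3 * (1 / sqrt (s + b\<^sup>2)) ^ (?n + 3)"
    using gauss_le_inverse_power[of "?n + 3"] by metis
  define C where "C = C1 * D1 + C3 * D3 * (2 / (real ?n + 1))"
  have C: "C > 0" unfolding C_def using C1(1) C3(1) D1(1) D3(1) by (intro add_pos_nonneg) auto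
  show ?thesis
  proof (intro exI[of _ "C * 2 ^ (?n + 1)"] conjI allI impI)
    show "0 < C * 2 ^ (?n + 1)" using C by simp
    fix \<tau> :: real and x :: "real ^ 'n" assume \<tau>: "\<tau> > 0"
    define L where "L = (LINT \<xi>|lborel. complex_of_real (\<xi> $ l * (\<xi> $ j * \<xi> $ k) / (norm \<xi>)\<^sup>2 * gauss \<tau> \<xi>) * cis (x \<bullet> \<xi>))"
    have I1_le: "norm (I1 \<tau> x) \<le> C1 * (D1 * (1 / sqrt (\<tau> + (norm x)\<^sup>2)) ^ (?n + 1))"
      using order.trans[OF C1(2)[OF \<tau>, of x, unfolded mult.assoc] mult_left_mono[OF D1(2)[OF \<tau>, of "norm x"]]] C1(1) by auto
    have "ennreal (norm L) \<le> (\<integral>\<^sup>+s. ennreal (norm (indicator {\<tau>..} s *\<^sub>R I3 s x)) \<partial>lborel)"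
      unfolding L_def oseen_correction_eq_heat_tail[OF \<tau>] I3_def by (rule norm_integral_le_nn_integral)
    also have "\<dots> \<le> (\<integral>\<^sup>+s. ennreal (C3 * D3) * (ennreal ((1 / sqrt (s + (norm x)\<^sup>2)) ^ (?n + 3)) * indicator {\<tau>..} s) \<partial>lborel)"
    proof (intro nn_integral_mono)
      fix s
      show "ennreal (norm (indicator {\<tau>..} s *\<^sub>R I3 s x)) \<le> ennreal (C3 * D3) * (ennreal ((1 / sqrt (s + (norm x)\<^sup>2)) ^ (?n + 3)) * indicator {\<tau>..} s)"
      proof (cases "\<tau> \<le> s")
        case True
        then have s: "s > 0" using \<tau> by simp
        have "norm (I3 s x) \<le> C3 * (D3 * (1 / sqrt (s + (norm x)\<^sup>2)) ^ (?n + 3))"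
          using order.trans[OF C3(2)[OF s, of x, unfolded mult.assoc] mult_left_mono[OF D3(2)[OF s, of "norm x"]]] C3(1) by auto
        then show ?thesis
          using True C3(1) D3(1) s by (simp add: ennreal_mult[symmetric] ennreal_leI mult.assoc)
      qed simp
    qed
    also have "\<dots> = ennreal (C3 * D3) * ennreal (2 / (real ?n + 1) * (1 / sqrt (\<tau> + (norm x)\<^sup>2)) ^ (?n + 1))"
      by (subst nn_integral_cmult) (simp_all only: nn_integral_inverse_power_tail[OF \<tau>], measurable)
    also have "\<dots> = ennreal (C3 * D3 * (2 / (real ?n + 1)) * (1 / sqrt (\<tau> + (norm x)\<^sup>2)) ^ (?n + 1))"
      using C3(1) D3(1) \<tau> by (simp add: ennreal_mult[symmetric] mult_ac)
    finally have L_le: "norm L \<le> C3 * D3 * (2 / (real ?n + 1)) * (1 / sqrt (\<tau> + (norm x)\<^sup>2)) ^ (?n + 1)"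
      using C3(1) D3(1) \<tau> by (subst (asm) ennreal_le_iff) auto
    have "(LINT \<xi>|lborel. oseen_symbol j k l \<xi> * complex_of_real (gauss \<tau> \<xi>) * cis (x \<bullet> \<xi>))
       = (LINT \<xi>|lborel. \<i> * (of_bool (j = k) * (complex_of_real (\<xi> $ l * gauss \<tau> \<xi>) * cis (x \<bullet> \<xi>))
           - complex_of_real (\<xi> $ l * (\<xi> $ j * \<xi> $ k) / (norm \<xi>)\<^sup>2 * gauss \<tau> \<xi>) * cis (x \<bullet> \<xi>)))"
      by (intro Bochner_Integration.integral_cong) (auto simp: oseen_symbol_def leray_symbol_def algebra_simps)
    also have "\<dots> = \<i> * (of_bool (j = k) * I1 \<tau> x - L)"
    proof -
      have int1: "integrable lborel (\<lambda>\<xi>. complex_of_real (\<xi> $ l * gauss \<tau> \<xi>) * cis (x \<bullet> \<xi>))"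
        using integrable_multiplier_gauss[of "\<lambda>\<xi>. complex_of_real (\<xi> $ l)" "\<lambda>\<xi>. x \<bullet> \<xi>" 1 1 \<tau>] \<tau>
        by (simp add: component_le_norm_cart)
      have int3: "integrable lborel (\<lambda>\<xi>. complex_of_real (\<xi> $ l * (\<xi> $ j * \<xi> $ k) / (norm \<xi>)\<^sup>2 * gauss \<tau> \<xi>) * cis (x \<bullet> \<xi>))"
      proof -
        have "norm (complex_of_real (\<xi> $ l * (\<xi> $ j * \<xi> $ k) / (norm \<xi>)\<^sup>2)) \<le> 1 * norm \<xi> ^ 1" for \<xi> :: "real ^ 'n"
        proof (cases "\<xi> = 0")
          case False
          have "\<bar>\<xi> $ l\<bar> * (\<bar>\<xi> $ j\<bar> * \<bar>\<xi> $ k\<bar>) \<le> norm \<xi> * (norm \<xi> * norm \<xi>)"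
            by (intro mult_mono component_le_norm_cart) auto
          with False show ?thesis
            by (simp only: norm_of_real) (simp add: abs_mult divide_le_eq power2_eq_square)
        qed simp
        from integrable_multiplier_gauss[OF _ _ this, of "\<lambda>\<xi>. x \<bullet> \<xi>" \<tau>] show ?thesis using \<tau> by (simp add: mult_ac)
      qed
      show ?thesis
        unfolding I1_def L_def
        by (simp only: integral_mult_right_zero Bochner_Integration.integral_diff[OF integrable_mult_right[OF int1] int3])
    qed
    finally have "norm (LINT \<xi>|lborel. oseen_symbol j k l \<xi> * complex_of_real (gauss \<tau> \<xi>) * cis (x \<bullet> \<xi>))
       = norm (of_bool (j = k) * I1 \<tau> x - L)" by (simp only: norm_mult norm_ii mult_1)
    also have "\<dots> \<le> norm (I1 \<tau> x) + norm L"
      by (rule order.trans[OF norm_triangle_ineq4]) (simp add: norm_mult)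
    also have "\<dots> \<le> C * (1 / sqrt (\<tau> + (norm x)\<^sup>2)) ^ (?n + 1)"
      using add_mono[OF I1_le L_le] unfolding C_def by (simp only: distrib_right mult.assoc)
    finally have 1: "norm (LINT \<xi>|lborel. oseen_symbol j k l \<xi> * complex_of_real (gauss \<tau> \<xi>) * cis (x \<bullet> \<xi>))
       \<le> C * (1 / sqrt (\<tau> + (norm x)\<^sup>2)) ^ (?n + 1)" .
    have "1 \<le> (2 * pi) ^ ?n" using pi_ge_two by (intro one_le_power) linarith
    then have "norm (complex_of_real (1 / (2 * pi) ^ ?n)) \<le> 1"
      by (simp only: norm_of_real) (simp add: divide_le_eq)
    then have "norm (multiplier_kernel (oseen_symbol j k l) \<tau> x) \<le> norm (LINT \<xi>|lborel. oseen_symbol j k l \<xi> * complex_of_real (gauss \<tau> \<xi>) * cis (x \<bullet> \<xi>))"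
      unfolding multiplier_kernel_def norm_mult by (intro mult_left_le_one_le) auto
    also note 1
    also have "C * (1 / sqrt (\<tau> + (norm x)\<^sup>2)) ^ (?n + 1) \<le> C * (2 / (sqrt \<tau> + norm x)) ^ (?n + 1)"
    proof (intro mult_left_mono power_mono)
      have "sqrt \<tau> + norm x \<le> 2 * sqrt (\<tau> + (norm x)\<^sup>2)"
        using \<tau> by (intro sqrt_plus_le_two_sqrt) auto
      moreover have "sqrt \<tau> + norm x > 0" "sqrt (\<tau> + (norm x)\<^sup>2) > 0" using \<tau> by (auto intro!: add_pos_nonneg)
      ultimately show "1 / sqrt (\<tau> + (norm x)\<^sup>2) \<le> 2 / (sqrt \<tau> + norm x)" by (simp add: field_simps)
    qed (use C \<tau> in auto)
    finally show "norm (multiplier_kernel (oseen_symbol j k l) \<tau> x) \<le> C * 2 ^ (?n + 1) / (sqrt \<tau> + norm x) ^ (?n + 1)"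
      by (simp add: power_divide)
  qed
qed

section \<open>Averaging against polynomially decaying weights\<close>

lemma nn_integral_inverse_power_atLeast:
  assumes a: "a > 0"
  shows "(\<integral>\<^sup>+r. ennreal (real (k + 1) * inverse r ^ (k + 2)) * indicator {a..} r \<partial>lborel) = ennreal (inverse a ^ (k + 1))"
proof -
  have "(\<integral>\<^sup>+r. ennreal (real (k + 1) * inverse r ^ (k + 2)) * indicator {a..} r \<partial>lborel) = ennreal (0 - (- (inverse a ^ (k + 1))))"
  proof (rule nn_integral_FTC_atLeast)
    fix r assume "a \<le> r"
    with a have r: "r > 0" by simp
    show "0 \<le> real (k + 1) * inverse r ^ (k + 2)" using r by simp
    have "((\<lambda>r. inverse r) has_real_derivative - (inverse r * inverse r)) (at r)"
      using r by (auto intro!: derivative_eq_intros)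
    from DERIV_minus[OF DERIV_power[OF this, of "k + 1"]] show "((\<lambda>r. - (inverse r ^ (k + 1))) has_real_derivative real (k + 1) * inverse r ^ (k + 2)) (at r)"
      by (simp add: mult_ac)
  next
    have "((\<lambda>r::real. - (inverse r ^ (k + 1))) \<longlongrightarrow> - (0 ^ (k + 1))) at_top"
      by (intro tendsto_intros tendsto_inverse_0_at_top filterlim_ident)
    then show "((\<lambda>r::real. - (inverse r ^ (k + 1))) \<longlongrightarrow> 0) at_top" by simp
  qed measurable
  then show ?thesis by simp
qed

definition decay_weight :: "real \<Rightarrow> real ^ 'n::finite \<Rightarrow> real" where
  "decay_weight \<rho> x = inverse (\<rho> + norm x) ^ (CARD('n) + 1)"

lemma borel_measurable_decay_weight [measurable (raw)]:
  assumes [measurable]: "f \<in> borel_measurable M" "g \<in> borel_measurable M"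
  shows "(\<lambda>p. decay_weight (f p) (g p)) \<in> borel_measurable M"
  unfolding decay_weight_def by measurable

lemma decay_weight_nonneg: "\<rho> \<ge> 0 \<Longrightarrow> decay_weight \<rho> x \<ge> 0"
  by (simp add: decay_weight_def)

lemma decay_weight_le:
  fixes x y :: "real ^ 'n::finite"
  assumes "\<rho> > 0" "\<rho> + norm x \<le> 2 * (\<sigma> + norm y)"
  shows "decay_weight \<sigma> y \<le> 2 ^ (CARD('n) + 1) * decay_weight \<rho> x"
proof -
  have p: "\<rho> + norm x > 0" using assms(1) by (simp add: add_pos_nonneg)
  then have "inverse (\<sigma> + norm y) \<le> 2 * inverse (\<rho> + norm x)"
    using assms(2) by (simp add: field_simps)
  moreover have "0 \<le> inverse (\<sigma> + norm y)" using assms p by simp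
  ultimately have "inverse (\<sigma> + norm y) ^ (CARD('n) + 1) \<le> (2 * inverse (\<rho> + norm x)) ^ (CARD('n) + 1)"
    by (rule power_mono)
  then show ?thesis unfolding decay_weight_def power_mult_distrib .
qed

lemma one_le_decay_weight:
  fixes x :: "real ^ 'n::finite"
  assumes "\<rho> > 0" "\<rho> + norm x \<le> L"
  shows "1 \<le> ennreal (L ^ (CARD('n) + 1)) * ennreal (decay_weight \<rho> x)"
proof -
  have "\<rho> + norm x > 0" using assms(1) by (simp add: add_pos_nonneg)
  then have "1 \<le> L * inverse (\<rho> + norm x)" "L \<ge> 0" using assms(2) by (simp_all add: field_simps)
  then have "1 \<le> (L * inverse (\<rho> + norm x)) ^ (CARD('n) + 1)" by (intro one_le_power)
  then have "ennreal 1 \<le> ennreal (L ^ (CARD('n) + 1) * decay_weight \<rho> x)"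
    unfolding decay_weight_def power_mult_distrib by (rule ennreal_leI)
  then show ?thesis using \<open>L \<ge> 0\<close> assms(1) by (simp add: ennreal_mult decay_weight_nonneg del: power_Suc)
qed

text \<open>
  Layer cake: the weight is a superposition of the indicators of the balls of radius \<open>r - \<rho>\<close> with density
  \<open>(n + 1) r^(-n-2)\<close>. Their volume is at most a multiple of \<open>r^n\<close>, and the integral of \<open>r^(-2)\<close>
  over \<open>r \<ge> \<rho>\<close> is \<open>1/\<rho>\<close>.
\<close>
lemma nn_integral_decay_weight:
  fixes z :: "real ^ 'n::finite"
  assumes \<rho>: "\<rho> > 0"
  shows "(\<integral>\<^sup>+y. ennreal (decay_weight \<rho> (z - y)) \<partial>lborel)
    \<le> ennreal (real (CARD('n) + 1) * unit_ball_vol (real CARD('n)) * inverse \<rho>)"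
proof -
  let ?n = "CARD('n)" and ?V = "unit_ball_vol (real CARD('n))"
  have V: "?V \<ge> 0" using unit_ball_vol_pos[of "real ?n"] by linarith
  have layer: "ennreal (decay_weight \<rho> (z - y)) =
      (\<integral>\<^sup>+r. ennreal (real (?n + 1) * inverse r ^ (?n + 2)) * indicator {\<rho> + norm (z - y)..} r \<partial>lborel)" for y
    unfolding decay_weight_def using \<rho> by (subst nn_integral_inverse_power_atLeast) (auto simp: add_pos_nonneg)
  have "(\<integral>\<^sup>+y. ennreal (decay_weight \<rho> (z - y)) \<partial>lborel)
     = (\<integral>\<^sup>+y. \<integral>\<^sup>+r. ennreal (real (?n + 1) * inverse r ^ (?n + 2)) * indicator {\<rho>..} r * indicator (cball z (r - \<rho>)) y \<partial>lborel \<partial>lborel)"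
    unfolding layer
  proof (intro nn_integral_cong)
    fix y :: "real ^ 'n" and r :: real
    have "indicator {\<rho> + norm (z - y)..} r = (indicator {\<rho>..} r * indicator (cball z (r - \<rho>)) y :: ennreal)"
      using norm_ge_zero[of "z - y"] by (simp add: indicator_def dist_norm del: norm_ge_zero)
    then show "ennreal (real (?n + 1) * inverse r ^ (?n + 2)) * indicator {\<rho> + norm (z - y)..} r
      = ennreal (real (?n + 1) * inverse r ^ (?n + 2)) * indicator {\<rho>..} r * indicator (cball z (r - \<rho>)) y"
      by (simp only: mult.assoc)
  qed
  also have "\<dots> = (\<integral>\<^sup>+r. \<integral>\<^sup>+y. ennreal (real (?n + 1) * inverse r ^ (?n + 2)) * indicator {\<rho>..} r * indicator (cball z (r - \<rho>)) y \<partial>lborel \<partial>lborel)"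
  proof (rule lborel_pair.Fubini')
    have "{p::real \<times> (real^'n). dist z (snd p) \<le> fst p - \<rho>} \<in> sets borel"
      by (intro borel_closed closed_Collect_le continuous_intros)
    then have [measurable]: "(\<lambda>p. indicator {p::real \<times> (real^'n). dist z (snd p) \<le> fst p - \<rho>} p :: ennreal) \<in> borel_measurable (lborel \<Otimes>\<^sub>M lborel)"
      by (auto simp: lborel_prod)
    have "(\<lambda>p. ennreal (real (?n + 1) * inverse (fst p) ^ (?n + 2)) * indicator {\<rho>..} (fst p) * indicator {p::real \<times> (real^'n). dist z (snd p) \<le> fst p - \<rho>} p)
       \<in> borel_measurable (lborel \<Otimes>\<^sub>M lborel)" by measurable
    then show "(\<lambda>(r, y). ennreal (real (?n + 1) * inverse r ^ (?n + 2)) * indicator {\<rho>..} r * indicator (cball z (r - \<rho>)) y)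
       \<in> borel_measurable (lborel \<Otimes>\<^sub>M lborel)"
      by (simp add: case_prod_beta' cball_def indicator_def)
  qed
  also have "\<dots> = (\<integral>\<^sup>+r. ennreal (real (?n + 1) * inverse r ^ (?n + 2)) * indicator {\<rho>..} r * emeasure lborel (cball z (r - \<rho>)) \<partial>lborel)"
    by (intro nn_integral_cong) (simp add: nn_integral_cmult_indicator)
  also have "\<dots> \<le> (\<integral>\<^sup>+r. ennreal (real (?n + 1) * ?V) * (ennreal (real (0 + 1) * inverse r ^ (0 + 2)) * indicator {\<rho>..} r) \<partial>lborel)"
  proof (intro nn_integral_mono)
    fix r
    show "ennreal (real (?n + 1) * inverse r ^ (?n + 2)) * indicator {\<rho>..} r * emeasure lborel (cball z (r - \<rho>))
      \<le> ennreal (real (?n + 1) * ?V) * (ennreal (real (0 + 1) * inverse r ^ (0 + 2)) * indicator {\<rho>..} r)"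
    proof (cases "\<rho> \<le> r")
      case True
      with \<rho> have r: "r > 0" by simp
      have "inverse r ^ (?n + 2) * (?V * (r - \<rho>) ^ ?n) \<le> inverse r ^ (?n + 2) * (?V * r ^ ?n)"
        using True \<rho> r V by (intro mult_left_mono power_mono) auto
      also have "\<dots> = ?V * inverse r ^ 2"
        using r by (simp add: power_add power2_eq_square field_simps)
      finally have "real (?n + 1) * inverse r ^ (?n + 2) * (?V * (r - \<rho>) ^ ?n) \<le> real (?n + 1) * ?V * inverse r ^ 2"
        by (simp only: mult.assoc) (rule mult_left_mono, auto)
      then have "ennreal (real (?n + 1) * inverse r ^ (?n + 2) * (?V * (r - \<rho>) ^ ?n)) \<le> ennreal (real (?n + 1) * ?V * inverse r ^ 2)"
        by (rule ennreal_leI)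
      moreover have "ennreal (real (?n + 1) * inverse r ^ (?n + 2)) * indicator {\<rho>..} r * emeasure lborel (cball z (r - \<rho>))
         = ennreal (real (?n + 1) * inverse r ^ (?n + 2) * (?V * (r - \<rho>) ^ ?n))"
        using True r V by (simp add: emeasure_cball ennreal_mult)
      moreover have "ennreal (real (?n + 1) * ?V) * (ennreal (real (0 + 1) * inverse r ^ (0 + 2)) * indicator {\<rho>..} r)
         = ennreal (real (?n + 1) * ?V * inverse r ^ 2)"
        using True r V by (simp add: ennreal_mult power2_eq_square)
      ultimately show ?thesis by (simp only:)
    qed simp
  qed
  also have "\<dots> = ennreal (real (?n + 1) * ?V) * ennreal (inverse \<rho> ^ (0 + 1))"
    unfolding nn_integral_inverse_power_atLeast[OF \<rho>, of 0, symmetric] by (rule nn_integral_cmult) measurable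
  also have "\<dots> = ennreal (real (?n + 1) * ?V * inverse \<rho>)"
    using \<rho> V by (simp add: ennreal_mult[symmetric])
  finally show ?thesis .
qed

text \<open>
  On a ball of radius \<open>\<rho>\<close> the weight varies at most by the factor \<open>2^(n+1)\<close>, so it is dominated by its
  own averages over such balls. Exchanging the integrals transfers the average to \<open>h\<close>, where the
  hypothesis applies. This replaces a covering of the space by balls.
\<close>
lemma nn_integral_decay_weight_average:
  fixes h :: "real ^ 'n::finite \<Rightarrow> ennreal"
  assumes [measurable]: "h \<in> borel_measurable borel" and \<rho>: "\<rho> > 0"
    and A: "\<And>\<zeta>. (\<integral>\<^sup>+y. h y * indicator (ball \<zeta> \<rho>) y \<partial>lborel) \<le> A"
  shows "(\<integral>\<^sup>+y. h y * ennreal (decay_weight \<rho> (z - y)) \<partial>lborel)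
    \<le> ennreal (2 ^ (CARD('n) + 1) * real (CARD('n) + 1) * inverse \<rho> ^ (CARD('n) + 1)) * A"
proof -
  let ?n = "CARD('n)" and ?V = "unit_ball_vol (real CARD('n))"
  have V: "?V > 0" by simp
  let ?W = "\<lambda>y. ennreal (decay_weight \<rho> (z - y))"
  have vol: "emeasure lborel (ball y \<rho>) = ennreal (?V * \<rho> ^ ?n)" for y :: "real ^ 'n"
    using \<rho> by (simp add: emeasure_ball)
  have "ennreal (?V * \<rho> ^ ?n) * (\<integral>\<^sup>+y. h y * ?W y \<partial>lborel) = (\<integral>\<^sup>+y. \<integral>\<^sup>+\<zeta>. h y * ?W y * indicator (ball y \<rho>) \<zeta> \<partial>lborel \<partial>lborel)"
    by (simp add: nn_integral_cmult_indicator vol nn_integral_multc mult.commute[of "ennreal (?V * \<rho> ^ ?n)"])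
  also have "\<dots> \<le> (\<integral>\<^sup>+y. \<integral>\<^sup>+\<zeta>. ennreal (2 ^ (?n + 1)) * (?W \<zeta> * (h y * indicator (ball \<zeta> \<rho>) y)) \<partial>lborel \<partial>lborel)"
  proof (intro nn_integral_mono)
    fix y \<zeta> :: "real ^ 'n"
    show "h y * ?W y * indicator (ball y \<rho>) \<zeta> \<le> ennreal (2 ^ (?n + 1)) * (?W \<zeta> * (h y * indicator (ball \<zeta> \<rho>) y))"
    proof (cases "\<zeta> \<in> ball y \<rho>")
      case True
      then have "norm (z - \<zeta>) \<le> norm (z - y) + \<rho>"
        using norm_triangle_ineq[of "z - y" "y - \<zeta>"] by (simp add: dist_norm)
      then have "decay_weight \<rho> (z - y) \<le> 2 ^ (?n + 1) * decay_weight \<rho> (z - \<zeta>)"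
        using \<rho> norm_ge_zero[of "z - y"] by (intro decay_weight_le) (simp_all del: norm_ge_zero)
      then have "?W y \<le> ennreal (2 ^ (?n + 1)) * ?W \<zeta>"
        using \<rho> by (simp add: ennreal_mult[symmetric] decay_weight_nonneg ennreal_leI)
      then have "h y * ?W y \<le> h y * (ennreal (2 ^ (?n + 1)) * ?W \<zeta>)" by (rule mult_left_mono) simp
      then show ?thesis using True by (simp add: mult_ac dist_commute)
    qed simp
  qed
  also have "\<dots> = (\<integral>\<^sup>+\<zeta>. \<integral>\<^sup>+y. ennreal (2 ^ (?n + 1)) * (?W \<zeta> * (h y * indicator (ball \<zeta> \<rho>) y)) \<partial>lborel \<partial>lborel)"
  proof (rule lborel_pair.Fubini')
    have [measurable]: "(\<lambda>p::(real^'n) \<times> (real^'n). indicator {p. snd p \<in> ball (fst p) \<rho>} p :: ennreal) \<in> borel_measurable (lborel \<Otimes>\<^sub>M lborel)"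
      using borel_mem_ball_pair[of \<rho>, where 'a="real^'n"] unfolding lborel_prod measurable_lborel1 by measurable
    have "(\<lambda>p. ennreal (2 ^ (?n + 1)) * (?W (fst p) * (h (snd p) * indicator {p. snd p \<in> ball (fst p) \<rho>} p))) \<in> borel_measurable (lborel \<Otimes>\<^sub>M lborel)"
      by measurable
    then show "(\<lambda>(\<zeta>, y). ennreal (2 ^ (?n + 1)) * (?W \<zeta> * (h y * indicator (ball \<zeta> \<rho>) y))) \<in> borel_measurable (lborel \<Otimes>\<^sub>M lborel)"
      by (simp add: case_prod_beta' indicator_def)
  qed
  also have "\<dots> = (\<integral>\<^sup>+\<zeta>. ennreal (2 ^ (?n + 1)) * (?W \<zeta> * (\<integral>\<^sup>+y. h y * indicator (ball \<zeta> \<rho>) y \<partial>lborel)) \<partial>lborel)"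
  proof (rule nn_integral_cong)
    fix \<zeta> :: "real ^ 'n"
    have [measurable]: "ball \<zeta> \<rho> \<in> sets borel" by simp
    have "(\<integral>\<^sup>+y. ?W \<zeta> * (h y * indicator (ball \<zeta> \<rho>) y) \<partial>lborel) = ?W \<zeta> * (\<integral>\<^sup>+y. h y * indicator (ball \<zeta> \<rho>) y \<partial>lborel)"
      by (rule nn_integral_cmult) measurable
    moreover have "(\<integral>\<^sup>+y. ennreal (2 ^ (?n + 1)) * (?W \<zeta> * (h y * indicator (ball \<zeta> \<rho>) y)) \<partial>lborel)
      = ennreal (2 ^ (?n + 1)) * (\<integral>\<^sup>+y. ?W \<zeta> * (h y * indicator (ball \<zeta> \<rho>) y) \<partial>lborel)"
      by (rule nn_integral_cmult) measurable
    ultimately show "(\<integral>\<^sup>+y. ennreal (2 ^ (?n + 1)) * (?W \<zeta> * (h y * indicator (ball \<zeta> \<rho>) y)) \<partial>lborel)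
      = ennreal (2 ^ (?n + 1)) * (?W \<zeta> * (\<integral>\<^sup>+y. h y * indicator (ball \<zeta> \<rho>) y \<partial>lborel))" by simp
  qed
  also have "\<dots> \<le> (\<integral>\<^sup>+\<zeta>. ennreal (2 ^ (?n + 1)) * (?W \<zeta> * A) \<partial>lborel)"
    by (intro nn_integral_mono mult_left_mono A) auto
  also have "\<dots> = ennreal (2 ^ (?n + 1)) * ((\<integral>\<^sup>+\<zeta>. ?W \<zeta> \<partial>lborel) * A)"
    by (simp add: nn_integral_cmult nn_integral_multc)
  also have "\<dots> \<le> ennreal (2 ^ (?n + 1)) * (ennreal (real (?n + 1) * ?V * inverse \<rho>) * A)"
    by (intro mult_left_mono mult_right_mono nn_integral_decay_weight \<rho>) auto
  also have "\<dots> = ennreal (?V * \<rho> ^ ?n) * (ennreal (2 ^ (?n + 1) * real (?n + 1) * inverse \<rho> ^ (?n + 1)) * A)"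
  proof -
    have "2 ^ (?n + 1) * (real (?n + 1) * ?V * inverse \<rho>) = (?V * \<rho> ^ ?n) * (2 ^ (?n + 1) * real (?n + 1) * inverse \<rho> ^ (?n + 1))"
      using \<rho> by (simp add: field_simps)
    then have "ennreal (2 ^ (?n + 1)) * ennreal (real (?n + 1) * ?V * inverse \<rho>) = ennreal (?V * \<rho> ^ ?n) * ennreal (2 ^ (?n + 1) * real (?n + 1) * inverse \<rho> ^ (?n + 1))"
      using \<rho> V by (simp only: ennreal_mult''[symmetric] less_imp_le mult_nonneg_nonneg zero_le_power of_nat_0_le_iff inverse_nonnegative_iff_nonnegative zero_le_numeral)
    then show ?thesis by (simp only: mult.assoc[symmetric])
  qed
  finally show ?thesis
    using V \<rho> by (subst (asm) ennreal_mult_le_mult_iff) (auto simp: ennreal_zero_less_mult_iff ennreal_eq_0_iff not_le)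
qed

section \<open>Squares of integrals and a one-sided Plancherel estimate\<close>

lemma integrable_pair_bound:
  fixes H :: "'b \<times> 'a \<Rightarrow> 'c::{banach, second_countable_topology}"
  assumes "pair_sigma_finite N M" and [measurable]: "H \<in> borel_measurable (N \<Otimes>\<^sub>M M)"
    and u: "integrable N u" and v: "integrable M v"
    and le: "\<And>b p. norm (H (b, p)) \<le> u b * v p"
  shows "integrable (N \<Otimes>\<^sub>M M) H"
proof -
  interpret pair_sigma_finite N M by fact
  show ?thesis
  proof (rule Fubini_integrable)
    have Hb: "integrable M (\<lambda>p. H (b, p))" if "b \<in> space N" for b
      by (rule Bochner_Integration.integrable_bound[OF integrable_mult_right[OF v, of "u b"]])
         (use that order.trans[OF le abs_ge_self] in \<open>auto simp del: abs_mult\<close>)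
    then show "AE b in N. integrable M (\<lambda>p. H (b, p))" by simp
    show "integrable N (\<lambda>b. \<integral>p. norm (H (b, p)) \<partial>M)"
    proof (rule Bochner_Integration.integrable_bound[OF integrable_mult_left[OF u, of "\<integral>p. v p \<partial>M"]])
      show "AE b in N. norm (\<integral>p. norm (H (b, p)) \<partial>M) \<le> norm (u b * (\<integral>p. v p \<partial>M))"
      proof (rule AE_I2)
        fix b assume b: "b \<in> space N"
        have "(\<integral>p. norm (H (b, p)) \<partial>M) \<le> (\<integral>p. u b * v p \<partial>M)"
          by (intro integral_mono integrable_norm Hb b integrable_mult_right v le)
        then show "norm (\<integral>p. norm (H (b, p)) \<partial>M) \<le> norm (u b * (\<integral>p. v p \<partial>M))" by simp
      qed
    qed measurable
  qed measurable
qed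

text \<open>
  The \<open>TT\<^sup>*\<close> argument: after expanding the square, integration over \<open>b\<close> comes first and leaves a bilinear
  form in \<open>f\<close> whose kernel is the Gram matrix of the functions \<open>e \<cdot> p\<close>. The square integrable majorant
  \<open>g\<close> makes both exchanges of integrals absolutely convergent.
\<close>
lemma nn_integral_sq_integral_le:
  fixes f :: "'a \<Rightarrow> complex" and e :: "'b \<Rightarrow> 'a \<Rightarrow> complex"
  assumes pair: "pair_sigma_finite N M" and f: "integrable M f"
    and e [measurable]: "(\<lambda>(b, p). e b p) \<in> borel_measurable (N \<Otimes>\<^sub>M M)"
    and g [measurable]: "g \<in> borel_measurable N" and g2: "integrable N (\<lambda>b. (g b)\<^sup>2)"
    and e_le: "\<And>b p. norm (e b p) \<le> g b"
  shows "(\<integral>\<^sup>+b. ennreal ((norm (\<integral>p. f p * e b p \<partial>M))\<^sup>2) \<partial>N)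
    \<le> (\<integral>\<^sup>+p. \<integral>\<^sup>+q. ennreal (norm (f p) * norm (f q) * norm (\<integral>b. e b p * cnj (e b q) \<partial>N)) \<partial>M \<partial>M)"
proof -
  interpret pair_sigma_finite N M by fact
  have g0: "g b \<ge> 0" for b using order.trans[OF norm_ge_zero e_le] .
  have [measurable]: "f \<in> borel_measurable M" using f by auto
  have nf: "integrable M (\<lambda>p. norm (f p))" using f by (rule integrable_norm)
  define L where "L = (\<integral>p. norm (f p) \<partial>M)"
  have L0: "L \<ge> 0" by (simp add: L_def)
  define A where "A b = (\<integral>p. f p * e b p \<partial>M)" for b
  have [measurable]: "A \<in> borel_measurable N" unfolding A_def[abs_def] by measurable
  have A_le: "norm (A b) \<le> g b * L" for b
  proof -
    have "norm (A b) \<le> (\<integral>p. norm (f p * e b p) \<partial>M)" unfolding A_def by (rule integral_norm_bound)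
    also have "\<dots> \<le> (\<integral>p. g b * norm (f p) \<partial>M)"
    proof (rule integral_mono')
      show "integrable M (\<lambda>p. g b * norm (f p))" using nf by simp
      show "norm (f p * e b p) \<le> g b * norm (f p)" for p
        using mult_right_mono[OF e_le, of "norm (f p)" b p] by (simp add: norm_mult mult.commute)
    qed (use g0 in auto)
    finally show ?thesis by (simp add: L_def)
  qed
  define G where "G p = (\<integral>b. e b p * cnj (A b) \<partial>N)" for p
  have sq_eq: "complex_of_real ((norm (A b))\<^sup>2) = (\<integral>p. f p * e b p * cnj (A b) \<partial>M)" for b
    using complex_norm_square[of "A b"] by (simp add: A_def)
  have int1: "integrable (N \<Otimes>\<^sub>M M) (\<lambda>(b, p). f p * e b p * cnj (A b))"
  proof (rule integrable_pair_bound[OF pair])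
    show "integrable N (\<lambda>b. (g b)\<^sup>2 * L)" using g2 by simp
    show "integrable M (\<lambda>p. norm (f p))" by fact
    fix b p
    have "norm (e b p * cnj (A b)) \<le> g b * (g b * L)"
      unfolding norm_mult using e_le[of b p] A_le[of b] g0[of b] L0 by (intro mult_mono) auto
    then show "norm (case (b, p) of (b, p) \<Rightarrow> f p * e b p * cnj (A b)) \<le> (g b)\<^sup>2 * L * norm (f p)"
      using mult_left_mono[of "norm (e b p * cnj (A b))" "g b * (g b * L)" "norm (f p)"]
      by (simp add: norm_mult power2_eq_square mult_ac)
  qed measurable
  have intA: "integrable N (\<lambda>b. (norm (A b))\<^sup>2)"
  proof (rule Bochner_Integration.integrable_bound)
    show "integrable N (\<lambda>b. (g b)\<^sup>2 * L\<^sup>2)" using g2 by simp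
    show "AE b in N. norm ((norm (A b))\<^sup>2) \<le> norm ((g b)\<^sup>2 * L\<^sup>2)"
      using power_mono[OF A_le, of _ 2] by (auto simp: power_mult_distrib)
  qed measurable
  have "complex_of_real (\<integral>b. (norm (A b))\<^sup>2 \<partial>N) = (\<integral>b. complex_of_real ((norm (A b))\<^sup>2) \<partial>N)"
    by (rule integral_complex_of_real[symmetric])
  also have "\<dots> = (\<integral>b. \<integral>p. f p * e b p * cnj (A b) \<partial>M \<partial>N)"
    unfolding sq_eq by (intro Bochner_Integration.integral_cong) auto
  also have "\<dots> = (\<integral>p. \<integral>b. f p * e b p * cnj (A b) \<partial>N \<partial>M)"
    by (rule Fubini_integral[OF int1, symmetric])
  also have "\<dots> = (\<integral>p. f p * G p \<partial>M)"
  proof (rule Bochner_Integration.integral_cong[OF refl])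
    fix p
    have "(\<integral>b. f p * e b p * cnj (A b) \<partial>N) = (\<integral>b. f p * (e b p * cnj (A b)) \<partial>N)"
      by (intro Bochner_Integration.integral_cong) (auto simp: mult_ac)
    then show "(\<integral>b. f p * e b p * cnj (A b) \<partial>N) = f p * G p"
      by (simp add: G_def)
  qed
  finally have "norm (complex_of_real (\<integral>b. (norm (A b))\<^sup>2 \<partial>N)) = norm (\<integral>p. f p * G p \<partial>M)"
    by (rule arg_cong)
  then have "(\<integral>b. (norm (A b))\<^sup>2 \<partial>N) = norm (\<integral>p. f p * G p \<partial>M)"
    unfolding norm_of_real by simp
  moreover have "(\<integral>\<^sup>+b. ennreal ((norm (A b))\<^sup>2) \<partial>N) = ennreal (\<integral>b. (norm (A b))\<^sup>2 \<partial>N)"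
    using intA by (intro nn_integral_eq_integral) auto
  ultimately have "(\<integral>\<^sup>+b. ennreal ((norm (A b))\<^sup>2) \<partial>N) \<le> (\<integral>\<^sup>+p. ennreal (norm (f p * G p)) \<partial>M)"
    by (simp only: norm_integral_le_nn_integral)
  also have "\<dots> \<le> (\<integral>\<^sup>+p. \<integral>\<^sup>+q. ennreal (norm (f p) * norm (f q) * norm (\<integral>b. e b p * cnj (e b q) \<partial>N)) \<partial>M \<partial>M)"
  proof (rule nn_integral_mono)
    fix p assume p: "p \<in> space M"
    have [measurable]: "(\<lambda>b. e b p) \<in> borel_measurable N"
      using measurable_compose[OF measurable_Pair2'[OF p] e] by simp
    have int2: "integrable (N \<Otimes>\<^sub>M M) (\<lambda>(b, q). e b p * cnj (f q * e b q))"
    proof (rule integrable_pair_bound[OF pair _ g2 nf])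
      show "norm (case (b, q) of (b, q) \<Rightarrow> e b p * cnj (f q * e b q)) \<le> (g b)\<^sup>2 * norm (f q)" for b q
        using mult_mono[OF e_le[of b p] mult_right_mono[OF e_le[of b q], of "norm (f q)"]] g0[of b]
        by (simp add: norm_mult power2_eq_square mult_ac)
    qed measurable
    have "G p = (\<integral>b. \<integral>q. e b p * cnj (f q * e b q) \<partial>M \<partial>N)"
      unfolding G_def A_def by (simp add: complex_cnj_mult[symmetric] del: complex_cnj_mult)
    also have "\<dots> = (\<integral>q. \<integral>b. e b p * cnj (f q * e b q) \<partial>N \<partial>M)"
      by (rule Fubini_integral[OF int2, symmetric])
    also have "\<dots> = (\<integral>q. cnj (f q) * (\<integral>b. e b p * cnj (e b q) \<partial>N) \<partial>M)"
      by (intro Bochner_Integration.integral_cong refl)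
         (simp add: integral_mult_right_zero[symmetric] mult_ac del: integral_mult_right_zero)
    finally have G: "G p = (\<integral>q. cnj (f q) * (\<integral>b. e b p * cnj (e b q) \<partial>N) \<partial>M)" .
    have "ennreal (norm (f p * G p)) = ennreal (norm (f p)) * ennreal (norm (G p))"
      by (simp add: norm_mult ennreal_mult)
    also have "\<dots> \<le> ennreal (norm (f p)) * (\<integral>\<^sup>+q. ennreal (norm (cnj (f q) * (\<integral>b. e b p * cnj (e b q) \<partial>N))) \<partial>M)"
      unfolding G by (intro mult_left_mono norm_integral_le_nn_integral) auto
    also have "\<dots> = (\<integral>\<^sup>+q. ennreal (norm (f p)) * ennreal (norm (cnj (f q) * (\<integral>b. e b p * cnj (e b q) \<partial>N))) \<partial>M)"
      by (rule nn_integral_cmult[symmetric]) measurable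
    also have "\<dots> = (\<integral>\<^sup>+q. ennreal (norm (f p) * norm (f q) * norm (\<integral>b. e b p * cnj (e b q) \<partial>N)) \<partial>M)"
      by (intro nn_integral_cong) (simp add: norm_mult ennreal_mult mult_ac)
    finally show "ennreal (norm (f p * G p)) \<le> (\<integral>\<^sup>+q. ennreal (norm (f p) * norm (f q) * norm (\<integral>b. e b p * cnj (e b q) \<partial>N)) \<partial>M)" .
  qed
  finally show ?thesis unfolding A_def .
qed

text \<open>
  The Fourier transform of \<open>gauss c\<close>, that is, \<open>(2\<pi>)^n\<close> times the heat kernel at time \<open>c\<close>.
\<close>
definition heat_fourier :: "real \<Rightarrow> real ^ 'n::finite \<Rightarrow> real" where
  "heat_fourier c w = sqrt (pi / c) ^ CARD('n) * exp (- (norm w)\<^sup>2 / (4 * c))"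

lemma heat_fourier_nonneg: "c > 0 \<Longrightarrow> heat_fourier c w \<ge> 0"
  by (simp add: heat_fourier_def)

lemma heat_fourier_minus: "heat_fourier c (x - y) = heat_fourier c (y - x)"
  by (simp add: heat_fourier_def norm_minus_commute)

lemma borel_measurable_heat_fourier [measurable (raw)]:
  assumes [measurable]: "f \<in> borel_measurable M" "g \<in> borel_measurable M"
  shows "(\<lambda>p. heat_fourier (f p) (g p)) \<in> borel_measurable M"
  unfolding heat_fourier_def by measurable

lemma nn_integral_heat_fourier:
  fixes z :: "real ^ 'n::finite"
  assumes c: "c > 0"
  shows "(\<integral>\<^sup>+y. ennreal (heat_fourier c (z - y)) \<partial>lborel) = ennreal ((2 * pi) ^ CARD('n))"
proof -
  let ?n = "CARD('n)"
  have c4: "1 / (4 * c) > 0" using c by simp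
  have eq: "heat_fourier c w = sqrt (pi / c) ^ ?n * gauss (1 / (4 * c)) w" for w :: "real ^ 'n"
    by (simp add: heat_fourier_def)
  have "complex_of_real (LINT w|lborel. gauss (1 / (4 * c)) (w :: real ^ 'n)) = complex_of_real (sqrt (pi / (1 / (4 * c))) ^ ?n)"
    using fourier_gauss[OF c4, of "0 :: real ^ 'n"]
    by (simp add: integral_complex_of_real[symmetric] del: integral_complex_of_real)
  then have I: "(LINT w|lborel. gauss (1 / (4 * c)) (w :: real ^ 'n)) = sqrt (pi / (1 / (4 * c))) ^ ?n"
    by (simp only: of_real_eq_iff)
  have "(\<integral>\<^sup>+y. ennreal (heat_fourier c (z - y)) \<partial>lborel) = (\<integral>\<^sup>+y. ennreal (heat_fourier c (y :: real ^ 'n)) \<partial>lborel)"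
    by (rule nn_integral_lborel_reflect) measurable
  also have "\<dots> = ennreal (LINT w|lborel. heat_fourier c (w :: real ^ 'n))"
    unfolding eq using c by (intro nn_integral_eq_integral integrable_mult_right integrable_gauss[OF c4]) auto
  also have "(LINT w|lborel. heat_fourier c (w :: real ^ 'n)) = sqrt (pi / c) ^ ?n * sqrt (pi / (1 / (4 * c))) ^ ?n"
    unfolding eq by (simp only: integral_mult_right_zero I)
  also have "\<dots> = (2 * pi) ^ ?n"
  proof -
    have "sqrt (pi / c) * sqrt (pi / (1 / (4 * c))) = sqrt ((2 * pi)\<^sup>2)"
      unfolding real_sqrt_mult[symmetric] using c by (simp add: power2_eq_square)
    also have "sqrt ((2 * pi)\<^sup>2) = 2 * pi" by (simp only: real_sqrt_abs) simp
    finally show ?thesis by (simp only: power_mult_distrib[symmetric])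
  qed
  finally show ?thesis .
qed

lemma heat_fourier_le_decay_weight:
  "\<exists>C>0. \<forall>r>0. \<forall>c. \<forall>w :: real ^ 'n::finite. r / 2 \<le> c \<and> c \<le> r \<longrightarrow> heat_fourier c w \<le> C * sqrt r * decay_weight (sqrt r) w"
proof -
  let ?n = "CARD('n)"
  obtain D where D: "D > 0" "\<And>s b. s > 0 \<Longrightarrow> (1 / sqrt s) ^ (?n + 1) * exp (- b\<^sup>2 / (8 * s)) \<le> D * (1 / sqrt (s + b\<^sup>2)) ^ (?n + 1)"
    using gauss_le_inverse_power[of "?n + 1"] by metis
  show ?thesis
  proof (intro exI[of _ "sqrt pi ^ ?n * D * 2 ^ (?n + 1)"] conjI allI impI; (elim conjE)?)
    show "0 < sqrt pi ^ ?n * D * 2 ^ (?n + 1)" using D by simp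
    fix r c :: real and w :: "real ^ 'n" assume r: "r > 0" and c: "r / 2 \<le> c" "c \<le> r"
    then have c0: "c > 0" by simp
    have "heat_fourier c w = sqrt pi ^ ?n * sqrt c * ((1 / sqrt c) ^ (?n + 1) * exp (- (norm w)\<^sup>2 / (4 * c)))"
      using c0 by (simp add: heat_fourier_def real_sqrt_divide power_divide)
    also have "\<dots> \<le> sqrt pi ^ ?n * sqrt r * ((1 / sqrt c) ^ (?n + 1) * exp (- (norm w)\<^sup>2 / (8 * c)))"
      using c0 c by (intro mult_mono) (auto simp: frac_le)
    also have "\<dots> \<le> sqrt pi ^ ?n * sqrt r * (D * (1 / sqrt (c + (norm w)\<^sup>2)) ^ (?n + 1))"
      using r by (intro mult_left_mono D c0) auto
    also have "\<dots> \<le> sqrt pi ^ ?n * sqrt r * (D * (2 * inverse (sqrt r + norm w)) ^ (?n + 1))"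
    proof (intro mult_left_mono power_mono)
      have "sqrt r + norm w \<le> 2 * sqrt (c + (norm w)\<^sup>2)"
        using r c by (intro sqrt_plus_le_two_sqrt)
      moreover have "sqrt r + norm w > 0" "sqrt (c + (norm w)\<^sup>2) > 0" using r c0 by (auto intro!: add_pos_nonneg)
      ultimately show "1 / sqrt (c + (norm w)\<^sup>2) \<le> 2 * inverse (sqrt r + norm w)" by (simp add: field_simps)
    qed (use D r c0 in auto)
    also have "\<dots> = sqrt pi ^ ?n * D * 2 ^ (?n + 1) * sqrt r * decay_weight (sqrt r) w"
      unfolding decay_weight_def power_mult_distrib by (simp only: mult_ac)
    finally show "heat_fourier c w \<le> sqrt pi ^ ?n * D * 2 ^ (?n + 1) * sqrt r * decay_weight (sqrt r) w" .
  qed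
qed

lemma fourier_gauss_diff:
  fixes \<xi> \<eta> :: "real ^ 'n::finite"
  assumes "c > 0"
  shows "(LINT x|lborel. complex_of_real (gauss c x) * cis ((\<xi> - \<eta>) \<bullet> x)) = complex_of_real (heat_fourier c (\<xi> - \<eta>))"
  unfolding heat_fourier_def using fourier_gauss[OF assms, of "\<xi> - \<eta>"] .

text \<open>
  Schur's test: \<open>f(\<xi>) f(\<eta>)\<close> is at most \<open>(f(\<xi>)\<^sup>2 + f(\<eta>)\<^sup>2) / 2\<close>, and the kernel has mass \<open>(2\<pi>)^n\<close> in
  either variable.
\<close>
lemma nn_integral_heat_fourier_schur:
  fixes f :: "real ^ 'n::finite \<Rightarrow> real"
  assumes [measurable]: "f \<in> borel_measurable borel" and f0: "\<And>\<xi>. f \<xi> \<ge> 0" and c: "c > 0"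
  shows "(\<integral>\<^sup>+\<xi>. \<integral>\<^sup>+\<eta>. ennreal (f \<xi> * f \<eta> * heat_fourier c (\<xi> - \<eta>)) \<partial>lborel \<partial>lborel)
    \<le> ennreal ((2 * pi) ^ CARD('n)) * (\<integral>\<^sup>+\<xi>. ennreal ((f \<xi>)\<^sup>2) \<partial>lborel)"
proof -
  let ?\<Gamma> = "\<lambda>\<xi> \<eta>. ennreal (heat_fourier c (\<xi> - \<eta> :: real ^ 'n))"
  let ?h = "\<lambda>\<xi>. ennreal ((f \<xi>)\<^sup>2 / 2)"
  let ?I = "ennreal ((2 * pi) ^ CARD('n))"
  have "(\<integral>\<^sup>+\<xi>. \<integral>\<^sup>+\<eta>. ennreal (f \<xi> * f \<eta> * heat_fourier c (\<xi> - \<eta>)) \<partial>lborel \<partial>lborel)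
     \<le> (\<integral>\<^sup>+\<xi>. \<integral>\<^sup>+\<eta>. ?h \<xi> * ?\<Gamma> \<xi> \<eta> + ?h \<eta> * ?\<Gamma> \<xi> \<eta> \<partial>lborel \<partial>lborel)"
  proof (intro nn_integral_mono)
    fix \<xi> \<eta> :: "real ^ 'n"
    have G: "heat_fourier c (\<xi> - \<eta>) \<ge> 0" using c by (rule heat_fourier_nonneg)
    have "f \<xi> * f \<eta> \<le> (f \<xi>)\<^sup>2 / 2 + (f \<eta>)\<^sup>2 / 2" using sum_squares_bound[of "f \<xi>" "f \<eta>"] by simp
    then have "f \<xi> * f \<eta> * heat_fourier c (\<xi> - \<eta>) \<le> ((f \<xi>)\<^sup>2 / 2 + (f \<eta>)\<^sup>2 / 2) * heat_fourier c (\<xi> - \<eta>)"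
      using G by (rule mult_right_mono)
    then show "ennreal (f \<xi> * f \<eta> * heat_fourier c (\<xi> - \<eta>)) \<le> ?h \<xi> * ?\<Gamma> \<xi> \<eta> + ?h \<eta> * ?\<Gamma> \<xi> \<eta>"
      using G by (simp add: ennreal_mult[symmetric] ennreal_plus[symmetric] distrib_right ennreal_leI del: ennreal_plus)
  qed
  also have "\<dots> = (\<integral>\<^sup>+\<xi>. (\<integral>\<^sup>+\<eta>. ?h \<xi> * ?\<Gamma> \<xi> \<eta> \<partial>lborel) + (\<integral>\<^sup>+\<eta>. ?h \<eta> * ?\<Gamma> \<xi> \<eta> \<partial>lborel) \<partial>lborel)"
    by (intro nn_integral_cong nn_integral_add) measurable
  also have "\<dots> = (\<integral>\<^sup>+\<xi>. (\<integral>\<^sup>+\<eta>. ?h \<xi> * ?\<Gamma> \<xi> \<eta> \<partial>lborel) \<partial>lborel) + (\<integral>\<^sup>+\<xi>. (\<integral>\<^sup>+\<eta>. ?h \<eta> * ?\<Gamma> \<xi> \<eta> \<partial>lborel) \<partial>lborel)"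
    by (intro nn_integral_add) measurable
  also have "(\<integral>\<^sup>+\<xi>. (\<integral>\<^sup>+\<eta>. ?h \<eta> * ?\<Gamma> \<xi> \<eta> \<partial>lborel) \<partial>lborel) = (\<integral>\<^sup>+\<eta>. (\<integral>\<^sup>+\<xi>. ?h \<eta> * ?\<Gamma> \<xi> \<eta> \<partial>lborel) \<partial>lborel)"
    by (rule lborel_pair.Fubini'[symmetric]) measurable
  also have "\<dots> = (\<integral>\<^sup>+\<eta>. (\<integral>\<^sup>+\<xi>. ?h \<eta> * ?\<Gamma> \<eta> \<xi> \<partial>lborel) \<partial>lborel)"
    by (simp only: heat_fourier_minus)
  also have "(\<integral>\<^sup>+\<xi>. (\<integral>\<^sup>+\<eta>. ?h \<xi> * ?\<Gamma> \<xi> \<eta> \<partial>lborel) \<partial>lborel) = (\<integral>\<^sup>+\<xi>. ?h \<xi> * ?I \<partial>lborel)"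
  proof (rule nn_integral_cong)
    fix \<xi> :: "real ^ 'n"
    have "(\<integral>\<^sup>+\<eta>. ?h \<xi> * ?\<Gamma> \<xi> \<eta> \<partial>lborel) = ?h \<xi> * (\<integral>\<^sup>+\<eta>. ?\<Gamma> \<xi> \<eta> \<partial>lborel)" by (rule nn_integral_cmult) measurable
    then show "(\<integral>\<^sup>+\<eta>. ?h \<xi> * ?\<Gamma> \<xi> \<eta> \<partial>lborel) = ?h \<xi> * ?I" by (simp only: nn_integral_heat_fourier[OF c])
  qed
  also have "(\<integral>\<^sup>+\<xi>. ?h \<xi> * ?I \<partial>lborel) + (\<integral>\<^sup>+\<xi>. ?h \<xi> * ?I \<partial>lborel) = (\<integral>\<^sup>+\<xi>. ?h \<xi> * ?I + ?h \<xi> * ?I \<partial>lborel)"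
    by (rule nn_integral_add[symmetric]) measurable
  also have "\<dots> = (\<integral>\<^sup>+\<xi>. ?I * ennreal ((f \<xi>)\<^sup>2) \<partial>lborel)"
    by (intro nn_integral_cong) (simp add: distrib_right[symmetric] ennreal_plus[symmetric] mult.commute del: ennreal_plus)
  also have "\<dots> = ?I * (\<integral>\<^sup>+\<xi>. ennreal ((f \<xi>)\<^sup>2) \<partial>lborel)" by (rule nn_integral_cmult) measurable
  finally show ?thesis .
qed

text \<open>
  With the damping factor \<open>gauss \<delta>\<close> the \<open>TT\<^sup>*\<close> argument applies, and its kernel \<open>heat_fourier \<delta>\<close> has
  mass \<open>(2\<pi>)^n\<close> for every \<open>\<delta>\<close>. Fatou's lemma removes the damping.
\<close>
lemma plancherel_le:
  fixes m :: "real ^ 'n::finite \<Rightarrow> complex"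
  assumes m: "integrable lborel m"
  shows "(\<integral>\<^sup>+x. ennreal ((norm (LINT \<xi>|lborel. m \<xi> * cis (x \<bullet> \<xi>)))\<^sup>2) \<partial>lborel)
     \<le> ennreal ((2 * pi) ^ CARD('n)) * (\<integral>\<^sup>+\<xi>. ennreal ((norm (m \<xi>))\<^sup>2) \<partial>lborel)"
    (is "(\<integral>\<^sup>+x. ?\<Phi> x \<partial>lborel) \<le> ?R")
proof -
  have [measurable]: "m \<in> borel_measurable borel" using m by auto
  define \<delta> where "\<delta> i = inverse (real (Suc i))" for i
  have \<delta>: "\<delta> i > 0" for i by (simp add: \<delta>_def)
  have damped: "(\<integral>\<^sup>+x. ?\<Phi> x * ennreal (gauss (\<delta> i) x) \<partial>lborel) \<le> ?R" for i
  proof -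
    define e where "e x \<xi> = complex_of_real (gauss (\<delta> i / 2) x) * cis (x \<bullet> \<xi>)" for x \<xi> :: "real ^ 'n"
    define g where "g x = gauss (\<delta> i / 2) x" for x :: "real ^ 'n"
    have exp2: "exp (- (\<delta> i / 2) * r) * exp (- (\<delta> i / 2) * r) = exp (- \<delta> i * r)" for r
      by (simp add: exp_add[symmetric])
    have "(\<integral>\<^sup>+x. ?\<Phi> x * ennreal (gauss (\<delta> i) x) \<partial>lborel) = (\<integral>\<^sup>+x. ennreal ((norm (LINT \<xi>|lborel. m \<xi> * e x \<xi>))\<^sup>2) \<partial>lborel)"
    proof (rule nn_integral_cong)
      fix x :: "real ^ 'n"
      have "(LINT \<xi>|lborel. m \<xi> * e x \<xi>) = (LINT \<xi>|lborel. complex_of_real (g x) * (m \<xi> * cis (x \<bullet> \<xi>)))"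
        by (intro Bochner_Integration.integral_cong) (auto simp: e_def g_def)
      then have "norm (LINT \<xi>|lborel. m \<xi> * e x \<xi>) = g x * norm (LINT \<xi>|lborel. m \<xi> * cis (x \<bullet> \<xi>))"
        by (simp add: norm_mult g_def)
      then show "?\<Phi> x * ennreal (gauss (\<delta> i) x) = ennreal ((norm (LINT \<xi>|lborel. m \<xi> * e x \<xi>))\<^sup>2)"
        using exp2[of "(norm x)\<^sup>2"] by (simp add: ennreal_mult[symmetric] power_mult_distrib g_def power2_eq_square mult_ac)
    qed
    also have "\<dots> \<le> (\<integral>\<^sup>+\<xi>. \<integral>\<^sup>+\<eta>. ennreal (norm (m \<xi>) * norm (m \<eta>) * norm (LINT x|lborel. e x \<xi> * cnj (e x \<eta>))) \<partial>lborel \<partial>lborel)"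
    proof (rule nn_integral_sq_integral_le[where g = g])
      show "pair_sigma_finite lborel (lborel :: (real ^ 'n) measure)" by unfold_locales
      have "integrable lborel (\<lambda>x :: real ^ 'n. gauss (\<delta> i) x)" by (rule integrable_gauss[OF \<delta>])
      then show "integrable lborel (\<lambda>x. (g x)\<^sup>2)" by (simp only: g_def power2_eq_square exp2)
      show "(\<lambda>(x, \<xi>). e x \<xi>) \<in> borel_measurable (lborel \<Otimes>\<^sub>M lborel)" unfolding e_def by measurable
      show "g \<in> borel_measurable lborel" unfolding g_def[abs_def] by measurable
      show "norm (e x \<xi>) \<le> g x" for x \<xi> by (simp add: e_def g_def norm_mult)
    qed (rule m)
    also have "\<dots> = (\<integral>\<^sup>+\<xi>. \<integral>\<^sup>+\<eta>. ennreal (norm (m \<xi>) * norm (m \<eta>) * heat_fourier (\<delta> i) (\<xi> - \<eta>)) \<partial>lborel \<partial>lborel)"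
    proof -
      have "(LINT x|lborel. e x \<xi> * cnj (e x \<eta>)) = complex_of_real (heat_fourier (\<delta> i) (\<xi> - \<eta>))" for \<xi> \<eta>
      proof -
        have "e x \<xi> * cnj (e x \<eta>) = complex_of_real (gauss (\<delta> i) x) * cis ((\<xi> - \<eta>) \<bullet> x)" for x
        proof -
          have "e x \<xi> * cnj (e x \<eta>) = complex_of_real (gauss (\<delta> i / 2) x * gauss (\<delta> i / 2) x) * (cis (x \<bullet> \<xi>) * cis (- (x \<bullet> \<eta>)))"
            by (simp only: e_def complex_cnj_mult cis_cnj complex_cnj_complex_of_real of_real_mult mult_ac)
          then show ?thesis
            unfolding exp2 cis_mult by (simp add: inner_diff_left inner_diff_right inner_commute)
        qed
        then show ?thesis by (simp only: fourier_gauss_diff[OF \<delta>])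
      qed
      then show ?thesis by (simp only: norm_of_real abs_of_nonneg[OF heat_fourier_nonneg[OF \<delta>]])
    qed
    also have "\<dots> \<le> ?R"
      by (rule nn_integral_heat_fourier_schur) (auto simp: \<delta>)
    finally show ?thesis .
  qed
  have "(\<integral>\<^sup>+x. ?\<Phi> x \<partial>lborel) = (\<integral>\<^sup>+x. liminf (\<lambda>i. ?\<Phi> x * ennreal (gauss (\<delta> i) x)) \<partial>lborel)"
  proof (rule nn_integral_cong)
    fix x :: "real ^ 'n"
    have "\<delta> \<longlonglongrightarrow> 0" unfolding \<delta>_def by (rule LIMSEQ_inverse_real_of_nat)
    then have "(\<lambda>i. gauss (\<delta> i) x) \<longlonglongrightarrow> gauss 0 x"
      by (intro tendsto_intros)
    then have "(\<lambda>i. ennreal (gauss (\<delta> i) x)) \<longlonglongrightarrow> ennreal 1"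
      by (intro tendsto_ennrealI) simp
    then have "(\<lambda>i. ?\<Phi> x * ennreal (gauss (\<delta> i) x)) \<longlonglongrightarrow> ?\<Phi> x * ennreal 1"
      by (intro ennreal_tendsto_cmult) auto
    then show "?\<Phi> x = liminf (\<lambda>i. ?\<Phi> x * ennreal (gauss (\<delta> i) x))"
      by (simp add: lim_imp_Liminf)
  qed
  also have "\<dots> \<le> liminf (\<lambda>i. \<integral>\<^sup>+x. ?\<Phi> x * ennreal (gauss (\<delta> i) x) \<partial>lborel)"
    by (rule nn_integral_liminf) measurable
  also have "\<dots> \<le> ?R"
    using Liminf_le[OF sequentially_bot, of "\<lambda>i. \<integral>\<^sup>+x. ?\<Phi> x * ennreal (gauss (\<delta> i) x) \<partial>lborel" ?R] damped by simp
  finally show ?thesis .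
qed

section \<open>The energy of the Duhamel integral\<close>

text \<open>
  The delay \<open>\<epsilon>\<close> keeps the kernel away from its singularity at time zero; the Duhamel integral proper is
  the case \<open>\<epsilon> = 0\<close>.
\<close>
definition duhamel :: "(real \<Rightarrow> real ^ 'n::finite \<Rightarrow> complex) \<Rightarrow> real \<Rightarrow> ('n spacetime \<Rightarrow> complex) \<Rightarrow> real \<Rightarrow> real ^ 'n \<Rightarrow> complex" where
  "duhamel \<kappa> \<epsilon> F t x = (LINT p|lborel. before t p *\<^sub>R (\<kappa> (t - fst p + \<epsilon>) (x - snd p) * F p))"

lemma borel_measurable_duhamel_pair:
  fixes F :: "'n::finite spacetime \<Rightarrow> complex"
  assumes [measurable]: "(\<lambda>p. \<kappa> (fst p) (snd p)) \<in> borel_measurable borel" "F \<in> borel_measurable borel"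
  shows "(\<lambda>p. duhamel \<kappa> \<epsilon> F (fst p) (snd p)) \<in> borel_measurable borel"
proof -
  have [measurable]: "(\<lambda>(a, b). \<kappa> a b) \<in> borel_measurable (borel \<Otimes>\<^sub>M borel)"
    using assms(1) unfolding borel_prod by (simp add: case_prod_beta')
  show ?thesis unfolding duhamel_def borel_prod[symmetric] by measurable
qed

abbreviation heat_mode :: "real \<Rightarrow> real \<Rightarrow> real ^ 'n::finite \<Rightarrow> 'n spacetime \<Rightarrow> complex" where
  "heat_mode \<epsilon> t \<xi> p \<equiv> complex_of_real (before t p * gauss (t - fst p + \<epsilon>) \<xi>) * cis (- (snd p \<bullet> \<xi>))"

text \<open>
  The spatial Fourier transform at time \<open>t + \<epsilon>\<close> of the heat flow driven by \<open>F\<close> up to time \<open>t\<close>.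
\<close>
definition heat_transform :: "real \<Rightarrow> ('n::finite spacetime \<Rightarrow> complex) \<Rightarrow> real \<Rightarrow> real ^ 'n \<Rightarrow> complex" where
  "heat_transform \<epsilon> F t \<xi> = (LINT p|lborel. F p *
     (heat_mode \<epsilon> t \<xi> p))"

text \<open>
  The delay contributes the factor \<open>gauss \<epsilon> \<xi>\<close>, whose product with \<open>norm \<xi>\<close> is integrable. This makes
  the exchange of the integrals over space-time and over frequency absolutely convergent.
\<close>
lemma
  fixes F :: "'n::finite spacetime \<Rightarrow> complex"
  assumes F: "integrable lborel F" and \<epsilon>: "\<epsilon> > 0"
    and m [measurable]: "m \<in> borel_measurable borel" and m_le: "\<And>\<xi>. norm (m \<xi>) \<le> norm \<xi>"
  shows duhamel_eq_inverse_fourier: "duhamel (multiplier_kernel m) \<epsilon> F t x =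
      complex_of_real (1 / (2 * pi) ^ CARD('n)) * (LINT \<xi>|lborel. m \<xi> * heat_transform \<epsilon> F t \<xi> * cis (x \<bullet> \<xi>))"
    and integrable_multiplier_heat_transform: "integrable lborel (\<lambda>\<xi>. m \<xi> * heat_transform \<epsilon> F t \<xi>)"
proof -
  have [measurable]: "F \<in> borel_measurable borel" using F by auto
  define H where "H \<xi> p = F p * m \<xi> * complex_of_real (before t p * gauss (t - fst p + \<epsilon>) \<xi>) * cis ((x - snd p) \<bullet> \<xi>)"
    for \<xi> :: "real ^ 'n" and p :: "'n spacetime"
  have exp_le: "before t p * gauss (t - fst p + \<epsilon>) \<xi> \<le> gauss \<epsilon> \<xi>"
    for \<xi> :: "real ^ 'n" and p :: "'n spacetime"
  proof (cases "fst p \<in> {0<..<t}")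
    case True
    then have "\<epsilon> * (norm \<xi>)\<^sup>2 \<le> (t - fst p + \<epsilon>) * (norm \<xi>)\<^sup>2" by (intro mult_right_mono) auto
    then have "gauss (t - fst p + \<epsilon>) \<xi> \<le> gauss \<epsilon> \<xi>"
      by (simp only: exp_le_cancel_iff mult_minus_left neg_le_iff_le)
    then show ?thesis using True by simp
  qed simp
  have ge: "integrable lborel (\<lambda>\<xi> :: real ^ 'n. norm \<xi> ^ 1 * gauss \<epsilon> \<xi>)"
    by (rule integrable_norm_power_gauss[OF \<epsilon>])
  have H_meas [measurable]: "(\<lambda>(\<xi>, p). H \<xi> p) \<in> borel_measurable (lborel \<Otimes>\<^sub>M lborel)"
    unfolding H_def by measurable
  have "integrable (lborel \<Otimes>\<^sub>M lborel) (\<lambda>(\<xi>, p). H \<xi> p)"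
  proof (rule integrable_pair_bound[OF _ H_meas ge integrable_norm[OF F]])
    show "pair_sigma_finite (lborel :: (real ^ 'n) measure) (lborel :: ('n spacetime) measure)" by unfold_locales
    fix \<xi> :: "real ^ 'n" and p :: "'n spacetime"
    have "norm (H \<xi> p) = norm (F p) * (norm (m \<xi>) * (before t p * gauss (t - fst p + \<epsilon>) \<xi>))"
      by (simp add: H_def norm_mult)
    also have "\<dots> \<le> norm (F p) * (norm \<xi> * gauss \<epsilon> \<xi>)"
      by (intro mult_left_mono mult_mono m_le exp_le) auto
    finally show "norm (case (\<xi>, p) of (\<xi>, p) \<Rightarrow> H \<xi> p) \<le> norm \<xi> ^ 1 * gauss \<epsilon> \<xi> * norm (F p)"
      by (simp add: mult_ac)
  qed
  then have fub: "(LINT p|lborel. LINT \<xi>|lborel. H \<xi> p) = (LINT \<xi>|lborel. LINT p|lborel. H \<xi> p)"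
    by (rule lborel_pair.Fubini_integral)
  have "duhamel (multiplier_kernel m) \<epsilon> F t x = (LINT p|lborel. complex_of_real (1 / (2 * pi) ^ CARD('n)) * (LINT \<xi>|lborel. H \<xi> p))"
    unfolding duhamel_def
  proof (rule Bochner_Integration.integral_cong[OF refl])
    fix p :: "'n spacetime"
    have "(LINT \<xi>|lborel. H \<xi> p) = (LINT \<xi>|lborel. (F p * before t p) * (m \<xi> * complex_of_real (gauss (t - fst p + \<epsilon>) \<xi>) * cis ((x - snd p) \<bullet> \<xi>)))"
      by (intro Bochner_Integration.integral_cong refl) (simp add: H_def indicator_def)
    also have "\<dots> = (F p * before t p) * (LINT \<xi>|lborel. m \<xi> * complex_of_real (gauss (t - fst p + \<epsilon>) \<xi>) * cis ((x - snd p) \<bullet> \<xi>))"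
      by (rule integral_mult_right_zero)
    finally show "before t p *\<^sub>R (multiplier_kernel m (t - fst p + \<epsilon>) (x - snd p) * F p)
       = complex_of_real (1 / (2 * pi) ^ CARD('n)) * (LINT \<xi>|lborel. H \<xi> p)"
      by (simp add: multiplier_kernel_def indicator_def)
  qed
  also have "\<dots> = complex_of_real (1 / (2 * pi) ^ CARD('n)) * (LINT p|lborel. LINT \<xi>|lborel. H \<xi> p)"
    by (rule integral_mult_right_zero)
  also have "(LINT p|lborel. LINT \<xi>|lborel. H \<xi> p) = (LINT \<xi>|lborel. LINT p|lborel. H \<xi> p)" by (rule fub)
  also have "\<dots> = (LINT \<xi>|lborel. m \<xi> * heat_transform \<epsilon> F t \<xi> * cis (x \<bullet> \<xi>))"
  proof (rule Bochner_Integration.integral_cong[OF refl])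
    fix \<xi> :: "real ^ 'n"
    have "(LINT p|lborel. H \<xi> p) = (LINT p|lborel. (m \<xi> * cis (x \<bullet> \<xi>)) * (F p *
     (heat_mode \<epsilon> t \<xi> p)))"
    proof (rule Bochner_Integration.integral_cong[OF refl])
      fix p :: "'n spacetime"
      have c: "cis ((x - snd p) \<bullet> \<xi>) = cis (x \<bullet> \<xi>) * cis (- (snd p \<bullet> \<xi>))"
        unfolding cis_mult by (simp add: inner_diff_left)
      show "H \<xi> p = (m \<xi> * cis (x \<bullet> \<xi>)) * (F p *
     (heat_mode \<epsilon> t \<xi> p))"
        unfolding H_def c by (simp only: mult_ac)
    qed
    also have "\<dots> = (m \<xi> * cis (x \<bullet> \<xi>)) * heat_transform \<epsilon> F t \<xi>"
      unfolding heat_transform_def by (rule integral_mult_right_zero)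
    finally show "(LINT p|lborel. H \<xi> p) = m \<xi> * heat_transform \<epsilon> F t \<xi> * cis (x \<bullet> \<xi>)" by (simp only: mult_ac)
  qed
  finally show "duhamel (multiplier_kernel m) \<epsilon> F t x =
      complex_of_real (1 / (2 * pi) ^ CARD('n)) * (LINT \<xi>|lborel. m \<xi> * heat_transform \<epsilon> F t \<xi> * cis (x \<bullet> \<xi>))" .
  have [measurable]: "heat_transform \<epsilon> F t \<in> borel_measurable borel"
    unfolding heat_transform_def[abs_def] by measurable
  show "integrable lborel (\<lambda>\<xi>. m \<xi> * heat_transform \<epsilon> F t \<xi>)"
  proof (rule Bochner_Integration.integrable_bound[OF integrable_mult_left[OF ge, of "LINT p|lborel. norm (F p)"]])
    show "AE \<xi> in lborel. norm (m \<xi> * heat_transform \<epsilon> F t \<xi>) \<le> norm (norm \<xi> ^ 1 * gauss \<epsilon> \<xi> * (LINT p|lborel. norm (F p)))"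
    proof (rule AE_I2)
      fix \<xi> :: "real ^ 'n"
      have "norm (heat_transform \<epsilon> F t \<xi>) \<le> (LINT p|lborel. norm (F p *
     (heat_mode \<epsilon> t \<xi> p)))"
        unfolding heat_transform_def by (rule integral_norm_bound)
      also have "\<dots> \<le> (LINT p|lborel. gauss \<epsilon> \<xi> * norm (F p))"
      proof (rule integral_mono')
        show "integrable lborel (\<lambda>p. gauss \<epsilon> \<xi> * norm (F p))" using F by simp
        show "norm (F p * (heat_mode \<epsilon> t \<xi> p))
           \<le> gauss \<epsilon> \<xi> * norm (F p)" for p
          using mult_right_mono[OF exp_le[of p \<xi>], of "norm (F p)"] by (simp add: norm_mult mult_ac)
      qed auto
      also have "\<dots> = gauss \<epsilon> \<xi> * (LINT p|lborel. norm (F p))"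
        by (rule integral_mult_right_zero)
      finally have "norm (m \<xi>) * norm (heat_transform \<epsilon> F t \<xi>) \<le> norm \<xi> * (gauss \<epsilon> \<xi> * (LINT p|lborel. norm (F p)))"
        by (intro mult_mono m_le) auto
      then show "norm (m \<xi> * heat_transform \<epsilon> F t \<xi>) \<le> norm (norm \<xi> ^ 1 * gauss \<epsilon> \<xi> * (LINT p|lborel. norm (F p)))"
        by (simp add: norm_mult mult_ac)
    qed
  qed measurable
qed

text \<open>
  The \<open>TT\<^sup>*\<close> argument with the modes indexed by \<open>(\<xi>, t)\<close>. Their Gram matrix is computed by integrating
  first in \<open>t\<close>, where the weight \<open>|\<xi>|\<^sup>2\<close> cancels the rate of decay, and then in \<open>\<xi>\<close>, which produces a
  heat kernel. It is nonnegative, so no cancellation has to be tracked afterwards.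
\<close>
lemma nn_integral_heat_transform_le:
  fixes F :: "'n::finite spacetime \<Rightarrow> complex"
  assumes F: "integrable lborel F" and \<epsilon>: "\<epsilon> > 0" and R: "R > 0"
    and supp: "\<And>p. F p \<noteq> 0 \<Longrightarrow> 0 < fst p \<and> fst p < R"
  shows "(\<integral>\<^sup>+t. indicator {0<..<R} t * (\<integral>\<^sup>+\<xi>. ennreal ((norm \<xi> * norm (heat_transform \<epsilon> F t \<xi>))\<^sup>2) \<partial>lborel) \<partial>lborel)
    \<le> (\<integral>\<^sup>+p. \<integral>\<^sup>+q. ennreal (norm (F p) * norm (F q) * (heat_fourier (\<bar>fst p - fst q\<bar> + 2 * \<epsilon>) (snd p - snd q) / 2)) \<partial>lborel \<partial>lborel)"
proof -
  have [measurable]: "F \<in> borel_measurable borel" using F by auto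
  define e where "e b p = complex_of_real (norm (fst b) * (indicator {0<..<snd b} (fst p) * indicator {..<R} (fst p) * gauss (snd b - fst p + \<epsilon>) (fst b))) * cis (- (snd p \<bullet> fst b))"
    for b :: "(real ^ 'n) \<times> real" and p :: "'n spacetime"
  (* Although t < R on the left-hand side, the modes are kept for all t > 0: the source stops at
     time R, after which they decay, and the time integral gets no boundary term at R. *)
  define g where "g b = norm (fst b) * (indicator {0<..} (snd b) * gauss (max 0 (snd b - R) + \<epsilon>) (fst b))"
    for b :: "(real ^ 'n) \<times> real"
  have [measurable]: "(\<lambda>(b, p). e b p) \<in> borel_measurable (lborel \<Otimes>\<^sub>M lborel)"
  proof -
    show ?thesis unfolding e_def case_prod_beta' by measurable
  qed
  have e_meas: "(\<lambda>b. e b p) \<in> borel_measurable borel" for p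
  proof -
    show ?thesis unfolding e_def by measurable
  qed
  have [measurable]: "g \<in> borel_measurable borel" unfolding g_def[abs_def] by measurable
  have e_le: "norm (e b p) \<le> g b" for b p
  proof (cases "0 < fst p \<and> fst p < snd b \<and> fst p < R")
    case True
    then have "max 0 (snd b - R) + \<epsilon> \<le> snd b - fst p + \<epsilon>" by auto
    then have "(max 0 (snd b - R) + \<epsilon>) * (norm (fst b))\<^sup>2 \<le> (snd b - fst p + \<epsilon>) * (norm (fst b))\<^sup>2"
      by (intro mult_right_mono) auto
    then have "gauss (snd b - fst p + \<epsilon>) (fst b) \<le> gauss (max 0 (snd b - R) + \<epsilon>) (fst b)"
      by (simp only: exp_le_cancel_iff mult_minus_left neg_le_iff_le)
    then show ?thesis using True unfolding e_def g_def by (auto simp: norm_mult intro!: mult_left_mono)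
  next
    case False
    then have "e b p = 0" by (auto simp: e_def indicator_def)
    then show ?thesis by (simp add: g_def)
  qed
  have g2: "integrable lborel (\<lambda>b. (g b)\<^sup>2)"
  proof (rule integrableI_bounded)
    let ?E = "\<lambda>\<xi> :: real ^ 'n. gauss (2 * \<epsilon>) \<xi>"
    have slice: "(\<integral>\<^sup>+t. ennreal ((g (\<xi>, t))\<^sup>2) \<partial>lborel) \<le> ennreal (R * (norm \<xi> ^ 2 * ?E \<xi>) + ?E \<xi> / 2)" for \<xi>
    proof (cases "\<xi> = 0")
      case False
      define l where "l = (norm \<xi>)\<^sup>2"
      have l: "2 * l > 0" using False by (simp add: l_def)
      let ?h = "\<lambda>t. l * ?E \<xi> * indicator {0..R} t + l * ?E \<xi> * exp (R * (2 * l)) * (indicator {R<..} t * exp (- t * (2 * l)))"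
      have "has_bochner_integral lborel ?h (l * ?E \<xi> * measure lborel {0..R} + l * ?E \<xi> * exp (R * (2 * l)) * (exp (- R * (2 * l)) / (2 * l)))"
        using R by (intro has_bochner_integral_add has_bochner_integral_mult_right has_bochner_integral_real_indicator has_bochner_integral_exp_tail_open[OF l]) auto
      also have "l * ?E \<xi> * measure lborel {0..R} + l * ?E \<xi> * exp (R * (2 * l)) * (exp (- R * (2 * l)) / (2 * l)) = R * (norm \<xi> ^ 2 * ?E \<xi>) + ?E \<xi> / 2"
        using R False l by (simp add: l_def exp_minus)
      finally have h: "has_bochner_integral lborel ?h (R * (norm \<xi> ^ 2 * ?E \<xi>) + ?E \<xi> / 2)" .
      have "(\<integral>\<^sup>+t. ennreal ((g (\<xi>, t))\<^sup>2) \<partial>lborel) \<le> (\<integral>\<^sup>+t. ennreal (?h t) \<partial>lborel)"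
      proof (intro nn_integral_mono ennreal_leI)
        fix t :: real
        have sq: "(exp a)\<^sup>2 = exp (2 * a)" for a :: real by (simp add: exp_double)
        consider "t \<le> 0" | "0 < t" "t \<le> R" | "R < t" by linarith
        then show "(g (\<xi>, t))\<^sup>2 \<le> ?h t"
        proof cases
          case 1
          then show ?thesis using l by (simp add: g_def)
        next
          case 2
          then have "(g (\<xi>, t))\<^sup>2 = l * ?E \<xi>"
            by (simp add: g_def power_mult_distrib sq l_def mult.assoc)
          then show ?thesis using 2 l by simp
        next
          case 3
          have "(g (\<xi>, t))\<^sup>2 = l * exp (2 * (- ((t - R) + \<epsilon>) * l))"
            using 3 R by (simp add: g_def power_mult_distrib sq l_def)
          also have "exp (2 * (- ((t - R) + \<epsilon>) * l)) = ?E \<xi> * exp (R * (2 * l)) * exp (- t * (2 * l))"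
            unfolding exp_add[symmetric] l_def[symmetric] by (simp add: algebra_simps)
          finally show ?thesis using 3 R l by simp
        qed
      qed
      also have "\<dots> = ennreal (R * (norm \<xi> ^ 2 * ?E \<xi>) + ?E \<xi> / 2)"
        using l R by (subst nn_integral_eq_integral[OF integrable.intros[OF h]])
           (auto simp only: has_bochner_integral_integral_eq[OF h] intro!: AE_I2 add_nonneg_nonneg mult_nonneg_nonneg, auto)
      finally show ?thesis .
    qed (simp add: g_def)
    have int: "integrable lborel (\<lambda>\<xi> :: real ^ 'n. R * (norm \<xi> ^ 2 * ?E \<xi>) + ?E \<xi> / 2)"
      using \<epsilon> by (intro Bochner_Integration.integrable_add integrable_mult_right integrable_divide_zero integrable_norm_power_gauss integrable_gauss) auto
    have "(\<integral>\<^sup>+b. ennreal (norm ((g b)\<^sup>2)) \<partial>lborel) = (\<integral>\<^sup>+b. ennreal ((g b)\<^sup>2) \<partial>(lborel \<Otimes>\<^sub>M lborel))"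
      unfolding lborel_prod by simp
    also have "\<dots> = (\<integral>\<^sup>+\<xi>. \<integral>\<^sup>+t. ennreal ((g (\<xi>, t))\<^sup>2) \<partial>lborel \<partial>lborel)"
      by (rule lborel.nn_integral_fst[symmetric]) (unfold lborel_prod, measurable)
    also have "\<dots> \<le> (\<integral>\<^sup>+\<xi>. ennreal (R * (norm \<xi> ^ 2 * ?E \<xi>) + ?E \<xi> / 2) \<partial>lborel)"
      by (intro nn_integral_mono slice)
    also have "\<dots> < \<infinity>"
      using R by (subst nn_integral_eq_integral[OF int]) auto
    finally show "(\<integral>\<^sup>+b. ennreal (norm ((g b)\<^sup>2)) \<partial>lborel) < \<infinity>" .
  qed measurable
  have kernel: "(LINT b|lborel. e b p * cnj (e b q)) = complex_of_real (heat_fourier (\<bar>fst p - fst q\<bar> + 2 * \<epsilon>) (snd p - snd q) / 2)"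
    if pq: "0 < fst p" "fst p < R" "0 < fst q" "fst q < R" for p q
  proof -
    obtain s y where p: "p = (s, y)" by (cases p)
    obtain \<sigma> z where q: "q = (\<sigma>, z)" by (cases q)
    define f where "f b = e b p * cnj (e b q)" for b
    have [measurable]: "f \<in> borel_measurable borel"
      unfolding f_def using e_meas[of p] e_meas[of q] by measurable
    have int: "integrable (lborel \<Otimes>\<^sub>M lborel) f"
      unfolding lborel_prod
    proof (rule Bochner_Integration.integrable_bound[OF g2])
      have "norm (f b) \<le> g b * g b" for b
        unfolding f_def norm_mult complex_mod_cnj by (intro mult_mono e_le) (auto simp: g_def)
      then show "AE b in lborel. norm (f b) \<le> norm ((g b)\<^sup>2)" by (simp add: power2_eq_square)
    qed simp
    have f_eq: "f (\<xi>, t) = complex_of_real ((norm \<xi>)\<^sup>2 * exp ((s + \<sigma> - 2 * \<epsilon>) * (norm \<xi>)\<^sup>2) * (indicator {max s \<sigma><..} t * exp (- t * (2 * (norm \<xi>)\<^sup>2)))) * cis ((z - y) \<bullet> \<xi>)" for \<xi> t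
    proof (cases "max s \<sigma> < t")
      case True
      have c: "cis ((z - y) \<bullet> \<xi>) = cis (- (y \<bullet> \<xi>)) * cis (z \<bullet> \<xi>)"
        unfolding cis_mult by (simp add: inner_diff_left)
      have x: "gauss (t - s + \<epsilon>) \<xi> * gauss (t - \<sigma> + \<epsilon>) \<xi>
         = exp ((s + \<sigma> - 2 * \<epsilon>) * (norm \<xi>)\<^sup>2) * exp (- t * (2 * (norm \<xi>)\<^sup>2))"
        unfolding exp_add[symmetric] by (simp add: algebra_simps)
      have "f (\<xi>, t) = complex_of_real ((norm \<xi>)\<^sup>2 * (gauss (t - s + \<epsilon>) \<xi> * gauss (t - \<sigma> + \<epsilon>) \<xi>)) * (cis (- (y \<bullet> \<xi>)) * cis (z \<bullet> \<xi>))"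
        using True that by (simp add: f_def e_def p q cis_cnj power2_eq_square mult_ac)
      then show ?thesis unfolding x c using True by (simp add: mult_ac)
    next
      case False
      then show ?thesis by (auto simp: f_def e_def p q indicator_def)
    qed
    (* max s \<sigma> is the time from which both modes are present, and 2 * max s \<sigma> - s - \<sigma> = |s - \<sigma>|. *)
    have inner: "(LINT t|lborel. f (\<xi>, t)) = complex_of_real (1 / 2) * (complex_of_real (gauss (\<bar>s - \<sigma>\<bar> + 2 * \<epsilon>) \<xi>) * cis ((z - y) \<bullet> \<xi>))" if "\<xi> \<noteq> 0" for \<xi>
    proof -
      define l where "l = (norm \<xi>)\<^sup>2"
      have l: "2 * l > 0" using that by (simp add: l_def)
      have "(LINT t|lborel. f (\<xi>, t)) = complex_of_real (LINT t|lborel. l * exp ((s + \<sigma> - 2 * \<epsilon>) * l) * (indicator {max s \<sigma><..} t * exp (- t * (2 * l)))) * cis ((z - y) \<bullet> \<xi>)"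
        unfolding f_eq l_def by (simp only: integral_mult_left_zero integral_complex_of_real)
      also have "(LINT t|lborel. l * exp ((s + \<sigma> - 2 * \<epsilon>) * l) * (indicator {max s \<sigma><..} t * exp (- t * (2 * l)))) = l * exp ((s + \<sigma> - 2 * \<epsilon>) * l) * (exp (- max s \<sigma> * (2 * l)) / (2 * l))"
        by (simp only: integral_mult_right_zero has_bochner_integral_integral_eq[OF has_bochner_integral_exp_tail_open[OF l]])
      also have "\<dots> = 1 / 2 * (exp ((s + \<sigma> - 2 * \<epsilon>) * l) * exp (- max s \<sigma> * (2 * l)))"
        using l by simp
      also have "exp ((s + \<sigma> - 2 * \<epsilon>) * l) * exp (- max s \<sigma> * (2 * l)) = exp (- (\<bar>s - \<sigma>\<bar> + 2 * \<epsilon>) * l)"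
        unfolding exp_add[symmetric] by (simp add: algebra_simps max_def abs_if)
      finally show ?thesis by (simp add: l_def)
    qed
    have "(LINT b|lborel. f b) = (LINT \<xi>|lborel. LINT t|lborel. f (\<xi>, t))"
      using lborel_pair.integral_fst'[OF int] by (simp add: lborel_prod)
    also have "\<dots> = (LINT \<xi>|lborel. complex_of_real (1 / 2) * (complex_of_real (gauss (\<bar>s - \<sigma>\<bar> + 2 * \<epsilon>) \<xi>) * cis ((z - y) \<bullet> \<xi>)))"
    proof (rule integral_cong_AE)
      have "f \<in> borel_measurable (lborel \<Otimes>\<^sub>M lborel)" unfolding lborel_prod by simp
      then show "(\<lambda>\<xi>. LINT t|lborel. f (\<xi>, t)) \<in> borel_measurable lborel" by measurable
      show "AE \<xi> in lborel. (LINT t|lborel. f (\<xi>, t)) = complex_of_real (1 / 2) * (complex_of_real (gauss (\<bar>s - \<sigma>\<bar> + 2 * \<epsilon>) \<xi>) * cis ((z - y) \<bullet> \<xi>))"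
        using AE_lborel_singleton[of "0 :: real ^ 'n"] by (rule AE_mp) (rule AE_I2, use inner in blast)
    qed measurable
    also have "\<dots> = complex_of_real (1 / 2) * complex_of_real (heat_fourier (\<bar>s - \<sigma>\<bar> + 2 * \<epsilon>) (z - y))"
      using \<epsilon> by (subst integral_mult_right_zero, subst fourier_gauss_diff) auto
    also have "\<dots> = complex_of_real (heat_fourier (\<bar>s - \<sigma>\<bar> + 2 * \<epsilon>) (y - z) / 2)"
      by (simp add: heat_fourier_minus[of _ z y])
    finally show ?thesis by (simp add: f_def p q)
  qed
  have "(\<integral>\<^sup>+t. indicator {0<..<R} t * (\<integral>\<^sup>+\<xi>. ennreal ((norm \<xi> * norm (heat_transform \<epsilon> F t \<xi>))\<^sup>2) \<partial>lborel) \<partial>lborel)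
     \<le> (\<integral>\<^sup>+t. \<integral>\<^sup>+\<xi>. ennreal ((norm (LINT p|lborel. F p * e (\<xi>, t) p))\<^sup>2) \<partial>lborel \<partial>lborel)"
  proof (rule nn_integral_mono)
    fix t :: real
    have "(LINT p|lborel. F p * e (\<xi>, t) p) = complex_of_real (norm \<xi>) * heat_transform \<epsilon> F t \<xi>" for \<xi>
    proof -
      have "(LINT p|lborel. F p * e (\<xi>, t) p) = (LINT p|lborel. complex_of_real (norm \<xi>) * (F p *
     (heat_mode \<epsilon> t \<xi> p)))"
      proof (rule Bochner_Integration.integral_cong[OF refl])
        fix p
        show "F p * e (\<xi>, t) p = complex_of_real (norm \<xi>) * (F p *
     (heat_mode \<epsilon> t \<xi> p))"
          using supp[of p] by (cases "F p = 0") (auto simp: e_def)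
      qed
      then show ?thesis unfolding heat_transform_def by (simp only: integral_mult_right_zero)
    qed
    then show "indicator {0<..<R} t * (\<integral>\<^sup>+\<xi>. ennreal ((norm \<xi> * norm (heat_transform \<epsilon> F t \<xi>))\<^sup>2) \<partial>lborel)
      \<le> (\<integral>\<^sup>+\<xi>. ennreal ((norm (LINT p|lborel. F p * e (\<xi>, t) p))\<^sup>2) \<partial>lborel)"
      by (simp add: norm_mult indicator_def)
  qed
  also have "\<dots> = (\<integral>\<^sup>+b. ennreal ((norm (LINT p|lborel. F p * e b p))\<^sup>2) \<partial>(lborel \<Otimes>\<^sub>M lborel))"
    by (rule lborel_pair.nn_integral_snd) (unfold lborel_prod, measurable)
  also have "\<dots> = (\<integral>\<^sup>+b. ennreal ((norm (LINT p|lborel. F p * e b p))\<^sup>2) \<partial>lborel)"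
    unfolding lborel_prod ..
  also have "\<dots> \<le> (\<integral>\<^sup>+p. \<integral>\<^sup>+q. ennreal (norm (F p) * norm (F q) * norm (LINT b|lborel. e b p * cnj (e b q))) \<partial>lborel \<partial>lborel)"
  proof (rule nn_integral_sq_integral_le[where g = g])
    show "pair_sigma_finite (lborel :: ((real ^ 'n) \<times> real) measure) (lborel :: ('n spacetime) measure)" by unfold_locales
  qed (use F g2 e_le in auto)
  also have "\<dots> \<le> (\<integral>\<^sup>+p. \<integral>\<^sup>+q. ennreal (norm (F p) * norm (F q) * (heat_fourier (\<bar>fst p - fst q\<bar> + 2 * \<epsilon>) (snd p - snd q) / 2)) \<partial>lborel \<partial>lborel)"
  proof (intro nn_integral_mono ennreal_leI)
    fix p q
    show "norm (F p) * norm (F q) * norm (LINT b|lborel. e b p * cnj (e b q)) \<le> norm (F p) * norm (F q) * (heat_fourier (\<bar>fst p - fst q\<bar> + 2 * \<epsilon>) (snd p - snd q) / 2)"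
    proof (cases "F p = 0 \<or> F q = 0")
      case False
      have "heat_fourier (\<bar>fst p - fst q\<bar> + 2 * \<epsilon>) (snd p - snd q) \<ge> 0"
        using \<epsilon> by (intro heat_fourier_nonneg) auto
      then have "norm (LINT b|lborel. e b p * cnj (e b q)) = heat_fourier (\<bar>fst p - fst q\<bar> + 2 * \<epsilon>) (snd p - snd q) / 2"
        using False supp[of p] supp[of q] by (subst kernel) (simp_all only: norm_of_real, auto)
      then show ?thesis by (simp only: order_refl)
    qed auto
  qed
  finally show ?thesis .
qed

abbreviation strip_energy :: "real \<Rightarrow> (real \<Rightarrow> real ^ 'n::finite \<Rightarrow> complex) \<Rightarrow> ennreal" where
  "strip_energy R u \<equiv> \<integral>\<^sup>+t. indicator {0<..<R} t * (\<integral>\<^sup>+x. ennreal ((norm (u t x))\<^sup>2) \<partial>lborel) \<partial>lborel"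

abbreviation cylinder_energy :: "real \<Rightarrow> real ^ 'n::finite \<Rightarrow> (real \<Rightarrow> real ^ 'n \<Rightarrow> complex) \<Rightarrow> ennreal" where
  "cylinder_energy R a u \<equiv> \<integral>\<^sup>+t. indicator {0<..<R} t *
     (\<integral>\<^sup>+x. indicator (ball a (sqrt R)) x * ennreal ((norm (u t x))\<^sup>2) \<partial>lborel) \<partial>lborel"

text \<open>
  The hypothesis \<open>|m(\<xi>)| \<le> |\<xi>|\<close> discards everything about the multiplier except its size; for the
  Oseen kernel this is the \<open>L\<^sup>2\<close>-boundedness of the Leray projection.
\<close>
lemma duhamel_energy_le:
  fixes F :: "'n::finite spacetime \<Rightarrow> complex"
  assumes F: "integrable lborel F" and \<epsilon>: "\<epsilon> > 0" and R: "R > 0"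
    and supp: "\<And>p. F p \<noteq> 0 \<Longrightarrow> 0 < fst p \<and> fst p < R"
    and m [measurable]: "m \<in> borel_measurable borel" and m_le: "\<And>\<xi>. norm (m \<xi>) \<le> norm \<xi>"
  shows "(strip_energy R (duhamel (multiplier_kernel m) \<epsilon> F))
    \<le> (\<integral>\<^sup>+p. \<integral>\<^sup>+q. ennreal (norm (F p) * norm (F q) * (heat_fourier (\<bar>fst p - fst q\<bar> + 2 * \<epsilon>) (snd p - snd q) / 2)) \<partial>lborel \<partial>lborel)"
proof -
  have spatial: "(\<integral>\<^sup>+x. ennreal ((norm (duhamel (multiplier_kernel m) \<epsilon> F t x))\<^sup>2) \<partial>lborel)
      \<le> (\<integral>\<^sup>+\<xi>. ennreal ((norm \<xi> * norm (heat_transform \<epsilon> F t \<xi>))\<^sup>2) \<partial>lborel)" for t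
  proof -
    let ?c = "1 / (2 * pi) ^ CARD('n)"
    let ?I = "\<lambda>x. LINT \<xi>|lborel. m \<xi> * heat_transform \<epsilon> F t \<xi> * cis (x \<bullet> \<xi>)"
    have c0: "?c \<ge> 0" by simp
    have "1 \<le> (2 * pi) ^ CARD('n)" using pi_ge_two by (intro one_le_power) linarith
    then have c1: "?c \<le> 1" by (simp add: divide_le_eq)
    have int: "integrable lborel (\<lambda>\<xi>. m \<xi> * heat_transform \<epsilon> F t \<xi>)"
      by (rule integrable_multiplier_heat_transform[OF F \<epsilon> m m_le])
    have [measurable]: "?I \<in> borel_measurable borel"
    proof -
      have [measurable]: "(\<lambda>\<xi>. m \<xi> * heat_transform \<epsilon> F t \<xi>) \<in> borel_measurable borel" using int by auto
      show ?thesis by measurable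
    qed
    have "(\<integral>\<^sup>+x. ennreal ((norm (duhamel (multiplier_kernel m) \<epsilon> F t x))\<^sup>2) \<partial>lborel) = (\<integral>\<^sup>+x. ennreal (?c\<^sup>2) * ennreal ((norm (?I x))\<^sup>2) \<partial>lborel)"
      unfolding duhamel_eq_inverse_fourier[OF F \<epsilon> m m_le] norm_mult norm_of_real
      by (intro nn_integral_cong) (simp add: ennreal_mult[symmetric] power_mult_distrib power_divide)
    also have "\<dots> = ennreal (?c\<^sup>2) * (\<integral>\<^sup>+x. ennreal ((norm (?I x))\<^sup>2) \<partial>lborel)"
      by (rule nn_integral_cmult) measurable
    also have "\<dots> \<le> ennreal (?c\<^sup>2) * (ennreal ((2 * pi) ^ CARD('n)) * (\<integral>\<^sup>+\<xi>. ennreal ((norm (m \<xi> * heat_transform \<epsilon> F t \<xi>))\<^sup>2) \<partial>lborel))"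
      by (intro mult_left_mono plancherel_le int) auto
    also have "\<dots> = ennreal (?c\<^sup>2 * (2 * pi) ^ CARD('n)) * (\<integral>\<^sup>+\<xi>. ennreal ((norm (m \<xi> * heat_transform \<epsilon> F t \<xi>))\<^sup>2) \<partial>lborel)"
      by (simp add: ennreal_mult mult.assoc)
    also have "?c\<^sup>2 * (2 * pi) ^ CARD('n) = ?c" by (simp add: power2_eq_square)
    also have "ennreal ?c * (\<integral>\<^sup>+\<xi>. ennreal ((norm (m \<xi> * heat_transform \<epsilon> F t \<xi>))\<^sup>2) \<partial>lborel)
       \<le> 1 * (\<integral>\<^sup>+\<xi>. ennreal ((norm \<xi> * norm (heat_transform \<epsilon> F t \<xi>))\<^sup>2) \<partial>lborel)"
      using c1 m_le by (intro mult_mono nn_integral_mono ennreal_leI power_mono) (auto simp: norm_mult mult_right_mono)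
    finally show ?thesis by simp
  qed
  have "(strip_energy R (duhamel (multiplier_kernel m) \<epsilon> F))
     \<le> (\<integral>\<^sup>+t. indicator {0<..<R} t * (\<integral>\<^sup>+\<xi>. ennreal ((norm \<xi> * norm (heat_transform \<epsilon> F t \<xi>))\<^sup>2) \<partial>lborel) \<partial>lborel)"
    by (intro nn_integral_mono mult_left_mono[OF spatial] zero_le)
  also note nn_integral_heat_transform_le[OF F \<epsilon> R supp]
  finally show ?thesis .
qed

lemma nn_integral_symmetric_le:
  fixes W :: "'n::finite spacetime \<Rightarrow> 'n spacetime \<Rightarrow> ennreal"
  assumes [measurable]: "(\<lambda>(p, q). W p q) \<in> borel_measurable (lborel \<Otimes>\<^sub>M lborel)" and sym: "\<And>p q. W p q = W q p"
  shows "(\<integral>\<^sup>+p. \<integral>\<^sup>+q. W p q \<partial>lborel \<partial>lborel) \<le> 2 * (\<integral>\<^sup>+q. \<integral>\<^sup>+p. indicator {..fst q} (fst p) * W p q \<partial>lborel \<partial>lborel)"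
proof -
  let ?V = "\<lambda>p q. indicator {..fst q} (fst p) * W p q"
  have [measurable]: "(\<lambda>(p, q). ?V p q) \<in> borel_measurable (lborel \<Otimes>\<^sub>M lborel)"
    unfolding indicator_def atMost_iff by measurable
  have "(\<integral>\<^sup>+p. \<integral>\<^sup>+q. W p q \<partial>lborel \<partial>lborel) \<le> (\<integral>\<^sup>+p. \<integral>\<^sup>+q. ?V p q + ?V q p \<partial>lborel \<partial>lborel)"
    by (intro nn_integral_mono) (auto simp: indicator_def sym)
  also have "\<dots> = (\<integral>\<^sup>+p. (\<integral>\<^sup>+q. ?V p q \<partial>lborel) + (\<integral>\<^sup>+q. ?V q p \<partial>lborel) \<partial>lborel)"
    by (intro nn_integral_cong nn_integral_add) measurable
  also have "\<dots> = (\<integral>\<^sup>+p. (\<integral>\<^sup>+q. ?V p q \<partial>lborel) \<partial>lborel) + (\<integral>\<^sup>+p. (\<integral>\<^sup>+q. ?V q p \<partial>lborel) \<partial>lborel)"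
    by (intro nn_integral_add) measurable
  also have "(\<integral>\<^sup>+p. (\<integral>\<^sup>+q. ?V p q \<partial>lborel) \<partial>lborel) = (\<integral>\<^sup>+q. (\<integral>\<^sup>+p. ?V p q \<partial>lborel) \<partial>lborel)"
    by (rule lborel_pair.Fubini'[symmetric]) measurable
  finally show ?thesis by (simp add: mult_2)
qed

section \<open>Sources with a Carleson bound and a decay bound\<close>

lemma time_interval_downward: "t \<in> time_interval T \<Longrightarrow> 0 < s \<Longrightarrow> s \<le> t \<Longrightarrow> s \<in> time_interval T"
  using le_less_trans[of "ereal s" "ereal t" T] by (simp add: time_interval_def)

text \<open>
  The scale-invariant bounds that a product of two functions of the path space satisfies. The
  restriction to a Borel function of space-time makes Tonelli's theorem directly applicable.
\<close>
definition source_bound :: "ereal \<Rightarrow> real \<Rightarrow> ('n::finite spacetime \<Rightarrow> complex) \<Rightarrow> bool" where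
  "source_bound T M F \<longleftrightarrow> F \<in> borel_measurable borel \<and> 0 \<le> M
     \<and> (AE p in lborel. fst p \<in> time_interval T \<longrightarrow> norm (F p) \<le> M / fst p)
     \<and> (\<forall>t\<in>time_interval T. \<forall>x. (\<integral>\<^sup>+p. before t p * indicator (ball x (sqrt t)) (snd p) * ennreal (norm (F p)) \<partial>lborel)
           \<le> ennreal (M * sqrt t ^ CARD('n)))"

lemma nn_integral_carleson_decay_weight:
  fixes h :: "'n::finite spacetime \<Rightarrow> ennreal"
  assumes [measurable]: "h \<in> borel_measurable borel" and t: "t > 0" and c: "c \<ge> 0"
    and carleson: "\<And>x. (\<integral>\<^sup>+p. before t p * indicator (ball x (sqrt t)) (snd p) * h p \<partial>lborel) \<le> ennreal (c * sqrt t ^ CARD('n))"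
  shows "(\<integral>\<^sup>+p. before t p * h p * ennreal (decay_weight (sqrt t) (x - snd p)) \<partial>lborel)
    \<le> ennreal (2 ^ (CARD('n) + 1) * real (CARD('n) + 1) * c / sqrt t)"
proof -
  let ?n = "CARD('n)"
  have [measurable]: "h \<in> borel_measurable (borel \<Otimes>\<^sub>M borel)" unfolding borel_prod by measurable
  define H where "H y = (\<integral>\<^sup>+s. indicator {0<..<t} s * h (s, y) \<partial>lborel)" for y
  have [measurable]: "H \<in> borel_measurable borel" unfolding H_def by measurable
  have "(\<integral>\<^sup>+p. before t p * h p * ennreal (decay_weight (sqrt t) (x - snd p)) \<partial>lborel)
     = (\<integral>\<^sup>+y. \<integral>\<^sup>+s. indicator {0<..<t} s * h (s, y) * ennreal (decay_weight (sqrt t) (x - y)) \<partial>lborel \<partial>lborel)"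
  proof (subst nn_integral_lborel_pair_snd)
    show "(\<lambda>p. before t p * h p * ennreal (decay_weight (sqrt t) (x - snd p))) \<in> borel_measurable borel"
      by measurable
  qed simp
  also have "\<dots> = (\<integral>\<^sup>+y. H y * ennreal (decay_weight (sqrt t) (x - y)) \<partial>lborel)"
    unfolding H_def by (intro nn_integral_cong nn_integral_multc) measurable
  also have "\<dots> \<le> ennreal (2 ^ (?n + 1) * real (?n + 1) * inverse (sqrt t) ^ (?n + 1)) * ennreal (c * sqrt t ^ ?n)"
  proof (rule nn_integral_decay_weight_average)
    fix \<zeta> :: "real ^ 'n"
    have [measurable]: "ball \<zeta> (sqrt t) \<in> sets borel" by simp
    have "(\<integral>\<^sup>+y. H y * indicator (ball \<zeta> (sqrt t)) y \<partial>lborel) = (\<integral>\<^sup>+y. \<integral>\<^sup>+s. indicator {0<..<t} s * indicator (ball \<zeta> (sqrt t)) y * h (s, y) \<partial>lborel \<partial>lborel)"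
    proof (rule nn_integral_cong)
      fix y
      have "H y * indicator (ball \<zeta> (sqrt t)) y = (\<integral>\<^sup>+s. indicator {0<..<t} s * h (s, y) * indicator (ball \<zeta> (sqrt t)) y \<partial>lborel)"
        unfolding H_def by (rule nn_integral_multc[symmetric]) measurable
      then show "H y * indicator (ball \<zeta> (sqrt t)) y = (\<integral>\<^sup>+s. indicator {0<..<t} s * indicator (ball \<zeta> (sqrt t)) y * h (s, y) \<partial>lborel)"
        by (simp only: mult_ac)
    qed
    also have "\<dots> = (\<integral>\<^sup>+p. before t p * indicator (ball \<zeta> (sqrt t)) (snd p) * h p \<partial>lborel)"
    proof (subst nn_integral_lborel_pair_snd)
      show "(\<lambda>p. before t p * indicator (ball \<zeta> (sqrt t)) (snd p) * h p) \<in> borel_measurable borel"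
        by measurable
    qed simp
    also have "\<dots> \<le> ennreal (c * sqrt t ^ ?n)" by (rule carleson)
    finally show "(\<integral>\<^sup>+y. H y * indicator (ball \<zeta> (sqrt t)) y \<partial>lborel) \<le> ennreal (c * sqrt t ^ ?n)" .
  qed (use t in auto)
  also have "\<dots> = ennreal (2 ^ (?n + 1) * real (?n + 1) * inverse (sqrt t) ^ (?n + 1) * (c * sqrt t ^ ?n))"
    using t c by (simp add: ennreal_mult)
  also have "2 ^ (?n + 1) * real (?n + 1) * inverse (sqrt t) ^ (?n + 1) * (c * sqrt t ^ ?n) = 2 ^ (?n + 1) * real (?n + 1) * c / sqrt t"
    using t by (simp add: field_simps)
  finally show ?thesis .
qed

lemma
  assumes "source_bound T M F"
  shows borel_measurable_source: "F \<in> borel_measurable borel" and source_bound_nonneg: "0 \<le> M"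
  using assms by (auto simp: source_bound_def)

lemma nn_integral_source_decay_weight:
  fixes F :: "'n::finite spacetime \<Rightarrow> complex"
  assumes source: "source_bound T M F" and t: "t \<in> time_interval T"
  shows "(\<integral>\<^sup>+p. before t p * ennreal (norm (F p)) * ennreal (decay_weight (sqrt t) (x - snd p)) \<partial>lborel)
    \<le> ennreal (2 ^ (CARD('n) + 1) * real (CARD('n) + 1) * M / sqrt t)"
proof (rule nn_integral_carleson_decay_weight)
  show "(\<lambda>p. ennreal (norm (F p))) \<in> borel_measurable borel" using borel_measurable_source[OF source] by measurable
  show "(\<integral>\<^sup>+p. before t p * indicator (ball x (sqrt t)) (snd p) * ennreal (norm (F p)) \<partial>lborel) \<le> ennreal (M * sqrt t ^ CARD('n))" for x
    using source t unfolding source_bound_def by blast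
qed (use t source_bound_nonneg[OF source] in \<open>auto simp: time_interval_def\<close>)

lemma nn_integral_inverse_sqrt:
  assumes t: "t > 0"
  shows "(\<integral>\<^sup>+s. indicator {0<..<t} s * ennreal (inverse (sqrt (t - s))) \<partial>lborel) = ennreal (2 * sqrt t)"
proof -
  have "((\<lambda>s. s powr (-1/2)) has_integral (t powr (-1/2 + 1) / (-1/2 + 1))) {0..t}"
    using t by (intro has_integral_powr_from_0) auto
  then have "((\<lambda>s. if s \<in> {0..t} then s powr (-1/2) else 0) has_integral (2 * sqrt t)) UNIV"
    using t by (simp only: has_integral_restrict_UNIV) (simp add: powr_half_sqrt mult.commute)
  then have "(\<integral>\<^sup>+s. ennreal (if s \<in> {0..t} then s powr (-1/2) else 0) \<partial>lborel) = ennreal (2 * sqrt t)"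
    by (intro nn_integral_has_integral_lborel) auto
  moreover have "(\<integral>\<^sup>+s. indicator {0<..<t} s * ennreal (inverse (sqrt (t - s))) \<partial>lborel)
    = ennreal \<bar>-1\<bar> * (\<integral>\<^sup>+s. indicator {0<..<t} (t + (-1) * s) * ennreal (inverse (sqrt (t - (t + (-1) * s)))) \<partial>lborel)"
    by (rule nn_integral_real_affine) auto
  moreover have "(\<integral>\<^sup>+s. indicator {0<..<t} (t + (-1) * s) * ennreal (inverse (sqrt (t - (t + (-1) * s)))) \<partial>lborel)
     = (\<integral>\<^sup>+s. ennreal (if s \<in> {0..t} then s powr (-1/2) else 0) \<partial>lborel)"
  proof (rule nn_integral_cong_AE)
    show "AE s in lborel. indicator {0<..<t} (t + (-1) * s) * ennreal (inverse (sqrt (t - (t + (-1) * s)))) = ennreal (if s \<in> {0..t} then s powr (-1/2) else 0)"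
      using AE_lborel_singleton[of "0::real"] AE_lborel_singleton[of t]
      by eventually_elim (auto simp: indicator_def powr_minus powr_half_sqrt)
  qed
  ultimately show ?thesis by simp
qed

lemma nn_integral_le_combination:
  assumes [measurable]: "f \<in> borel_measurable M" "g \<in> borel_measurable M"
    and h: "AE p in M. h p \<le> ennreal a * f p + ennreal b * g p"
    and f: "(\<integral>\<^sup>+p. f p \<partial>M) \<le> ennreal A" and g: "(\<integral>\<^sup>+p. g p \<partial>M) \<le> ennreal B"
    and nonneg: "0 \<le> a" "0 \<le> b" "0 \<le> A" "0 \<le> B"
  shows "(\<integral>\<^sup>+p. h p \<partial>M) \<le> ennreal (a * A + b * B)"
proof -
  have "(\<integral>\<^sup>+p. h p \<partial>M) \<le> (\<integral>\<^sup>+p. ennreal a * f p + ennreal b * g p \<partial>M)"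
    by (rule nn_integral_mono_AE[OF h])
  also have "\<dots> = ennreal a * (\<integral>\<^sup>+p. f p \<partial>M) + ennreal b * (\<integral>\<^sup>+p. g p \<partial>M)"
    by (simp add: nn_integral_add nn_integral_cmult)
  also have "\<dots> \<le> ennreal a * ennreal A + ennreal b * ennreal B"
    by (intro add_mono mult_left_mono f g) auto
  also have "\<dots> = ennreal (a * A + b * B)" using nonneg by (simp add: ennreal_mult)
  finally show ?thesis .
qed

text \<open>
  Before time \<open>b\<close> only the Carleson bound is available; it is applied at scale \<open>\<surd>r\<close>, for which
  \<open>\<phi>\<close> must be dominated by a decaying weight. After time \<open>b\<close> the source is at most \<open>M / b\<close>, and it
  suffices that \<open>\<phi>\<close> is integrable.
\<close>
lemma nn_integral_source_early_late:
  fixes F :: "'n::finite spacetime \<Rightarrow> complex" and \<phi> :: "'n spacetime \<Rightarrow> real"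
  assumes source: "source_bound T M F" and r: "r \<in> time_interval T" and b: "0 < b"
    and [measurable]: "\<phi> \<in> borel_measurable borel" "S \<in> sets borel" and S: "S \<subseteq> time_interval T"
    and early: "\<And>p. fst p \<in> S \<Longrightarrow> fst p \<le> b \<Longrightarrow> fst p < r \<and> \<phi> p \<le> c * decay_weight (sqrt r) (x - snd p)"
    and late: "(\<integral>\<^sup>+p. indicator (S \<inter> {b..}) (fst p) * ennreal (\<phi> p) \<partial>lborel) \<le> ennreal L"
    and nonneg: "0 \<le> c" "0 \<le> L"
  shows "(\<integral>\<^sup>+p. indicator S (fst p) * ennreal (norm (F p)) * ennreal (\<phi> p) \<partial>lborel)
    \<le> ennreal (c * (2 ^ (CARD('n) + 1) * real (CARD('n) + 1) * M / sqrt r) + M / b * L)"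
proof (rule nn_integral_le_combination[OF _ _ _ nn_integral_source_decay_weight[OF source r] late])
  note [measurable] = borel_measurable_source[OF source]
  have M: "M \<ge> 0" and r0: "r > 0" using source r by (auto simp: source_bound_def time_interval_def)
  then show "0 \<le> M / b" "0 \<le> 2 ^ (CARD('n) + 1) * real (CARD('n) + 1) * M / sqrt r" using b by auto
  have "AE p in lborel. fst p \<in> time_interval T \<longrightarrow> norm (F p) \<le> M / fst p"
    using source unfolding source_bound_def by blast
  then show "AE p in lborel. indicator S (fst p) * ennreal (norm (F p)) * ennreal (\<phi> p)
    \<le> ennreal c * (before r p * ennreal (norm (F p)) * ennreal (decay_weight (sqrt r) (x - snd p)))
      + ennreal (M / b) * (indicator (S \<inter> {b..}) (fst p) * ennreal (\<phi> p))"
  proof eventually_elim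
    case (elim p)
    show ?case
    proof (cases "fst p \<in> S")
      case True
      with S have p: "fst p \<in> time_interval T" "0 < fst p" by (auto simp: time_interval_def)
      show ?thesis
      proof (cases "fst p \<le> b")
        case le: True
        have "ennreal (norm (F p)) * ennreal (\<phi> p) \<le> ennreal (norm (F p)) * (ennreal c * ennreal (decay_weight (sqrt r) (x - snd p)))"
          using early[OF True le] nonneg r0
          by (intro mult_left_mono) (simp_all add: ennreal_mult[symmetric] decay_weight_nonneg ennreal_leI)
        then show ?thesis using True early[OF True le] p by (simp add: mult_ac add_increasing2)
      next
        case False
        have "norm (F p) \<le> M / fst p" using elim p by simp
        also have "\<dots> \<le> M / b" using False b M p by (intro divide_left_mono) auto
        finally have "ennreal (norm (F p)) * ennreal (\<phi> p) \<le> ennreal (M / b) * ennreal (\<phi> p)"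
          by (intro mult_right_mono ennreal_leI) auto
        then show ?thesis using True False by (simp add: add_increasing)
      qed
    qed simp
  qed
  show "(\<lambda>p. before r p * ennreal (norm (F p)) * ennreal (decay_weight (sqrt r) (x - snd p))) \<in> borel_measurable lborel"
    "(\<lambda>p. indicator (S \<inter> {b..}) (fst p) * ennreal (\<phi> p)) \<in> borel_measurable lborel"
    by measurable
qed (use nonneg in auto)

abbreviation parabolic_mass :: "('n::finite spacetime \<Rightarrow> complex) \<Rightarrow> real \<Rightarrow> real ^ 'n \<Rightarrow> ennreal" where
  "parabolic_mass F t x \<equiv> \<integral>\<^sup>+p. before t p * ennreal (norm (F p)) *
     ennreal (decay_weight (sqrt (t - fst p)) (x - snd p)) \<partial>lborel"

lemma nn_integral_source_parabolic_weight:
  obtains B where "B > 0" "\<And>T M (F :: 'n::finite spacetime \<Rightarrow> complex) t x. source_bound T M F \<Longrightarrow> t \<in> time_interval T \<Longrightarrow>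
    (parabolic_mass F t x)
    \<le> ennreal (B * M / sqrt t)"
proof -
  let ?n = "CARD('n)" and ?V = "unit_ball_vol (real CARD('n))"
  let ?A = "2 ^ (?n + 1) * real (?n + 1) :: real" and ?W = "real (?n + 1) * ?V"
  have V: "?V > 0" by simp
  show ?thesis
  proof (rule that[of "2 ^ (?n + 1) * ?A + 4 * ?W"])
    show "2 ^ (?n + 1) * ?A + 4 * ?W > 0" using V by (intro add_pos_pos) simp_all
    fix T M t and F :: "'n spacetime \<Rightarrow> complex" and x :: "real ^ 'n"
    assume source: "source_bound T M F" and t: "t \<in> time_interval T"
    have t0: "t > 0" using t by (simp add: time_interval_def)
    have "(parabolic_mass F t x)
      \<le> ennreal (2 ^ (?n + 1) * (?A * M / sqrt t) + M / (t / 2) * (?W * (2 * sqrt t)))"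
    proof (rule nn_integral_source_early_late[OF source t])
      show "{0<..<t} \<subseteq> time_interval T" using time_interval_downward[OF t] by auto
      show "fst p < t \<and> decay_weight (sqrt (t - fst p)) (x - snd p) \<le> 2 ^ (?n + 1) * decay_weight (sqrt t) (x - snd p)"
        if "fst p \<in> {0<..<t}" and early: "fst p \<le> t / 2" for p
      proof
        have "t \<le> 2\<^sup>2 * (t - fst p)" using early t0 by simp
        then have "sqrt t \<le> sqrt (2\<^sup>2 * (t - fst p))" by (rule real_sqrt_le_mono)
        also have "\<dots> = 2 * sqrt (t - fst p)" by (simp only: real_sqrt_mult real_sqrt_abs abs_numeral)
        finally have "sqrt t + norm (x - snd p) \<le> 2 * (sqrt (t - fst p) + norm (x - snd p))"
          using norm_ge_zero[of "x - snd p"] unfolding distrib_left by linarith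
        then show "decay_weight (sqrt (t - fst p)) (x - snd p) \<le> 2 ^ (?n + 1) * decay_weight (sqrt t) (x - snd p)"
          using t0 by (intro decay_weight_le) auto
      qed (use that in simp)
      let ?late = "\<lambda>p. indicator ({0<..<t} \<inter> {t / 2..}) (fst p) * ennreal (decay_weight (sqrt (t - fst p)) (x - snd p))"
      have "(\<integral>\<^sup>+p. ?late p \<partial>lborel) = (\<integral>\<^sup>+s. \<integral>\<^sup>+y. ?late (s, y) \<partial>lborel \<partial>lborel)"
        by (rule nn_integral_lborel_pair_fst) measurable
      also have "\<dots> \<le> (\<integral>\<^sup>+s. ennreal ?W * (indicator {0<..<t} s * ennreal (inverse (sqrt (t - s)))) \<partial>lborel)"
      proof (rule nn_integral_mono)
        fix s
        show "(\<integral>\<^sup>+y. ?late (s, y) \<partial>lborel) \<le> ennreal ?W * (indicator {0<..<t} s * ennreal (inverse (sqrt (t - s))))"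
          using nn_integral_decay_weight[of "sqrt (t - s)" x] V by (simp add: indicator_def ennreal_mult)
      qed
      also have "\<dots> = ennreal ?W * (\<integral>\<^sup>+s. indicator {0<..<t} s * ennreal (inverse (sqrt (t - s))) \<partial>lborel)"
        by (rule nn_integral_cmult) measurable
      also have "\<dots> = ennreal (?W * (2 * sqrt t))"
        unfolding nn_integral_inverse_sqrt[OF t0] using V t0 by (simp add: ennreal_mult)
      finally show "(\<integral>\<^sup>+p. ?late p \<partial>lborel) \<le> ennreal (?W * (2 * sqrt t))" .
    qed (use t0 V in auto)
    also have "2 ^ (?n + 1) * (?A * M / sqrt t) + M / (t / 2) * (?W * (2 * sqrt t)) = (2 ^ (?n + 1) * ?A + 4 * ?W) * M / sqrt t"
    proof -
      have eq: "1 / t * sqrt t = 1 / sqrt t" using t0 by (simp add: real_div_sqrt field_simps)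
      have "M / (t / 2) * (?W * (2 * sqrt t)) = 4 * ?W * M * (1 / t * sqrt t)" by simp
      also have "\<dots> = 4 * ?W * M / sqrt t" unfolding eq by simp
      finally show ?thesis by (simp only: distrib_right add_divide_distrib mult.assoc times_divide_eq_right)
    qed
    finally show "(parabolic_mass F t x)
      \<le> ennreal ((2 ^ (?n + 1) * ?A + 4 * ?W) * M / sqrt t)" .
  qed
qed

text \<open>
  For \<open>s \<le> \<sigma>/2\<close> the time \<open>\<sigma> - s + 2\<epsilon>\<close> of the heat kernel lies between \<open>r/2\<close> and \<open>r\<close> for
  \<open>r = \<sigma> + 2\<epsilon>\<close>, so \<open>\<surd>r\<close> is the scale at which the Carleson bound is used. This is why \<open>r\<close> has to stay
  within the time interval.
\<close>
lemma nn_integral_source_heat_fourier: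
  obtains K where "K > 0" "\<And>T M (F :: 'n::finite spacetime \<Rightarrow> complex) \<sigma> \<epsilon> z. source_bound T M F \<Longrightarrow> 0 < \<sigma> \<Longrightarrow> 0 < \<epsilon> \<Longrightarrow> \<sigma> + 2 * \<epsilon> \<in> time_interval T \<Longrightarrow>
    (\<integral>\<^sup>+p. indicator {0<..\<sigma>} (fst p) * ennreal (norm (F p)) * ennreal (heat_fourier (\<sigma> - fst p + 2 * \<epsilon>) (z - snd p)) \<partial>lborel)
    \<le> ennreal (K * M)"
proof -
  let ?n = "CARD('n)"
  let ?A = "2 ^ (?n + 1) * real (?n + 1) :: real" and ?W = "(2 * pi) ^ ?n"
  obtain C where C: "C > 0" "\<And>r c (w :: real ^ 'n). r > 0 \<Longrightarrow> r / 2 \<le> c \<Longrightarrow> c \<le> r \<Longrightarrow> heat_fourier c w \<le> C * sqrt r * decay_weight (sqrt r) w"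
    using heat_fourier_le_decay_weight[where 'n='n] by metis
  show ?thesis
  proof (rule that[of "C * ?A + ?W"])
    show "C * ?A + ?W > 0" using C by (intro add_pos_pos) simp_all
    fix T M \<sigma> \<epsilon> and F :: "'n spacetime \<Rightarrow> complex" and z :: "real ^ 'n"
    assume source: "source_bound T M F" and \<sigma>: "0 < \<sigma>" and \<epsilon>: "0 < \<epsilon>" and r: "\<sigma> + 2 * \<epsilon> \<in> time_interval T"
    let ?r = "\<sigma> + 2 * \<epsilon>"
    have r0: "?r > 0" using \<sigma> \<epsilon> by simp
    have "(\<integral>\<^sup>+p. indicator {0<..\<sigma>} (fst p) * ennreal (norm (F p)) * ennreal (heat_fourier (\<sigma> - fst p + 2 * \<epsilon>) (z - snd p)) \<partial>lborel)
      \<le> ennreal (C * sqrt ?r * (?A * M / sqrt ?r) + M / (\<sigma> / 2) * (?W * (\<sigma> / 2)))"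
    proof (rule nn_integral_source_early_late[OF source r])
      show "{0<..\<sigma>} \<subseteq> time_interval T" using time_interval_downward[OF r] \<epsilon> by auto
      show "fst p < ?r \<and> heat_fourier (\<sigma> - fst p + 2 * \<epsilon>) (z - snd p) \<le> C * sqrt ?r * decay_weight (sqrt ?r) (z - snd p)"
        if "fst p \<in> {0<..\<sigma>}" "fst p \<le> \<sigma> / 2" for p
        using that \<epsilon> r0 by (intro conjI C(2)) auto
      let ?late = "\<lambda>p. indicator ({0<..\<sigma>} \<inter> {\<sigma> / 2..}) (fst p) * ennreal (heat_fourier (\<sigma> - fst p + 2 * \<epsilon>) (z - snd p))"
      have "(\<integral>\<^sup>+p. ?late p \<partial>lborel) = (\<integral>\<^sup>+s. \<integral>\<^sup>+y. ?late (s, y) \<partial>lborel \<partial>lborel)"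
        by (rule nn_integral_lborel_pair_fst) measurable
      also have "\<dots> \<le> (\<integral>\<^sup>+s. ennreal ?W * indicator {\<sigma> / 2..\<sigma>} s \<partial>lborel)"
      proof (rule nn_integral_mono)
        fix s
        show "(\<integral>\<^sup>+y. ?late (s, y) \<partial>lborel) \<le> ennreal ?W * indicator {\<sigma> / 2..\<sigma>} s"
          using nn_integral_heat_fourier[of "\<sigma> - s + 2 * \<epsilon>" z] \<epsilon> by (simp add: indicator_def)
      qed
      also have "\<dots> = ennreal (?W * (\<sigma> / 2))"
        using \<sigma> by (simp add: nn_integral_cmult_indicator ennreal_mult[symmetric])
      finally show "(\<integral>\<^sup>+p. ?late p \<partial>lborel) \<le> ennreal (?W * (\<sigma> / 2))" .
    qed (use \<sigma> C(1) r0 in auto)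
    also have "C * sqrt ?r * (?A * M / sqrt ?r) + M / (\<sigma> / 2) * (?W * (\<sigma> / 2)) = (C * ?A + ?W) * M"
      using r0 \<sigma> by (simp add: distrib_right)
    finally show "(\<integral>\<^sup>+p. indicator {0<..\<sigma>} (fst p) * ennreal (norm (F p)) * ennreal (heat_fourier (\<sigma> - fst p + 2 * \<epsilon>) (z - snd p)) \<partial>lborel)
      \<le> ennreal ((C * ?A + ?W) * M)" .
  qed
qed

text \<open>
  The radius is doubled so that points of the cylinder \<open>{0<..<R} \<times> ball a (sqrt R)\<close> have distance
  at least \<open>sqrt R\<close> from what is cut off.
\<close>
definition localize :: "real \<Rightarrow> real ^ 'n::finite \<Rightarrow> ('n spacetime \<Rightarrow> complex) \<Rightarrow> 'n spacetime \<Rightarrow> complex" where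
  "localize R a F p = indicator ({0<..<R} \<times> ball a (2 * sqrt R)) p *\<^sub>R F p"

lemma norm_localize_le: "norm (localize R a F p) \<le> norm (F p)"
  by (simp add: localize_def indicator_def)

lemma borel_measurable_localize [measurable]:
  assumes [measurable]: "F \<in> borel_measurable borel"
  shows "localize R a F \<in> borel_measurable borel"
proof -
  have [measurable]: "{0<..<R} \<times> ball a (2 * sqrt R) \<in> sets borel"
    by (intro borel_open open_Times) auto
  show ?thesis unfolding localize_def[abs_def] by measurable
qed

text \<open>
  The decay weight at scale \<open>\<surd>R\<close> is at least \<open>(3\<surd>R)^(-n-1)\<close> on the ball of radius \<open>2\<surd>R\<close>, so the
  averaging estimate also bounds the mass in the doubled cylinder.
\<close>
lemma nn_integral_localize_le:
  fixes F :: "'n::finite spacetime \<Rightarrow> complex"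
  assumes source: "source_bound T M F" and R: "R \<in> time_interval T"
  shows "(\<integral>\<^sup>+p. ennreal (norm (localize R a F p)) \<partial>lborel)
    \<le> ennreal (3 ^ (CARD('n) + 1) * (2 ^ (CARD('n) + 1) * real (CARD('n) + 1)) * M * sqrt R ^ CARD('n))"
proof -
  let ?n = "CARD('n)"
  let ?A = "2 ^ (?n + 1) * real (?n + 1) :: real"
  have R0: "R > 0" using R by (simp add: time_interval_def)
  have M: "M \<ge> 0" by (rule source_bound_nonneg[OF source])
  note [measurable] = borel_measurable_source[OF source]
  let ?w = "\<lambda>p. before R p * ennreal (norm (F p)) * ennreal (decay_weight (sqrt R) (a - snd p))"
  have "(\<integral>\<^sup>+p. ennreal (norm (localize R a F p)) \<partial>lborel) \<le> (\<integral>\<^sup>+p. ennreal ((3 * sqrt R) ^ (?n + 1)) * ?w p \<partial>lborel)"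
  proof (rule nn_integral_mono)
    fix p :: "'n spacetime"
    show "ennreal (norm (localize R a F p)) \<le> ennreal ((3 * sqrt R) ^ (?n + 1)) * ?w p"
    proof (cases "p \<in> {0<..<R} \<times> ball a (2 * sqrt R)")
      case True
      then have "norm (a - snd p) < 2 * sqrt R" by (auto simp: dist_norm)
      then have "1 \<le> ennreal ((3 * sqrt R) ^ (?n + 1)) * ennreal (decay_weight (sqrt R) (a - snd p))"
        using R0 by (intro one_le_decay_weight) auto
      then have "ennreal (norm (F p)) * 1 \<le> ennreal (norm (F p)) * (ennreal ((3 * sqrt R) ^ (?n + 1)) * ennreal (decay_weight (sqrt R) (a - snd p)))"
        by (rule mult_left_mono) simp
      moreover have "ennreal (norm (localize R a F p)) = ennreal (norm (F p))" "before R p = (1::ennreal)"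
        using True by (auto simp: localize_def)
      ultimately show ?thesis by (simp only: mult_1_right mult_1_left mult_ac)
    qed (simp add: localize_def)
  qed
  also have "\<dots> = ennreal ((3 * sqrt R) ^ (?n + 1)) * (\<integral>\<^sup>+p. ?w p \<partial>lborel)"
    by (rule nn_integral_cmult) measurable
  also have "\<dots> \<le> ennreal ((3 * sqrt R) ^ (?n + 1)) * ennreal (?A * M / sqrt R)"
    by (intro mult_left_mono nn_integral_source_decay_weight[OF source R]) auto
  also have "\<dots> = ennreal ((3 * sqrt R) ^ (?n + 1) * (?A * M / sqrt R))"
    using M R0 by (intro ennreal_mult[symmetric]) auto
  also have "(3 * sqrt R) ^ (?n + 1) * (?A * M / sqrt R) = 3 ^ (?n + 1) * ?A * M * sqrt R ^ ?n"
    using R0 by (simp add: power_mult_distrib)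
  finally show ?thesis .
qed

lemma integrable_localize:
  assumes "source_bound T M F" "R \<in> time_interval T"
  shows "integrable lborel (localize R a F)"
proof (rule integrableI_bounded)
  note [measurable] = borel_measurable_source[OF assms(1)]
  show "localize R a F \<in> borel_measurable lborel" by measurable
  show "(\<integral>\<^sup>+p. ennreal (norm (localize R a F p)) \<partial>lborel) < \<infinity>"
    using nn_integral_localize_le[OF assms, of a] by (rule le_less_trans) simp
qed

text \<open>
  In the symmetric bilinear form of \<open>|F|\<close> with the heat kernel it suffices to integrate over
  \<open>fst p \<le> fst q\<close>. The integral over \<open>p\<close> is then bounded uniformly in \<open>q\<close>, and the remaining integral
  over \<open>q\<close> is the mass of the localized source.
\<close>
lemma duhamel_localize_energy:
  obtains K where "K > 0" "\<And>T M (F :: 'n::finite spacetime \<Rightarrow> complex) R \<epsilon> a m. source_bound T M F \<Longrightarrow> R \<in> time_interval T \<Longrightarrow> 0 < \<epsilon> \<Longrightarrow> R + 2 * \<epsilon> \<in> time_interval T \<Longrightarrow>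
     m \<in> borel_measurable borel \<Longrightarrow> (\<And>\<xi>. norm (m \<xi>) \<le> norm \<xi>) \<Longrightarrow>
    (strip_energy R (duhamel (multiplier_kernel m) \<epsilon> (localize R a F)))
    \<le> ennreal (K * M\<^sup>2 * sqrt R ^ CARD('n))"
proof -
  let ?n = "CARD('n)"
  let ?A = "3 ^ (?n + 1) * (2 ^ (?n + 1) * real (?n + 1)) :: real"
  obtain K where K: "K > 0" "\<And>T M (F :: 'n spacetime \<Rightarrow> complex) \<sigma> \<epsilon> z. source_bound T M F \<Longrightarrow> 0 < \<sigma> \<Longrightarrow> 0 < \<epsilon> \<Longrightarrow> \<sigma> + 2 * \<epsilon> \<in> time_interval T \<Longrightarrow>
    (\<integral>\<^sup>+p. indicator {0<..\<sigma>} (fst p) * ennreal (norm (F p)) * ennreal (heat_fourier (\<sigma> - fst p + 2 * \<epsilon>) (z - snd p)) \<partial>lborel)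
    \<le> ennreal (K * M)" using nn_integral_source_heat_fourier by blast
  show ?thesis
  proof (rule that[of "K * ?A"])
    show "0 < K * ?A" using K(1) by simp
    fix T M R \<epsilon> and F :: "'n spacetime \<Rightarrow> complex" and a and m :: "real ^ 'n \<Rightarrow> complex"
    assume source: "source_bound T M F" and R: "R \<in> time_interval T" and \<epsilon>: "0 < \<epsilon>" and R\<epsilon>: "R + 2 * \<epsilon> \<in> time_interval T"
      and m: "m \<in> borel_measurable borel" "\<And>\<xi>. norm (m \<xi>) \<le> norm \<xi>"
    have R0: "R > 0" using R by (simp add: time_interval_def)
    have M: "M \<ge> 0" by (rule source_bound_nonneg[OF source])
    note [measurable] = borel_measurable_source[OF source]
    let ?F = "localize R a F"
    let ?\<Gamma> = "\<lambda>p q. heat_fourier (\<bar>fst p - fst q\<bar> + 2 * \<epsilon>) (snd p - snd q)"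
    let ?W = "\<lambda>p q. ennreal (norm (?F p) * norm (?F q) * (?\<Gamma> p q / 2))"
    have \<Gamma>0: "0 \<le> ?\<Gamma> p q" for p q :: "'n spacetime" using \<epsilon> by (intro heat_fourier_nonneg) auto
    have W_meas [measurable]: "(\<lambda>(p, q). ?W p q) \<in> borel_measurable (lborel \<Otimes>\<^sub>M lborel)" by measurable
    have "(strip_energy R (duhamel (multiplier_kernel m) \<epsilon> ?F))
      \<le> (\<integral>\<^sup>+p. \<integral>\<^sup>+q. ?W p q \<partial>lborel \<partial>lborel)"
    proof (rule duhamel_energy_le[OF integrable_localize[OF source R] \<epsilon> R0])
      show "0 < fst p \<and> fst p < R" if "?F p \<noteq> 0" for p using that by (auto simp: localize_def indicator_def split: if_splits)
    qed (use m in auto)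
    also have "\<dots> \<le> 2 * (\<integral>\<^sup>+q. \<integral>\<^sup>+p. indicator {..fst q} (fst p) * ?W p q \<partial>lborel \<partial>lborel)"
    proof (rule nn_integral_symmetric_le[OF W_meas])
      show "?W p q = ?W q p" for p q
        by (simp add: heat_fourier_minus[of _ "snd p" "snd q"] abs_minus_commute[of "fst p" "fst q"] mult_ac)
    qed
    also have "\<dots> \<le> 2 * (\<integral>\<^sup>+q. ennreal (norm (?F q) / 2) * ennreal (K * M) \<partial>lborel)"
    proof (intro mult_left_mono nn_integral_mono)
      fix q :: "'n spacetime"
      show "(\<integral>\<^sup>+p. indicator {..fst q} (fst p) * ?W p q \<partial>lborel) \<le> ennreal (norm (?F q) / 2) * ennreal (K * M)"
      proof (cases "?F q = 0")
        case False
        then have q: "0 < fst q" "fst q < R" by (auto simp: localize_def indicator_def split: if_splits)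
        have q\<epsilon>: "fst q + 2 * \<epsilon> \<in> time_interval T" using q \<epsilon> by (intro time_interval_downward[OF R\<epsilon>]) auto
        have "(\<integral>\<^sup>+p. indicator {..fst q} (fst p) * ?W p q \<partial>lborel)
          \<le> (\<integral>\<^sup>+p. ennreal (norm (?F q) / 2) * (indicator {0<..fst q} (fst p) * ennreal (norm (F p)) * ennreal (heat_fourier (fst q - fst p + 2 * \<epsilon>) (snd q - snd p))) \<partial>lborel)"
        proof (rule nn_integral_mono)
          fix p :: "'n spacetime"
          show "indicator {..fst q} (fst p) * ?W p q \<le> ennreal (norm (?F q) / 2) * (indicator {0<..fst q} (fst p) * ennreal (norm (F p)) * ennreal (heat_fourier (fst q - fst p + 2 * \<epsilon>) (snd q - snd p)))"
          proof (cases "0 < fst p \<and> fst p \<le> fst q")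
            case True
            then have abs: "\<bar>fst p - fst q\<bar> = fst q - fst p" by simp
            have "norm (?F p) * norm (?F q) * (?\<Gamma> p q / 2) \<le> norm (F p) * norm (?F q) * (?\<Gamma> p q / 2)"
              using \<Gamma>0[of p q] by (intro mult_right_mono norm_localize_le) auto
            also have "\<dots> = norm (?F q) / 2 * (norm (F p) * ?\<Gamma> p q)" by simp
            finally have "?W p q \<le> ennreal (norm (?F q) / 2 * (norm (F p) * ?\<Gamma> p q))" by (rule ennreal_leI)
            also have "\<dots> = ennreal (norm (?F q) / 2) * (ennreal (norm (F p)) * ennreal (?\<Gamma> p q))"
              using \<Gamma>0[of p q] by (simp only: ennreal_mult norm_ge_zero mult_nonneg_nonneg divide_nonneg_nonneg zero_le_numeral)
            finally show ?thesis using True unfolding abs by (simp add: heat_fourier_minus[of _ "snd p" "snd q"])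
          next
            case False
            then have "indicator {..fst q} (fst p) * ?W p q = 0"
              by (auto simp: localize_def indicator_def)
            then show ?thesis by (simp only: zero_le)
          qed
        qed
        also have "\<dots> = ennreal (norm (?F q) / 2) * (\<integral>\<^sup>+p. indicator {0<..fst q} (fst p) * ennreal (norm (F p)) * ennreal (heat_fourier (fst q - fst p + 2 * \<epsilon>) (snd q - snd p)) \<partial>lborel)"
          by (rule nn_integral_cmult) measurable
        also have "\<dots> \<le> ennreal (norm (?F q) / 2) * ennreal (K * M)"
          by (intro mult_left_mono K(2)[OF source q(1) \<epsilon> q\<epsilon>]) auto
        finally show ?thesis .
      qed simp
    qed auto
    also have "\<dots> = (\<integral>\<^sup>+q. ennreal (norm (?F q)) * ennreal (K * M) \<partial>lborel)"
    proof -
      have "2 * (\<integral>\<^sup>+q. ennreal (norm (?F q) / 2) * ennreal (K * M) \<partial>lborel) = (\<integral>\<^sup>+q. 2 * (ennreal (norm (?F q) / 2) * ennreal (K * M)) \<partial>lborel)"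
        by (rule nn_integral_cmult[symmetric]) measurable
      moreover have "2 * (ennreal (b / 2) * c) = ennreal b * c" if "b \<ge> 0" for b :: real and c
      proof -
        have "2 * ennreal (b / 2) = ennreal b"
          using that by (subst ennreal_numeral[symmetric], subst ennreal_mult[symmetric]) auto
        then show ?thesis by (simp only: mult.assoc[symmetric])
      qed
      ultimately show ?thesis by simp
    qed
    also have "\<dots> = (\<integral>\<^sup>+q. ennreal (norm (?F q)) \<partial>lborel) * ennreal (K * M)"
      by (rule nn_integral_multc) measurable
    also have "\<dots> \<le> ennreal (?A * M * sqrt R ^ ?n) * ennreal (K * M)"
      by (intro mult_right_mono nn_integral_localize_le[OF source R]) auto
    also have "\<dots> = ennreal (?A * M * sqrt R ^ ?n * (K * M))"
      using M K(1) R0 by (intro ennreal_mult[symmetric]) auto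
    also have "?A * M * sqrt R ^ ?n * (K * M) = K * ?A * M\<^sup>2 * sqrt R ^ ?n"
      by (simp only: power2_eq_square mult_ac)
    finally show "(strip_energy R (duhamel (multiplier_kernel m) \<epsilon> ?F))
      \<le> ennreal (K * ?A * M\<^sup>2 * sqrt R ^ ?n)" .
  qed
qed

section \<open>Bounds of the Duhamel integral\<close>

lemma multiplier_kernel_tendsto:
  fixes m :: "real ^ 'n::finite \<Rightarrow> complex"
  assumes [measurable]: "m \<in> borel_measurable borel" and m_le: "\<And>\<xi>. norm (m \<xi>) \<le> norm \<xi>"
    and \<tau>: "\<tau> > 0" and e: "\<And>i. e i \<ge> 0" "e \<longlonglongrightarrow> 0"
  shows "(\<lambda>i. multiplier_kernel m (\<tau> + e i) x) \<longlonglongrightarrow> multiplier_kernel m \<tau> x"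
  unfolding multiplier_kernel_def
proof (intro tendsto_mult tendsto_const integral_dominated_convergence)
  show "integrable lborel (\<lambda>\<xi> :: real ^ 'n. norm \<xi> ^ 1 * gauss \<tau> \<xi>)"
    by (rule integrable_norm_power_gauss[OF \<tau>])
  show "AE \<xi> in lborel. norm (m \<xi> * complex_of_real (gauss (\<tau> + e i) \<xi>) * cis (x \<bullet> \<xi>)) \<le> norm \<xi> ^ 1 * gauss \<tau> \<xi>" for i
  proof (rule AE_I2)
    fix \<xi> :: "real ^ 'n"
    have "\<tau> * (norm \<xi>)\<^sup>2 \<le> (\<tau> + e i) * (norm \<xi>)\<^sup>2" using e(1)[of i] by (intro mult_right_mono) auto
    then have "gauss (\<tau> + e i) \<xi> \<le> gauss \<tau> \<xi>"
      by (simp only: exp_le_cancel_iff mult_minus_left neg_le_iff_le)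
    then have "norm (m \<xi>) * gauss (\<tau> + e i) \<xi> \<le> norm \<xi> * gauss \<tau> \<xi>"
      by (intro mult_mono m_le) auto
    then show "norm (m \<xi> * complex_of_real (gauss (\<tau> + e i) \<xi>) * cis (x \<bullet> \<xi>)) \<le> norm \<xi> ^ 1 * gauss \<tau> \<xi>"
      by (simp add: norm_mult)
  qed
  show "AE \<xi> in lborel. (\<lambda>i. m \<xi> * complex_of_real (gauss (\<tau> + e i) \<xi>) * cis (x \<bullet> \<xi>))
      \<longlonglongrightarrow> m \<xi> * complex_of_real (gauss \<tau> \<xi>) * cis (x \<bullet> \<xi>)"
  proof (rule AE_I2)
    fix \<xi> :: "real ^ 'n"
    have "(\<lambda>i. gauss (\<tau> + e i) \<xi>) \<longlonglongrightarrow> gauss (\<tau> + 0) \<xi>"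
      using e(2) by (intro tendsto_intros)
    then show "(\<lambda>i. m \<xi> * complex_of_real (gauss (\<tau> + e i) \<xi>) * cis (x \<bullet> \<xi>))
      \<longlonglongrightarrow> m \<xi> * complex_of_real (gauss \<tau> \<xi>) * cis (x \<bullet> \<xi>)"
      by (intro tendsto_mult tendsto_const tendsto_of_real) simp
  qed
qed measurable

text \<open>
  The properties of the gradient of the Oseen kernel that the estimates use: the size of its symbol for the
  \<open>L\<^sup>2\<close> bound and the decay of the kernel for everything pointwise.
\<close>
locale parabolic_multiplier =
  fixes m :: "real ^ 'n::finite \<Rightarrow> complex" and C :: real
  assumes m_measurable [measurable]: "m \<in> borel_measurable borel"
    and m_le: "norm (m \<xi>) \<le> norm \<xi>"
    and C_pos: "C > 0"
    and kernel_le: "\<tau> > 0 \<Longrightarrow> norm (multiplier_kernel m \<tau> x) \<le> C * decay_weight (sqrt \<tau>) x"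
begin

abbreviation \<kappa> where "\<kappa> \<equiv> multiplier_kernel m"

definition integrand :: "real \<Rightarrow> ('n spacetime \<Rightarrow> complex) \<Rightarrow> real \<Rightarrow> real ^ 'n \<Rightarrow> 'n spacetime \<Rightarrow> complex" where
  "integrand \<epsilon> F t x p = before t p *\<^sub>R (\<kappa> (t - fst p + \<epsilon>) (x - snd p) * F p)"

lemma duhamel_eq_integrand: "duhamel \<kappa> \<epsilon> F t x = (LINT p|lborel. integrand \<epsilon> F t x p)"
  by (simp add: duhamel_def integrand_def)

lemma borel_measurable_integrand [measurable]:
  assumes [measurable]: "F \<in> borel_measurable borel"
  shows "integrand \<epsilon> F t x \<in> borel_measurable borel"
  unfolding integrand_def[abs_def] by measurable

lemma norm_integrand_le:
  assumes "\<epsilon> \<ge> 0"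
  shows "norm (integrand \<epsilon> F t x p) \<le> C * (before t p * norm (F p) * decay_weight (sqrt (t - fst p)) (x - snd p))"
proof (cases "fst p \<in> {0<..<t}")
  case True
  then have \<tau>: "t - fst p > 0" "t - fst p + \<epsilon> > 0" using assms by auto
  have "inverse (sqrt (t - fst p + \<epsilon>) + norm (x - snd p)) \<le> inverse (sqrt (t - fst p) + norm (x - snd p))"
    using \<tau> assms by (intro le_imp_inverse_le add_mono add_pos_nonneg real_sqrt_le_mono) auto
  then have d: "decay_weight (sqrt (t - fst p + \<epsilon>)) (x - snd p) \<le> decay_weight (sqrt (t - fst p)) (x - snd p)"
    unfolding decay_weight_def using \<tau> by (intro power_mono) auto
  have "norm (\<kappa> (t - fst p + \<epsilon>) (x - snd p)) \<le> C * decay_weight (sqrt (t - fst p)) (x - snd p)"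
    using C_pos by (intro order.trans[OF kernel_le[OF \<tau>(2)]] mult_left_mono d) auto
  then have "norm (\<kappa> (t - fst p + \<epsilon>) (x - snd p)) * norm (F p) \<le> C * decay_weight (sqrt (t - fst p)) (x - snd p) * norm (F p)"
    by (rule mult_right_mono) simp
  then show ?thesis using True by (simp add: integrand_def norm_mult mult_ac)
qed (simp add: integrand_def)

lemma ennreal_norm_integrand_le:
  assumes "\<epsilon> \<ge> 0"
  shows "ennreal (norm (integrand \<epsilon> F t x p)) \<le> ennreal C * (before t p * ennreal (norm (F p)) * ennreal (decay_weight (sqrt (t - fst p)) (x - snd p)))"
proof (cases "fst p \<in> {0<..<t}")
  case True
  then have "decay_weight (sqrt (t - fst p)) (x - snd p) \<ge> 0" by (simp add: decay_weight_nonneg)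
  then show ?thesis
    using ennreal_leI[OF norm_integrand_le[OF assms, of F t x p]] True C_pos by (simp add: ennreal_mult)
qed (simp add: integrand_def)

lemma nn_integral_integrand_le:
  obtains D where "D > 0" "\<And>T M F t x \<epsilon>. source_bound T M F \<Longrightarrow> t \<in> time_interval T \<Longrightarrow> \<epsilon> \<ge> 0 \<Longrightarrow>
     (\<integral>\<^sup>+p. ennreal (norm (integrand \<epsilon> F t x p)) \<partial>lborel) \<le> ennreal (D * M / sqrt t)"
proof -
  obtain B where B: "B > 0" "\<And>T M (F :: 'n spacetime \<Rightarrow> complex) t x. source_bound T M F \<Longrightarrow> t \<in> time_interval T \<Longrightarrow>
    (parabolic_mass F t x)
    \<le> ennreal (B * M / sqrt t)"
    using nn_integral_source_parabolic_weight by blast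
  show ?thesis
  proof (rule that[of "C * B"])
    show "C * B > 0" using C_pos B by simp
    fix T M and F :: "'n spacetime \<Rightarrow> complex" and t \<epsilon> :: real and x :: "real ^ 'n"
    assume source: "source_bound T M F" and t: "t \<in> time_interval T" and \<epsilon>: "\<epsilon> \<ge> 0"
    note [measurable] = borel_measurable_source[OF source]
    have "(\<integral>\<^sup>+p. ennreal (norm (integrand \<epsilon> F t x p)) \<partial>lborel)
      \<le> (\<integral>\<^sup>+p. ennreal C * (before t p * ennreal (norm (F p)) * ennreal (decay_weight (sqrt (t - fst p)) (x - snd p))) \<partial>lborel)"
      by (intro nn_integral_mono ennreal_norm_integrand_le \<epsilon>)
    also have "\<dots> = ennreal C * (parabolic_mass F t x)"
      by (rule nn_integral_cmult) measurable
    also have "\<dots> \<le> ennreal C * ennreal (B * M / sqrt t)"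
      by (intro mult_left_mono B(2)[OF source t]) auto
    also have "\<dots> = ennreal (C * B * M / sqrt t)"
      using C_pos B(1) source_bound_nonneg[OF source] t by (subst ennreal_mult[symmetric]) (auto simp: time_interval_def mult.assoc)
    finally show "(\<integral>\<^sup>+p. ennreal (norm (integrand \<epsilon> F t x p)) \<partial>lborel) \<le> ennreal (C * B * M / sqrt t)" .
  qed
qed

lemma integrable_integrand:
  assumes "source_bound T M F" "t \<in> time_interval T" "\<epsilon> \<ge> 0"
  shows "integrable lborel (integrand \<epsilon> F t x)"
proof (rule integrableI_bounded)
  note [measurable] = borel_measurable_source[OF assms(1)]
  show "integrand \<epsilon> F t x \<in> borel_measurable lborel" by measurable
  obtain D where "D > 0" and D: "\<And>T M F t x \<epsilon>. source_bound T M F \<Longrightarrow> t \<in> time_interval T \<Longrightarrow> \<epsilon> \<ge> 0 \<Longrightarrow>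
     (\<integral>\<^sup>+p. ennreal (norm (integrand \<epsilon> F t x p)) \<partial>lborel) \<le> ennreal (D * M / sqrt t)"
    using nn_integral_integrand_le by blast
  from D[OF assms] show "(\<integral>\<^sup>+p. ennreal (norm (integrand \<epsilon> F t x p)) \<partial>lborel) < \<infinity>" by (rule le_less_trans) simp
qed

lemma norm_duhamel_le:
  obtains D where "D > 0" "\<And>T M F t x. source_bound T M F \<Longrightarrow> t \<in> time_interval T \<Longrightarrow>
     norm (duhamel \<kappa> 0 F t x) \<le> D * M / sqrt t"
proof -
  obtain D where D: "D > 0" "\<And>T M F t x \<epsilon>. source_bound T M F \<Longrightarrow> t \<in> time_interval T \<Longrightarrow> \<epsilon> \<ge> 0 \<Longrightarrow>
     (\<integral>\<^sup>+p. ennreal (norm (integrand \<epsilon> F t x p)) \<partial>lborel) \<le> ennreal (D * M / sqrt t)"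
    using nn_integral_integrand_le by blast
  show ?thesis
  proof (rule that[OF D(1)])
    fix T M and F :: "'n spacetime \<Rightarrow> complex" and t :: real and x :: "real ^ 'n"
    assume source: "source_bound T M F" and t: "t \<in> time_interval T"
    have "ennreal (norm (duhamel \<kappa> 0 F t x)) \<le> ennreal (D * M / sqrt t)"
      unfolding duhamel_eq_integrand by (rule order.trans[OF norm_integral_le_nn_integral D(2)[OF source t]]) simp
    then show "norm (duhamel \<kappa> 0 F t x) \<le> D * M / sqrt t"
      using D(1) source_bound_nonneg[OF source] t by (subst (asm) ennreal_le_iff) (auto simp: time_interval_def)
  qed
qed

lemma duhamel_localize_tendsto:
  assumes source: "source_bound T M F" and t: "t \<in> time_interval T" and e: "\<And>i. e i \<ge> 0" "e \<longlonglongrightarrow> 0"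
  shows "(\<lambda>i. duhamel \<kappa> (e i) (localize R a F) t x) \<longlonglongrightarrow> duhamel \<kappa> 0 (localize R a F) t x"
  unfolding duhamel_eq_integrand
proof (rule integral_dominated_convergence)
  note [measurable] = borel_measurable_source[OF source]
  let ?w = "\<lambda>p. C * (before t p * norm (F p) * decay_weight (sqrt (t - fst p)) (x - snd p))"
  show "integrand (e i) (localize R a F) t x \<in> borel_measurable lborel" for i by measurable
  show "integrand 0 (localize R a F) t x \<in> borel_measurable lborel" by measurable
  have w0: "0 \<le> before t p * norm (F p) * decay_weight (sqrt (t - fst p)) (x - snd p)" for p
    by (auto simp: indicator_def decay_weight_nonneg)
  show "integrable lborel ?w"
  proof (rule integrableI_bounded)
    obtain B where "B > 0" and B: "\<And>T M (F :: 'n spacetime \<Rightarrow> complex) t x. source_bound T M F \<Longrightarrow> t \<in> time_interval T \<Longrightarrow>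
      (parabolic_mass F t x)
      \<le> ennreal (B * M / sqrt t)"
      using nn_integral_source_parabolic_weight by blast
    have "(\<integral>\<^sup>+p. ennreal (norm (?w p)) \<partial>lborel) = (\<integral>\<^sup>+p. ennreal C * (before t p * ennreal (norm (F p)) * ennreal (decay_weight (sqrt (t - fst p)) (x - snd p))) \<partial>lborel)"
    proof (rule nn_integral_cong)
      fix p :: "'n spacetime"
      show "ennreal (norm (?w p)) = ennreal C * (before t p * ennreal (norm (F p)) * ennreal (decay_weight (sqrt (t - fst p)) (x - snd p)))"
        using C_pos decay_weight_nonneg[of "sqrt (t - fst p)" "x - snd p"]
        by (cases "fst p \<in> {0<..<t}") (simp_all add: ennreal_mult[symmetric] abs_mult)
    qed
    also have "\<dots> = ennreal C * (parabolic_mass F t x)"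
      by (rule nn_integral_cmult) measurable
    also have "\<dots> < \<infinity>"
      using le_less_trans[OF B[OF source t, of x]] by (auto simp: ennreal_mult_less_top)
    finally show "(\<integral>\<^sup>+p. ennreal (norm (?w p)) \<partial>lborel) < \<infinity>" .
  qed measurable
  show "AE p in lborel. norm (integrand (e i) (localize R a F) t x p) \<le> ?w p" for i
  proof (rule AE_I2)
    fix p
    have "before t p * norm (localize R a F p) * decay_weight (sqrt (t - fst p)) (x - snd p)
       \<le> before t p * norm (F p) * decay_weight (sqrt (t - fst p)) (x - snd p)"
      by (auto simp: indicator_def intro!: mult_right_mono norm_localize_le decay_weight_nonneg)
    then show "norm (integrand (e i) (localize R a F) t x p) \<le> ?w p"
      using C_pos by (intro order.trans[OF norm_integrand_le[OF e(1)]] mult_left_mono) auto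
  qed
  show "AE p in lborel. (\<lambda>i. integrand (e i) (localize R a F) t x p) \<longlonglongrightarrow> integrand 0 (localize R a F) t x p"
  proof (rule AE_I2)
    fix p
    show "(\<lambda>i. integrand (e i) (localize R a F) t x p) \<longlonglongrightarrow> integrand 0 (localize R a F) t x p"
    proof (cases "fst p \<in> {0<..<t}")
      case True
      then have "(\<lambda>i. \<kappa> (t - fst p + e i) (x - snd p)) \<longlonglongrightarrow> \<kappa> (t - fst p) (x - snd p)"
        by (intro multiplier_kernel_tendsto m_le e) auto
      then show ?thesis unfolding integrand_def by (intro tendsto_intros) simp
    qed (simp add: integrand_def)
  qed
qed

lemma borel_measurable_duhamel [measurable (raw)]:
  assumes [measurable]: "F \<in> borel_measurable borel" and f: "f \<in> borel_measurable M" and g: "g \<in> borel_measurable M"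
  shows "(\<lambda>z. duhamel \<kappa> \<epsilon> F (f z) (g z)) \<in> borel_measurable M"
proof -
  have "(\<lambda>p. \<kappa> (fst p) (snd p)) \<in> borel_measurable borel" by measurable
  from measurable_compose[OF borel_measurable_Pair[OF f g] borel_measurable_duhamel_pair[OF this assms(1)]]
  show ?thesis by simp
qed

text \<open>
  The bound for \<open>\<epsilon> > 0\<close> is uniform in \<open>\<epsilon>\<close>, and the delayed integrals converge pointwise, so Fatou's lemma
  gives the same bound for \<open>\<epsilon> = 0\<close>.
\<close>
lemma duhamel_localize_energy_limit:
  obtains K where "K > 0" "\<And>T M F R a. source_bound T M F \<Longrightarrow> R \<in> time_interval T \<Longrightarrow>
    (strip_energy R (duhamel \<kappa> 0 (localize R a F)))
    \<le> ennreal (K * M\<^sup>2 * sqrt R ^ CARD('n))"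
proof -
  obtain K where K: "K > 0" "\<And>T M (F :: 'n spacetime \<Rightarrow> complex) R \<epsilon> a m. source_bound T M F \<Longrightarrow> R \<in> time_interval T \<Longrightarrow> 0 < \<epsilon> \<Longrightarrow> R + 2 * \<epsilon> \<in> time_interval T \<Longrightarrow>
     m \<in> borel_measurable borel \<Longrightarrow> (\<And>\<xi>. norm (m \<xi>) \<le> norm \<xi>) \<Longrightarrow>
    (strip_energy R (duhamel (multiplier_kernel m) \<epsilon> (localize R a F)))
    \<le> ennreal (K * M\<^sup>2 * sqrt R ^ CARD('n))"
    using duhamel_localize_energy by blast
  show ?thesis
  proof (rule that[OF K(1)])
    fix T M R and F :: "'n spacetime \<Rightarrow> complex" and a :: "real ^ 'n"
    assume source: "source_bound T M F" and R: "R \<in> time_interval T"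
    note [measurable] = borel_measurable_source[OF source]
    have R0: "R > 0" "ereal R < T" using R by (auto simp: time_interval_def)
    obtain T' where T': "ereal R < T'" "T' < T" using dense[OF R0(2)] by blast
    then obtain r where r: "T' = ereal r" by (cases T') auto
    (* R lies strictly below T, which leaves room for delays with R + 2 * \<epsilon> i \<le> r < T. *)
    define \<epsilon> where "\<epsilon> i = (r - R) / 2 * inverse (real (Suc i))" for i
    have rR: "r - R > 0" using T' r by simp
    have \<epsilon>0: "\<epsilon> i > 0" for i using rR by (simp add: \<epsilon>_def)
    have "\<epsilon> \<longlonglongrightarrow> (r - R) / 2 * 0"
      unfolding \<epsilon>_def by (intro tendsto_intros LIMSEQ_inverse_real_of_nat)
    then have \<epsilon>_lim: "\<epsilon> \<longlonglongrightarrow> 0" by simp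
    have R\<epsilon>: "R + 2 * \<epsilon> i \<in> time_interval T" for i
    proof (rule time_interval_downward)
      show "r \<in> time_interval T" using T' r R0 by (auto simp: time_interval_def)
      have "(r - R) * inverse (real (Suc i)) \<le> (r - R) * 1"
        using rR by (intro mult_left_mono) (auto simp: field_simps)
      then show "R + 2 * \<epsilon> i \<le> r" by (simp add: \<epsilon>_def)
      show "0 < R + 2 * \<epsilon> i" using R0 \<epsilon>0[of i] by simp
    qed
    define f where "f e p = (before R p * ennreal ((norm (duhamel \<kappa> e (localize R a F) (fst p) (snd p)))\<^sup>2))" for e and p :: "'n spacetime"
    have f_meas [measurable]: "f e \<in> borel_measurable borel" for e unfolding f_def by measurable
    have f_int: "(\<integral>\<^sup>+p. f e p \<partial>lborel) = (strip_energy R (duhamel \<kappa> e (localize R a F)))" for e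
    proof -
      have "(\<integral>\<^sup>+p. f e p \<partial>lborel) = (\<integral>\<^sup>+t. \<integral>\<^sup>+x. indicator {0<..<R} t * ennreal ((norm (duhamel \<kappa> e (localize R a F) t x))\<^sup>2) \<partial>lborel \<partial>lborel)"
        by (subst nn_integral_lborel_pair_fst[OF f_meas]) (simp add: f_def)
      also have "\<dots> = (strip_energy R (duhamel \<kappa> e (localize R a F)))"
        by (intro nn_integral_cong nn_integral_cmult) measurable
      finally show ?thesis .
    qed
    have "(\<integral>\<^sup>+p. f 0 p \<partial>lborel) = (\<integral>\<^sup>+p. liminf (\<lambda>i. f (\<epsilon> i) p) \<partial>lborel)"
    proof (rule nn_integral_cong)
      fix p :: "'n spacetime"
      have "(\<lambda>i. f (\<epsilon> i) p) \<longlonglongrightarrow> f 0 p"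
      proof (cases "fst p \<in> {0<..<R}")
        case True
        then have "fst p \<in> time_interval T" by (intro time_interval_downward[OF R]) auto
        then have "(\<lambda>i. duhamel \<kappa> (\<epsilon> i) (localize R a F) (fst p) (snd p)) \<longlonglongrightarrow> duhamel \<kappa> 0 (localize R a F) (fst p) (snd p)"
          using \<epsilon>0 \<epsilon>_lim by (intro duhamel_localize_tendsto[OF source]) (auto intro: less_imp_le)
        then show ?thesis
          using True unfolding f_def by (simp only: indicator_simps(1) mult_1_left) (intro tendsto_ennrealI tendsto_power tendsto_norm)
      qed (simp add: f_def)
      then show "f 0 p = liminf (\<lambda>i. f (\<epsilon> i) p)" by (simp add: lim_imp_Liminf)
    qed
    also have "\<dots> \<le> liminf (\<lambda>i. \<integral>\<^sup>+p. f (\<epsilon> i) p \<partial>lborel)"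
      by (rule nn_integral_liminf) measurable
    also have "\<dots> \<le> ennreal (K * M\<^sup>2 * sqrt R ^ CARD('n))"
    proof -
      have "(\<integral>\<^sup>+p. f (\<epsilon> i) p \<partial>lborel) \<le> ennreal (K * M\<^sup>2 * sqrt R ^ CARD('n))" for i
        unfolding f_int by (rule K(2)[OF source R \<epsilon>0 R\<epsilon> m_measurable m_le])
      then show ?thesis
        using Liminf_le[OF sequentially_bot, of "\<lambda>i. \<integral>\<^sup>+p. f (\<epsilon> i) p \<partial>lborel"] by simp
    qed
    finally show "(strip_energy R (duhamel \<kappa> 0 (localize R a F)))
      \<le> ennreal (K * M\<^sup>2 * sqrt R ^ CARD('n))" unfolding f_int .
  qed
qed

text \<open>
  Since \<open>x\<close> has distance at least \<open>\<surd>R\<close> from the cut-off source, the kernel is there comparable with the decay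
  weight at scale \<open>\<surd>R\<close> for every \<open>t < R\<close>, however small \<open>t - s\<close> is.
\<close>
lemma norm_duhamel_tail_le:
  assumes source: "source_bound T M F" and R: "R \<in> time_interval T" and t: "0 < t" "t < R" and x: "x \<in> ball a (sqrt R)"
  shows "norm (duhamel \<kappa> 0 (\<lambda>p. F p - localize R a F p) t x)
    \<le> C * 2 ^ (CARD('n) + 1) * (2 ^ (CARD('n) + 1) * real (CARD('n) + 1)) * M / sqrt R"
proof -
  let ?n = "CARD('n)"
  let ?A = "2 ^ (?n + 1) * real (?n + 1) :: real"
  let ?G = "\<lambda>p. F p - localize R a F p"
  have R0: "R > 0" using R by (simp add: time_interval_def)
  have M: "M \<ge> 0" by (rule source_bound_nonneg[OF source])
  note [measurable] = borel_measurable_source[OF source]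
  have "ennreal (norm (duhamel \<kappa> 0 ?G t x)) \<le> (\<integral>\<^sup>+p. ennreal (norm (integrand 0 ?G t x p)) \<partial>lborel)"
    unfolding duhamel_eq_integrand by (rule norm_integral_le_nn_integral)
  also have "\<dots> \<le> (\<integral>\<^sup>+p. ennreal (C * 2 ^ (?n + 1)) * (before R p * ennreal (norm (F p)) * ennreal (decay_weight (sqrt R) (x - snd p))) \<partial>lborel)"
  proof (rule nn_integral_mono)
    fix p :: "'n spacetime"
    show "ennreal (norm (integrand 0 ?G t x p)) \<le> ennreal (C * 2 ^ (?n + 1)) * (before R p * ennreal (norm (F p)) * ennreal (decay_weight (sqrt R) (x - snd p)))"
    proof (cases "fst p \<in> {0<..<t} \<and> ?G p \<noteq> 0")
      case True
      then have p: "0 < fst p" "fst p < t" by auto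
      with True t have "snd p \<notin> ball a (2 * sqrt R)" and G: "?G p = F p" by (auto simp: localize_def indicator_def mem_Times_iff split: if_splits)
      then have "2 * sqrt R \<le> norm (a - snd p)" by (simp add: dist_norm)
      also have "\<dots> \<le> norm (a - x) + norm (x - snd p)" using norm_triangle_ineq[of "a - x" "x - snd p"] by simp
      finally have "sqrt R \<le> norm (x - snd p)" using x by (simp add: dist_norm)
      then have "sqrt R + norm (x - snd p) \<le> 2 * (sqrt (t - fst p) + norm (x - snd p))"
        using p real_sqrt_ge_zero[of "t - fst p"] by (simp only: distrib_left) linarith
      then have d: "decay_weight (sqrt (t - fst p)) (x - snd p) \<le> 2 ^ (?n + 1) * decay_weight (sqrt R) (x - snd p)"
        using R0 by (intro decay_weight_le) auto
      have "norm (integrand 0 ?G t x p) \<le> C * (before t p * norm (?G p) * decay_weight (sqrt (t - fst p)) (x - snd p))"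
        by (rule norm_integrand_le) simp
      also have "\<dots> = C * (norm (F p) * decay_weight (sqrt (t - fst p)) (x - snd p))" using p G by simp
      also have "\<dots> \<le> C * (norm (F p) * (2 ^ (?n + 1) * decay_weight (sqrt R) (x - snd p)))"
        using C_pos by (intro mult_left_mono d) auto
      also have "\<dots> = C * 2 ^ (?n + 1) * (norm (F p) * decay_weight (sqrt R) (x - snd p))" by simp
      finally have "ennreal (norm (integrand 0 ?G t x p)) \<le> ennreal (C * 2 ^ (?n + 1) * (norm (F p) * decay_weight (sqrt R) (x - snd p)))"
        by (rule ennreal_leI)
      also have "\<dots> = ennreal (C * 2 ^ (?n + 1)) * (ennreal (norm (F p)) * ennreal (decay_weight (sqrt R) (x - snd p)))"
        using C_pos R0 decay_weight_nonneg[of "sqrt R" "x - snd p"] by (simp only: ennreal_mult norm_ge_zero mult_nonneg_nonneg less_imp_le zero_le_power zero_le_numeral real_sqrt_ge_zero)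
      finally show ?thesis using p t by simp
    next
      case False
      then have "integrand 0 ?G t x p = 0" by (auto simp: integrand_def)
      then show ?thesis by simp
    qed
  qed
  also have "\<dots> = ennreal (C * 2 ^ (?n + 1)) * (\<integral>\<^sup>+p. before R p * ennreal (norm (F p)) * ennreal (decay_weight (sqrt R) (x - snd p)) \<partial>lborel)"
    by (rule nn_integral_cmult) measurable
  also have "\<dots> \<le> ennreal (C * 2 ^ (?n + 1)) * ennreal (?A * M / sqrt R)"
    by (intro mult_left_mono nn_integral_source_decay_weight[OF source R]) auto
  also have "\<dots> = ennreal (C * 2 ^ (?n + 1) * (?A * M / sqrt R))"
    using C_pos M R0 by (intro ennreal_mult[symmetric]) auto
  finally have "norm (duhamel \<kappa> 0 ?G t x) \<le> C * 2 ^ (?n + 1) * (?A * M / sqrt R)"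
    using C_pos M R0 by (subst (asm) ennreal_le_iff) auto
  then show ?thesis by (simp only: mult.assoc times_divide_eq_right)
qed

text \<open>
  The square of the bound \<open>C M / \<surd>R\<close> for the far part, integrated over a cylinder of volume
  proportional to \<open>R R^(n/2)\<close>, has the same size \<open>M\<^sup>2 R^(n/2)\<close> as the bound for the near part.
\<close>
lemma duhamel_cylinder_energy:
  obtains K where "K > 0" "\<And>T M F R a. source_bound T M F \<Longrightarrow> R \<in> time_interval T \<Longrightarrow>
    (cylinder_energy R a (duhamel \<kappa> 0 F))
    \<le> ennreal (K * M\<^sup>2 * sqrt R ^ CARD('n))"
proof -
  let ?n = "CARD('n)" and ?V = "unit_ball_vol (real CARD('n))"
  have V: "?V > 0" by simp
  define Q where "Q = C * 2 ^ (?n + 1) * (2 ^ (?n + 1) * real (?n + 1))"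
  have Q: "Q > 0" using C_pos by (simp add: Q_def)
  obtain K where K: "K > 0" "\<And>T M F R a. source_bound T M F \<Longrightarrow> R \<in> time_interval T \<Longrightarrow>
    (strip_energy R (duhamel \<kappa> 0 (localize R a F)))
    \<le> ennreal (K * M\<^sup>2 * sqrt R ^ CARD('n))"
    using duhamel_localize_energy_limit by blast
  show ?thesis
  proof (rule that[of "2 * K + 2 * Q\<^sup>2 * ?V"])
    show "0 < 2 * K + 2 * Q\<^sup>2 * ?V" using K(1) Q V by (intro add_pos_pos) auto
    fix T M R and F :: "'n spacetime \<Rightarrow> complex" and a :: "real ^ 'n"
    assume source: "source_bound T M F" and R: "R \<in> time_interval T"
    note [measurable] = borel_measurable_source[OF source]
    have R0: "R > 0" using R by (simp add: time_interval_def)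
    have M: "M \<ge> 0" by (rule source_bound_nonneg[OF source])
    let ?u = "\<lambda>t x. ennreal ((norm (duhamel \<kappa> 0 (localize R a F) t x))\<^sup>2)"
    let ?q = "ennreal (2 * (Q * M / sqrt R)\<^sup>2)"
    have [measurable]: "ball a (sqrt R) \<in> sets borel" by simp
    have "(cylinder_energy R a (duhamel \<kappa> 0 F))
      \<le> (\<integral>\<^sup>+t. 2 * (indicator {0<..<R} t * (\<integral>\<^sup>+x. ?u t x \<partial>lborel)) + ?q * ennreal (?V * sqrt R ^ ?n) * indicator {0<..<R} t \<partial>lborel)"
    proof (rule nn_integral_mono)
      fix t :: real
      show "indicator {0<..<R} t * (\<integral>\<^sup>+x. indicator (ball a (sqrt R)) x * ennreal ((norm (duhamel \<kappa> 0 F t x))\<^sup>2) \<partial>lborel)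
        \<le> 2 * (indicator {0<..<R} t * (\<integral>\<^sup>+x. ?u t x \<partial>lborel)) + ?q * ennreal (?V * sqrt R ^ ?n) * indicator {0<..<R} t"
      proof (cases "t \<in> {0<..<R}")
        case True
        then have t: "t \<in> time_interval T" by (intro time_interval_downward[OF R]) auto
        have "(\<integral>\<^sup>+x. indicator (ball a (sqrt R)) x * ennreal ((norm (duhamel \<kappa> 0 F t x))\<^sup>2) \<partial>lborel)
          \<le> (\<integral>\<^sup>+x. 2 * ?u t x + ?q * indicator (ball a (sqrt R)) x \<partial>lborel)"
        proof (rule nn_integral_mono)
          fix x :: "real ^ 'n"
          show "indicator (ball a (sqrt R)) x * ennreal ((norm (duhamel \<kappa> 0 F t x))\<^sup>2) \<le> 2 * ?u t x + ?q * indicator (ball a (sqrt R)) x"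
          proof (cases "x \<in> ball a (sqrt R)")
            case x: True
            let ?b = "norm (duhamel \<kappa> 0 (localize R a F) t x)" and ?c = "norm (duhamel \<kappa> 0 (\<lambda>p. F p - localize R a F p) t x)"
            have int1: "integrable lborel (integrand 0 F t x)" by (rule integrable_integrand[OF source t]) simp
            have int2: "integrable lborel (integrand 0 (localize R a F) t x)"
              by (rule Bochner_Integration.integrable_bound[OF int1]) (measurable, auto simp: integrand_def norm_mult indicator_def intro!: AE_I2 mult_left_mono norm_localize_le)
            have "integrand 0 F t x = (\<lambda>p. integrand 0 (localize R a F) t x p + integrand 0 (\<lambda>p. F p - localize R a F p) t x p)"
              by (auto simp: integrand_def algebra_simps)
            moreover have "integrable lborel (integrand 0 (\<lambda>p. F p - localize R a F p) t x)"
            proof -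
              have "integrand 0 (\<lambda>p. F p - localize R a F p) t x = (\<lambda>p. integrand 0 F t x p - integrand 0 (localize R a F) t x p)"
                by (auto simp: integrand_def algebra_simps)
              then show ?thesis using int1 int2 by simp
            qed
            ultimately have "duhamel \<kappa> 0 F t x = duhamel \<kappa> 0 (localize R a F) t x + duhamel \<kappa> 0 (\<lambda>p. F p - localize R a F p) t x"
              unfolding duhamel_eq_integrand using int2 by simp
            then have "norm (duhamel \<kappa> 0 F t x) \<le> ?b + ?c" by (simp add: norm_triangle_ineq)
            then have "(norm (duhamel \<kappa> 0 F t x))\<^sup>2 \<le> (?b + ?c)\<^sup>2" by (rule power_mono) simp
            also have "\<dots> \<le> 2 * ?b\<^sup>2 + 2 * ?c\<^sup>2" using sum_squares_bound[of ?b ?c] by (simp add: power2_sum)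
            also have "?c\<^sup>2 \<le> (Q * M / sqrt R)\<^sup>2"
              using norm_duhamel_tail_le[OF source R _ _ x, of t] True by (intro power_mono) (auto simp: Q_def)
            finally have "(norm (duhamel \<kappa> 0 F t x))\<^sup>2 \<le> 2 * ?b\<^sup>2 + 2 * (Q * M / sqrt R)\<^sup>2" by simp
            then have "ennreal ((norm (duhamel \<kappa> 0 F t x))\<^sup>2) \<le> ennreal (2 * ?b\<^sup>2 + 2 * (Q * M / sqrt R)\<^sup>2)" by (rule ennreal_leI)
            also have "\<dots> = 2 * ?u t x + ?q"
            proof -
              have "ennreal (2 * ?b\<^sup>2) = 2 * ?u t x" by (subst ennreal_mult) auto
              then show ?thesis by (subst ennreal_plus) auto
            qed
            finally show ?thesis using x by simp
          qed simp
        qed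
        also have "\<dots> = (\<integral>\<^sup>+x. 2 * ?u t x \<partial>lborel) + (\<integral>\<^sup>+x. ?q * indicator (ball a (sqrt R)) x \<partial>lborel)"
          by (rule nn_integral_add) measurable
        also have "(\<integral>\<^sup>+x. 2 * ?u t x \<partial>lborel) = 2 * (\<integral>\<^sup>+x. ?u t x \<partial>lborel)"
          by (rule nn_integral_cmult) measurable
        also have "(\<integral>\<^sup>+x. ?q * indicator (ball a (sqrt R)) x \<partial>lborel) = ?q * ennreal (?V * sqrt R ^ ?n)"
          using R0 by (subst nn_integral_cmult_indicator) (auto simp: emeasure_ball)
        finally show ?thesis using True by simp
      qed simp
    qed
    also have "\<dots> = (\<integral>\<^sup>+t. 2 * (indicator {0<..<R} t * (\<integral>\<^sup>+x. ?u t x \<partial>lborel)) \<partial>lborel) + (\<integral>\<^sup>+t. ?q * ennreal (?V * sqrt R ^ ?n) * indicator {0<..<R} t \<partial>lborel)"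
      by (rule nn_integral_add) measurable
    also have "(\<integral>\<^sup>+t. 2 * (indicator {0<..<R} t * (\<integral>\<^sup>+x. ?u t x \<partial>lborel)) \<partial>lborel) = 2 * (\<integral>\<^sup>+t. indicator {0<..<R} t * (\<integral>\<^sup>+x. ?u t x \<partial>lborel) \<partial>lborel)"
      by (rule nn_integral_cmult) measurable
    also have "(\<integral>\<^sup>+t. ?q * ennreal (?V * sqrt R ^ ?n) * indicator {0<..<R} t \<partial>lborel) = ?q * ennreal (?V * sqrt R ^ ?n) * ennreal R"
      using R0 by (subst nn_integral_cmult_indicator) auto
    also have "2 * (\<integral>\<^sup>+t. indicator {0<..<R} t * (\<integral>\<^sup>+x. ?u t x \<partial>lborel) \<partial>lborel) + ?q * ennreal (?V * sqrt R ^ ?n) * ennreal R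
      \<le> 2 * ennreal (K * M\<^sup>2 * sqrt R ^ ?n) + ?q * ennreal (?V * sqrt R ^ ?n) * ennreal R"
      by (intro add_mono mult_left_mono K(2)[OF source R]) auto
    also have "\<dots> = ennreal ((2 * K + 2 * Q\<^sup>2 * ?V) * M\<^sup>2 * sqrt R ^ ?n)"
    proof -
      have "2 * ennreal (K * M\<^sup>2 * sqrt R ^ ?n) = ennreal (2 * (K * M\<^sup>2 * sqrt R ^ ?n))"
        using K(1) R0 by (subst ennreal_mult) auto
      moreover have "?q * ennreal (?V * sqrt R ^ ?n) * ennreal R = ennreal (2 * (Q * M / sqrt R)\<^sup>2 * (?V * sqrt R ^ ?n) * R)"
        using V R0 by (simp only: ennreal_mult mult_nonneg_nonneg less_imp_le zero_le_power2 zero_le_power real_sqrt_ge_zero zero_le_numeral)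
      moreover have "2 * (Q * M / sqrt R)\<^sup>2 * (?V * sqrt R ^ ?n) * R = 2 * Q\<^sup>2 * ?V * M\<^sup>2 * sqrt R ^ ?n"
        using R0 by (simp add: power_divide power_mult_distrib)
      moreover have "(2 * K + 2 * Q\<^sup>2 * ?V) * M\<^sup>2 * sqrt R ^ ?n = 2 * (K * M\<^sup>2 * sqrt R ^ ?n) + 2 * Q\<^sup>2 * ?V * M\<^sup>2 * sqrt R ^ ?n"
        by (simp add: algebra_simps)
      moreover have "0 \<le> 2 * (K * M\<^sup>2 * sqrt R ^ ?n)" "0 \<le> 2 * Q\<^sup>2 * ?V * M\<^sup>2 * sqrt R ^ ?n" using K(1) V R0 by auto
      ultimately show ?thesis by (simp only: ennreal_plus)
    qed
    finally show "(cylinder_energy R a (duhamel \<kappa> 0 F))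
      \<le> ennreal ((2 * K + 2 * Q\<^sup>2 * ?V) * M\<^sup>2 * sqrt R ^ ?n)" by simp
  qed
qed

end

section \<open>Borel representatives and the path norm\<close>

lemma open_time_interval: "open (time_interval T)"
proof (cases T)
  case (real r)
  then have "time_interval T = {0<..<r}" by (auto simp: time_interval_def)
  then show ?thesis by simp
next
  case PInf
  then have "time_interval T = {0<..}" by (auto simp: time_interval_def)
  then show ?thesis by simp
next
  case MInf
  then have "time_interval T = {}" by (auto simp: time_interval_def)
  then show ?thesis by simp
qed

lemma sets_time_interval [measurable]: "time_interval T \<in> sets borel"
  using open_time_interval by (rule borel_open)

lemma AE_lborel_slices:
  assumes "AE p in (lborel :: ('a::euclidean_space \<times> 'b::euclidean_space) measure). Q p"
  shows "AE s in lborel. AE y in lborel. Q (s, y)"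
  by (rule lborel_pair.AE_pair) (use assms in \<open>unfold lborel_prod\<close>)

lemma AE_lborel_from_slices:
  assumes "{p. Q p} \<in> sets (borel :: ('a::euclidean_space \<times> 'b::euclidean_space) measure)"
    and "AE s in lborel. AE y in lborel. Q (s, y)"
  shows "AE p in (lborel :: ('a \<times> 'b) measure). Q p"
proof -
  have "{x \<in> space (lborel \<Otimes>\<^sub>M lborel). Q x} \<in> sets (lborel \<Otimes>\<^sub>M lborel)"
    using assms(1) unfolding lborel_prod by simp
  from lborel_pair.AE_pair_measure[OF this assms(2)] show ?thesis unfolding lborel_prod .
qed

text \<open>
  The essential supremum exceeds \<open>c\<close> iff the set where \<open>h (t, \<cdot>)\<close> exceeds \<open>c\<close> has positive measure, and this
  measure is a measurable function of \<open>t\<close> by Tonelli's theorem.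
\<close>
lemma esssup_slice_measurable:
  fixes h :: "real \<times> 'a::euclidean_space \<Rightarrow> ennreal"
  assumes h [measurable]: "h \<in> borel_measurable borel"
  shows "(\<lambda>t. esssup lebesgue (\<lambda>x. h (t, x))) \<in> borel_measurable borel"
proof (rule borel_measurableI_greater)
  fix c
  have hp [measurable]: "h \<in> borel_measurable (borel \<Otimes>\<^sub>M borel)" unfolding borel_prod by (rule h)
  have slice: "(\<lambda>x. h (t, x)) \<in> borel_measurable lborel" for t by measurable
  then have slice': "(\<lambda>x. h (t, x)) \<in> borel_measurable lebesgue" for t by (rule measurable_completion)
  have set: "{x. c < h (t, x)} \<in> sets lborel" for t
  proof -
    have "{x \<in> space lborel. c < h (t, x)} \<in> sets lborel" by measurable
    then show ?thesis by simp
  qed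
  have "c < esssup lebesgue (\<lambda>x. h (t, x)) \<longleftrightarrow> 0 < emeasure lborel {x. c < h (t, x)}" for t
  proof
    assume "c < esssup lebesgue (\<lambda>x. h (t, x))"
    from esssup_pos_measure[OF slice' this] show "0 < emeasure lborel {x. c < h (t, x)}"
      using set by simp
  next
    assume pos: "0 < emeasure lborel {x. c < h (t, x)}"
    show "c < esssup lebesgue (\<lambda>x. h (t, x))"
    proof (rule ccontr)
      assume "\<not> c < esssup lebesgue (\<lambda>x. h (t, x))"
      then have "AE x in lebesgue. h (t, x) \<le> c"
        using esssup_AE[of "\<lambda>x. h (t, x)" lebesgue] by (auto elim!: eventually_mono)
      then have "AE x in lborel. x \<notin> {x. c < h (t, x)}"
        by (auto simp: AE_completion_iff not_less)
      then have "emeasure lborel {x. c < h (t, x)} = 0"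
        using set by (simp add: AE_iff_measurable[OF _ refl])
      with pos show False by simp
    qed
  qed
  moreover have "emeasure lborel {x. c < h (t, x)} = (\<integral>\<^sup>+x. indicator {p. c < h p} (t, x) \<partial>lborel)" for t
  proof -
    have "(\<integral>\<^sup>+x. indicator {p. c < h p} (t, x) \<partial>lborel) = (\<integral>\<^sup>+x. indicator {x. c < h (t, x)} x \<partial>lborel)"
      by (intro nn_integral_cong) (simp add: indicator_def)
    then show ?thesis using set[of t] by simp
  qed
  moreover have [measurable]: "(\<lambda>t. \<integral>\<^sup>+x. indicator {p. c < h p} (t, x) \<partial>lborel :: ennreal) \<in> borel_measurable borel"
    unfolding indicator_def mem_Collect_eq by measurable
  have "{t \<in> space borel. 0 < (\<integral>\<^sup>+x. indicator {p. c < h p} (t, x) \<partial>lborel :: ennreal)} \<in> sets borel"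
    by measurable
  ultimately show "{t \<in> space borel. c < esssup lebesgue (\<lambda>x. h (t, x))} \<in> sets borel"
    by simp
qed

lemma ennreal_sqrt_le:
  assumes "a \<le> ennreal (b\<^sup>2)" "b \<ge> 0"
  shows "ennreal_sqrt a \<le> ennreal b"
proof -
  have "a \<noteq> top" using assms(1) by (auto simp: top_unique)
  then obtain r where r: "a = ennreal r" "r \<ge> 0" by (cases a) auto
  then have "r \<le> b\<^sup>2" using assms by simp
  then have "sqrt r \<le> b" using assms(2) by (simp add: real_le_lsqrt)
  then show ?thesis using r by (simp add: ennreal_sqrt_def ennreal_leI)
qed

lemma le_of_ennreal_sqrt_le:
  assumes "ennreal_sqrt a \<le> ennreal b" "b \<ge> 0"
  shows "a \<le> ennreal (b\<^sup>2)"
proof -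
  have "a \<noteq> top" using assms(1) by (auto simp: ennreal_sqrt_def top_unique)
  then obtain r where r: "a = ennreal r" "r \<ge> 0" by (cases a) auto
  then have "sqrt r \<le> b" using assms by (simp add: ennreal_sqrt_def)
  then have "r \<le> b\<^sup>2" using r by (simp add: sqrt_le_D)
  then show ?thesis using r by (simp add: ennreal_leI)
qed

lemma powr_minus_half_nat: "t > 0 \<Longrightarrow> t powr (- real n / 2) = inverse (sqrt t ^ n)"
  by (simp add: powr_minus powr_half_sqrt[symmetric] powr_powr powr_realpow[symmetric])

text \<open>
  The two parts of the path norm for a Borel function, with the iterated essential supremum replaced
  by an almost everywhere bound in space-time and the integral over a cylinder by one in space-time.
\<close>
definition path_bounds :: "ereal \<Rightarrow> real \<Rightarrow> real \<Rightarrow> ('n::finite spacetime \<Rightarrow> 'b::real_normed_vector) \<Rightarrow> bool" where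
  "path_bounds T a b g \<longleftrightarrow> g \<in> borel_measurable borel \<and> 0 \<le> a \<and> 0 \<le> b
     \<and> (AE p in lborel. fst p \<in> time_interval T \<longrightarrow> norm (g p) * sqrt (fst p) \<le> a)
     \<and> (\<forall>t\<in>time_interval T. \<forall>x. (\<integral>\<^sup>+p. before t p * indicator (ball x (sqrt t)) (snd p) * ennreal ((norm (g p))\<^sup>2) \<partial>lborel)
           \<le> ennreal (b\<^sup>2 * sqrt t ^ CARD('n)))"

lemma cylinder_integral_eq:
  fixes f g :: "'n::finite spacetime \<Rightarrow> 'b::euclidean_space"
  assumes [measurable]: "g \<in> borel_measurable borel" and eq: "AE s in lborel. 0 < s \<longrightarrow> s < t \<longrightarrow> (AE y in lborel. f (s, y) = g (s, y))"
    and B [measurable]: "B \<in> sets borel"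
  shows "(\<integral>\<^sup>+ s\<in>{0<..<t}. (\<integral>\<^sup>+ y\<in>B. ennreal ((norm (f (s, y)))\<^sup>2) \<partial>lebesgue) \<partial>lebesgue)
    = (\<integral>\<^sup>+p. before t p * indicator B (snd p) * ennreal ((norm (g p))\<^sup>2) \<partial>lborel)"
proof -
  have [measurable]: "g \<in> borel_measurable (borel \<Otimes>\<^sub>M borel)" unfolding borel_prod by measurable
  have "(\<integral>\<^sup>+ s\<in>{0<..<t}. (\<integral>\<^sup>+ y\<in>B. ennreal ((norm (f (s, y)))\<^sup>2) \<partial>lebesgue) \<partial>lebesgue)
     = (\<integral>\<^sup>+ s. (\<integral>\<^sup>+ y. ennreal ((norm (g (s, y)))\<^sup>2) * indicator B y \<partial>lborel) * indicator {0<..<t} s \<partial>lborel)"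
    unfolding nn_integral_completion
  proof (rule nn_integral_cong_AE)
    show "AE s in lborel. (\<integral>\<^sup>+ y. ennreal ((norm (f (s, y)))\<^sup>2) * indicator B y \<partial>lborel) * indicator {0<..<t} s
      = (\<integral>\<^sup>+ y. ennreal ((norm (g (s, y)))\<^sup>2) * indicator B y \<partial>lborel) * indicator {0<..<t} s"
      using eq
    proof eventually_elim
      case (elim s)
      show ?case
      proof (cases "s \<in> {0<..<t}")
        case True
        then have "AE y in lborel. f (s, y) = g (s, y)" using elim by simp
        then have "(\<integral>\<^sup>+ y. ennreal ((norm (f (s, y)))\<^sup>2) * indicator B y \<partial>lborel) = (\<integral>\<^sup>+ y. ennreal ((norm (g (s, y)))\<^sup>2) * indicator B y \<partial>lborel)"
          by (intro nn_integral_cong_AE) (auto elim!: eventually_mono)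
        then show ?thesis by simp
      qed simp
    qed
  qed
  also have "\<dots> = (\<integral>\<^sup>+ s. \<integral>\<^sup>+ y. indicator {0<..<t} s * indicator B y * ennreal ((norm (g (s, y)))\<^sup>2) \<partial>lborel \<partial>lborel)"
  proof (rule nn_integral_cong)
    fix s
    have "(\<integral>\<^sup>+ y. ennreal ((norm (g (s, y)))\<^sup>2) * indicator B y \<partial>lborel) * indicator {0<..<t} s
       = (\<integral>\<^sup>+ y. ennreal ((norm (g (s, y)))\<^sup>2) * indicator B y * indicator {0<..<t} s \<partial>lborel)"
      by (rule nn_integral_multc[symmetric]) measurable
    then show "(\<integral>\<^sup>+ y. ennreal ((norm (g (s, y)))\<^sup>2) * indicator B y \<partial>lborel) * indicator {0<..<t} s
       = (\<integral>\<^sup>+ y. indicator {0<..<t} s * indicator B y * ennreal ((norm (g (s, y)))\<^sup>2) \<partial>lborel)"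
      by (simp only: mult_ac)
  qed
  also have "\<dots> = (\<integral>\<^sup>+p. before t p * indicator B (snd p) * ennreal ((norm (g p))\<^sup>2) \<partial>lborel)"
  proof (subst nn_integral_lborel_pair_fst)
    show "(\<lambda>p. before t p * indicator B (snd p) * ennreal ((norm (g p))\<^sup>2)) \<in> borel_measurable borel"
      by measurable
  qed simp
  finally show ?thesis .
qed

text \<open>
  As the outer essential supremum is \<open>top\<close> on non-measurable functions, the bound requires that the inner one is measurable in
  time. This holds because \<open>w\<close> agrees with a Borel function at every point, not only almost everywhere.
\<close>
lemma path_norm_le:
  fixes w g :: "'n::finite spacetime \<Rightarrow> 'b::euclidean_space"
  assumes g: "path_bounds T a b g" and eq: "\<And>t x. t \<in> time_interval T \<Longrightarrow> w (t, x) = g (t, x)"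
  shows "path_norm T w \<le> ennreal (a + b)"
proof -
  have gm [measurable]: "g \<in> borel_measurable borel" and ab: "0 \<le> a" "0 \<le> b" using g by (auto simp: path_bounds_def)
  let ?h = "\<lambda>p. ennreal (norm (sqrt (fst p) *\<^sub>R g p))"
  have hm: "?h \<in> borel_measurable borel" by measurable
  let ?\<psi> = "\<lambda>t. esssup lebesgue (\<lambda>x. ennreal (norm (sqrt t *\<^sub>R w (t, x))))"
  let ?L = "lebesgue_on (time_interval T)"
  have "(\<lambda>t. esssup lebesgue (\<lambda>x. ?h (t, x))) \<in> borel_measurable ?L"
    using esssup_slice_measurable[OF hm] by (intro measurable_restrict_space1 measurable_completion) simp
  then have \<psi>m: "?\<psi> \<in> borel_measurable ?L"
    by (rule measurable_cong[THEN iffD1, rotated]) (simp add: eq)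
  have T_leb: "time_interval T \<in> sets lebesgue" by simp
  have "AE t in lborel. AE x in lborel. t \<in> time_interval T \<longrightarrow> norm (g (t, x)) * sqrt t \<le> a"
    using AE_lborel_slices[of "\<lambda>p. fst p \<in> time_interval T \<longrightarrow> norm (g p) * sqrt (fst p) \<le> a"] g by (simp add: path_bounds_def)
  then have "AE t in lborel. t \<in> time_interval T \<longrightarrow> ?\<psi> t \<le> ennreal a"
  proof eventually_elim
    case (elim t)
    show ?case
    proof
      assume t: "t \<in> time_interval T"
      then have t0: "t > 0" by (simp add: time_interval_def)
      show "?\<psi> t \<le> ennreal a"
      proof (rule esssup_I)
        have "(\<lambda>x. g (t, x)) \<in> borel_measurable borel" by measurable
        then show "(\<lambda>x. ennreal (norm (sqrt t *\<^sub>R w (t, x)))) \<in> borel_measurable lebesgue"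
          by (intro measurable_completion) (simp add: eq[OF t])
        from elim have "AE x in lborel. ennreal (norm (sqrt t *\<^sub>R w (t, x))) \<le> ennreal a"
        proof eventually_elim
          case (elim x)
          then show ?case using t t0 by (simp add: eq mult.commute ennreal_leI)
        qed
        then show "AE x in lebesgue. ennreal (norm (sqrt t *\<^sub>R w (t, x))) \<le> ennreal a"
          by (rule AE_completion)
      qed
    qed
  qed
  then have "AE t in ?L. ?\<psi> t \<le> ennreal a"
    using T_leb by (simp add: AE_restrict_space_iff AE_completion_iff)
  then have 1: "esssup ?L ?\<psi> \<le> ennreal a" by (rule esssup_I[OF \<psi>m])
  have 2: "(SUP x. SUP t\<in>time_interval T.
          ennreal_sqrt (ennreal (t powr (- real CARD('n) / 2)) *
            (\<integral>\<^sup>+ s\<in>{0<..<t}. (\<integral>\<^sup>+ y\<in>ball x (sqrt t). ennreal ((norm (w (s, y)))\<^sup>2) \<partial>lebesgue) \<partial>lebesgue))) \<le> ennreal b"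
  proof (intro SUP_least ennreal_sqrt_le ab)
    fix x t assume t: "t \<in> time_interval T"
    then have t0: "t > 0" by (simp add: time_interval_def)
    have "(\<integral>\<^sup>+ s\<in>{0<..<t}. (\<integral>\<^sup>+ y\<in>ball x (sqrt t). ennreal ((norm (w (s, y)))\<^sup>2) \<partial>lebesgue) \<partial>lebesgue)
      = (\<integral>\<^sup>+p. before t p * indicator (ball x (sqrt t)) (snd p) * ennreal ((norm (g p))\<^sup>2) \<partial>lborel)"
    proof (rule cylinder_integral_eq[OF gm])
      show "AE s in lborel. 0 < s \<longrightarrow> s < t \<longrightarrow> (AE y in lborel. w (s, y) = g (s, y))"
        using time_interval_downward[OF t] by (auto simp: eq intro!: AE_I2)
    qed simp
    also have "\<dots> \<le> ennreal (b\<^sup>2 * sqrt t ^ CARD('n))" using g t by (auto simp: path_bounds_def)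
    finally have "ennreal (t powr (- real CARD('n) / 2)) * (\<integral>\<^sup>+ s\<in>{0<..<t}. (\<integral>\<^sup>+ y\<in>ball x (sqrt t). ennreal ((norm (w (s, y)))\<^sup>2) \<partial>lebesgue) \<partial>lebesgue)
      \<le> ennreal (t powr (- real CARD('n) / 2)) * ennreal (b\<^sup>2 * sqrt t ^ CARD('n))" by (rule mult_left_mono) simp
    also have "\<dots> = ennreal (b\<^sup>2)"
      unfolding powr_minus_half_nat[OF t0] using t0 by (simp add: ennreal_mult[symmetric])
    finally show "ennreal (t powr (- real CARD('n) / 2)) * (\<integral>\<^sup>+ s\<in>{0<..<t}. (\<integral>\<^sup>+ y\<in>ball x (sqrt t). ennreal ((norm (w (s, y)))\<^sup>2) \<partial>lebesgue) \<partial>lebesgue)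
      \<le> ennreal (b\<^sup>2)" .
  qed
  show ?thesis unfolding path_norm_def using add_mono[OF 1 2] ab by simp
qed

text \<open>
  Up to time \<open>r / 2\<close> the averaging estimate passes from balls of radius \<open>\<surd>(r / 2)\<close> to unit balls; from
  then on the pointwise bound is uniform. Splitting at \<open>r / 2\<close> also covers the case \<open>r = T\<close>, a time at which
  the Carleson bound is not assumed.
\<close>
lemma uloc_L2_upto_of_path_bounds:
  fixes w g :: "'n::finite spacetime \<Rightarrow> 'b::euclidean_space"
  assumes g: "path_bounds T a b g" and eq: "\<And>t x. t \<in> time_interval T \<Longrightarrow> w (t, x) = g (t, x)"
    and r: "r > 0" "ereal r \<le> T"
  shows "uloc_L2_upto r w"
proof -
  let ?n = "CARD('n)" and ?V = "unit_ball_vol (real CARD('n))"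
  have V: "?V > 0" by simp
  have [measurable]: "g \<in> borel_measurable borel" and ab: "0 \<le> a" "0 \<le> b" using g by (auto simp: path_bounds_def)
  define t where "t = r / 2"
  have t0: "t > 0" using r by (simp add: t_def)
  have sub: "s \<in> time_interval T" if "0 < s" "s < r" for s
    using that r(2) less_le_trans[of "ereal s" "ereal r" T] by (simp add: time_interval_def)
  have t: "t \<in> time_interval T" using r by (intro sub) (auto simp: t_def)
  define K where "K = (sqrt t + 1) ^ (?n + 1) * (2 ^ (?n + 1) * real (?n + 1) * b\<^sup>2 / sqrt t) + a\<^sup>2 / t * (r * ?V)"
  have "(\<integral>\<^sup>+ s\<in>{0<..<r}. (\<integral>\<^sup>+ y\<in>ball x 1. ennreal ((norm (w (s, y)))\<^sup>2) \<partial>lebesgue) \<partial>lebesgue) \<le> ennreal K" for x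
  proof -
    let ?w = "\<lambda>p. before t p * ennreal ((norm (g p))\<^sup>2) * ennreal (decay_weight (sqrt t) (x - snd p))"
    let ?c = "\<lambda>p. before r p * indicator (ball x 1) (snd p) :: ennreal"
    have [measurable]: "ball x 1 \<in> sets borel" by simp
    have "(\<integral>\<^sup>+ s\<in>{0<..<r}. (\<integral>\<^sup>+ y\<in>ball x 1. ennreal ((norm (w (s, y)))\<^sup>2) \<partial>lebesgue) \<partial>lebesgue)
      = (\<integral>\<^sup>+p. before r p * indicator (ball x 1) (snd p) * ennreal ((norm (g p))\<^sup>2) \<partial>lborel)"
    proof (rule cylinder_integral_eq)
      show "AE s in lborel. 0 < s \<longrightarrow> s < r \<longrightarrow> (AE y in lborel. w (s, y) = g (s, y))"
        using sub by (auto simp: eq intro!: AE_I2)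
    qed measurable
    also have "\<dots> \<le> ennreal K"
      unfolding K_def
    proof (rule nn_integral_le_combination)
      have "AE p in lborel. fst p \<in> time_interval T \<longrightarrow> norm (g p) * sqrt (fst p) \<le> a"
        using g by (simp add: path_bounds_def)
      then show "AE p in lborel. before r p * indicator (ball x 1) (snd p) * ennreal ((norm (g p))\<^sup>2)
        \<le> ennreal ((sqrt t + 1) ^ (?n + 1)) * ?w p + ennreal (a\<^sup>2 / t) * ?c p"
      proof eventually_elim
        case (elim p)
        show ?case
        proof (cases "fst p \<in> {0<..<r} \<and> snd p \<in> ball x 1")
          case True
          show ?thesis
          proof (cases "fst p < t")
            case early: True
            have d: "norm (x - snd p) < 1" using True by (simp add: dist_norm)
            have "1 \<le> ennreal ((sqrt t + 1) ^ (?n + 1)) * ennreal (decay_weight (sqrt t) (x - snd p))"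
              using d t0 by (intro one_le_decay_weight) auto
            then have "ennreal ((norm (g p))\<^sup>2) * 1 \<le> ennreal ((norm (g p))\<^sup>2) * (ennreal ((sqrt t + 1) ^ (?n + 1)) * ennreal (decay_weight (sqrt t) (x - snd p)))"
              by (intro mult_left_mono) simp_all
            also have "\<dots> = ennreal ((sqrt t + 1) ^ (?n + 1)) * ?w p"
              using True early by (simp add: mult_ac)
            finally show ?thesis using True by (simp add: add_increasing2)
          next
            case late: False
            have "fst p \<in> time_interval T" using True by (intro sub) auto
            then have "norm (g p) * sqrt (fst p) \<le> a" using elim by simp
            then have "(norm (g p) * sqrt (fst p))\<^sup>2 \<le> a\<^sup>2" using True by (intro power_mono) auto
            then have "(norm (g p))\<^sup>2 * fst p \<le> a\<^sup>2" using True by (simp add: power_mult_distrib)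
            moreover have "(norm (g p))\<^sup>2 * t \<le> (norm (g p))\<^sup>2 * fst p" using late by (intro mult_left_mono) auto
            ultimately have "(norm (g p))\<^sup>2 * t \<le> a\<^sup>2" by linarith
            then have "(norm (g p))\<^sup>2 \<le> a\<^sup>2 / t" using t0 by (simp add: pos_le_divide_eq)
            then show ?thesis using True by (simp add: add_increasing ennreal_leI)
          qed
        qed auto
      qed
      show "?w \<in> borel_measurable lborel" "?c \<in> borel_measurable lborel" by measurable
      show "(\<integral>\<^sup>+p. ?w p \<partial>lborel) \<le> ennreal (2 ^ (?n + 1) * real (?n + 1) * b\<^sup>2 / sqrt t)"
      proof (rule nn_integral_carleson_decay_weight[OF _ t0])
        show "(\<integral>\<^sup>+p. before t p * indicator (ball x (sqrt t)) (snd p) * ennreal ((norm (g p))\<^sup>2) \<partial>lborel) \<le> ennreal (b\<^sup>2 * sqrt t ^ ?n)" for x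
          using g t by (simp add: path_bounds_def)
      qed auto
      have "(\<integral>\<^sup>+p. ?c p \<partial>lborel) = (\<integral>\<^sup>+s. \<integral>\<^sup>+y. ?c (s, y) \<partial>lborel \<partial>lborel)"
        by (rule nn_integral_lborel_pair_fst) measurable
      also have "\<dots> = (\<integral>\<^sup>+s. ennreal ?V * indicator {0<..<r} s \<partial>lborel)"
        by (intro nn_integral_cong) (simp add: nn_integral_cmult_indicator emeasure_ball mult.commute)
      finally show "(\<integral>\<^sup>+p. ?c p \<partial>lborel) \<le> ennreal (r * ?V)"
        using r V by (simp add: nn_integral_cmult_indicator ennreal_mult[symmetric] mult.commute)
    qed (use t0 r V in auto)
    finally show ?thesis .
  qed
  then have "(SUP x. \<integral>\<^sup>+ s\<in>{0<..<r}. (\<integral>\<^sup>+ y\<in>ball x 1. ennreal ((norm (w (s, y)))\<^sup>2) \<partial>lebesgue) \<partial>lebesgue) \<le> ennreal K"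
    by (rule SUP_least)
  then show ?thesis unfolding uloc_L2_upto_def by (rule le_less_trans) simp
qed

lemma path_space_of_path_bounds:
  fixes w g :: "'n::finite spacetime \<Rightarrow> complex"
  assumes T: "T > 0" and g: "path_bounds T a b g" and eq: "\<And>t x. t \<in> time_interval T \<Longrightarrow> w (t, x) = g (t, x)"
  shows "w \<in> path_space T"
proof -
  have "g \<in> borel_measurable borel" using g by (simp add: path_bounds_def)
  then have "g \<in> borel_measurable (lebesgue_on (time_interval T \<times> UNIV))"
    by (intro measurable_restrict_space1 measurable_completion) simp
  then have "w \<in> borel_measurable (lebesgue_on (time_interval T \<times> UNIV))"
    by (rule measurable_cong[THEN iffD1, rotated]) (auto simp: eq)
  moreover have "uloc_L2 T w"
  proof (cases "T = \<infinity>")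
    case True
    then show ?thesis unfolding uloc_L2_def using uloc_L2_upto_of_path_bounds[OF g eq] by simp
  next
    case False
    with T obtain r where "T = ereal r" "r > 0" by (cases T) auto
    then show ?thesis unfolding uloc_L2_def using uloc_L2_upto_of_path_bounds[OF g eq, of r] by simp
  qed
  moreover have "path_norm T w < top"
  proof -
    have "path_norm T w \<le> ennreal (a + b)" by (rule path_norm_le[OF g eq])
    then show ?thesis by (rule le_less_trans) (rule ennreal_less_top)
  qed
  ultimately show ?thesis by (simp add: path_space_def)
qed

text \<open>
  Lebesgue measurable functions have Borel representatives. They agree on almost every time slice almost
  everywhere, which is enough to transfer both parts of the norm.
\<close>
lemma path_space_representative:
  fixes f :: "'n::finite spacetime \<Rightarrow> complex"
  assumes f: "f \<in> path_space T"
  obtains g where "path_bounds T (enn2real (path_norm T f)) (enn2real (path_norm T f)) g"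
    "AE s in lborel. s \<in> time_interval T \<longrightarrow> (AE y in lborel. f (s, y) = g (s, y))"
proof -
  let ?S = "time_interval T \<times> (UNIV :: (real ^ 'n) set)"
  let ?f = "\<lambda>p. indicator ?S p *\<^sub>R f p"
  define N where "N = enn2real (path_norm T f)"
  have N0: "N \<ge> 0" by (simp add: N_def)
  have N: "path_norm T f = ennreal N" using f by (simp add: N_def path_space_def)
  have S: "?S \<in> sets lebesgue" by (intro sets_completionI_sets) (simp add: borel_open open_Times open_time_interval)
  have "?f \<in> borel_measurable lebesgue"
    using f S by (subst borel_measurable_restrict_space_iff[symmetric]) (auto simp: path_space_def)
  then have "(\<lambda>p. Re (?f p)) \<in> borel_measurable lebesgue" "(\<lambda>p. Im (?f p)) \<in> borel_measurable lebesgue"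
    by measurable
  from this[THEN completion_ex_borel_measurable_real]
  obtain g1 g2 where g1: "g1 \<in> borel_measurable lborel" "AE p in lborel. Re (?f p) = g1 p"
    and g2: "g2 \<in> borel_measurable lborel" "AE p in lborel. Im (?f p) = g2 p"
    by (elim bexE)
  define g where "g p = Complex (g1 p) (g2 p)" for p
  have gm [measurable]: "g \<in> borel_measurable borel"
  proof -
    have "g = (\<lambda>p. complex_of_real (g1 p) + \<i> * complex_of_real (g2 p))" by (simp add: g_def[abs_def] Complex_eq)
    then show ?thesis using g1(1) g2(1) by simp
  qed
  have "AE p in lborel. ?f p = g p"
    using g1(2) g2(2) by eventually_elim (simp add: g_def complex_eq_iff)
  then have "AE p in lborel. fst p \<in> time_interval T \<longrightarrow> f p = g p"
    by eventually_elim (auto simp: indicator_def mem_Times_iff split: if_splits)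
  from AE_lborel_slices[OF this]
  have eq: "AE s in lborel. s \<in> time_interval T \<longrightarrow> (AE y in lborel. f (s, y) = g (s, y))"
    by eventually_elim simp
  let ?\<psi> = "\<lambda>t. esssup lebesgue (\<lambda>x. ennreal (norm (sqrt t *\<^sub>R f (t, x))))"
  have sum: "esssup (lebesgue_on (time_interval T)) ?\<psi> \<le> ennreal N"
    unfolding N[symmetric] path_norm_def by simp
  have "AE t in lebesgue_on (time_interval T). ?\<psi> t \<le> ennreal N"
    using esssup_AE[of ?\<psi>] by eventually_elim (rule order.trans[OF _ sum])
  then have \<psi>: "AE t in lborel. t \<in> time_interval T \<longrightarrow> ?\<psi> t \<le> ennreal N"
    by (simp add: AE_restrict_space_iff AE_completion_iff)
  have "AE p in lborel. fst p \<in> time_interval T \<longrightarrow> norm (g p) * sqrt (fst p) \<le> N"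
  proof (rule AE_lborel_from_slices)
    have "{p \<in> space borel. fst p \<in> time_interval T \<longrightarrow> norm (g p) * sqrt (fst p) \<le> N} \<in> sets borel" by measurable
    then show "{p. fst p \<in> time_interval T \<longrightarrow> norm (g p) * sqrt (fst p) \<le> N} \<in> sets borel" by simp
    show "AE s in lborel. AE y in lborel. fst (s, y) \<in> time_interval T \<longrightarrow> norm (g (s, y)) * sqrt (fst (s, y)) \<le> N"
      using eq \<psi>
    proof eventually_elim
      case (elim s)
      show ?case
      proof (cases "s \<in> time_interval T")
        case True
        then have s0: "s > 0" by (simp add: time_interval_def)
        have "AE y in lebesgue. ennreal (norm (sqrt s *\<^sub>R f (s, y))) \<le> ?\<psi> s" by (rule esssup_AE)
        then have "AE y in lborel. ennreal (norm (sqrt s *\<^sub>R f (s, y))) \<le> ?\<psi> s" by (simp add: AE_completion_iff)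
        moreover have "AE y in lborel. f (s, y) = g (s, y)" using elim True by simp
        ultimately show ?thesis
        proof eventually_elim
          case (elim y)
          have "ennreal (norm (sqrt s *\<^sub>R f (s, y))) \<le> ennreal N"
            using elim(1) \<open>s \<in> time_interval T \<longrightarrow> ?\<psi> s \<le> ennreal N\<close> True by (auto intro: order.trans)
          then show ?case using N0 s0 elim(2) by (simp add: mult.commute)
        qed
      qed simp
    qed
  qed
  moreover have "(\<integral>\<^sup>+p. before t p * indicator (ball x (sqrt t)) (snd p) * ennreal ((norm (g p))\<^sup>2) \<partial>lborel) \<le> ennreal (N\<^sup>2 * sqrt t ^ CARD('n))"
    if t: "t \<in> time_interval T" for t x
  proof -
    have t0: "t > 0" using t by (simp add: time_interval_def)
    let ?J = "\<integral>\<^sup>+p. before t p * indicator (ball x (sqrt t)) (snd p) * ennreal ((norm (g p))\<^sup>2) \<partial>lborel"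
    have J: "(\<integral>\<^sup>+ s\<in>{0<..<t}. (\<integral>\<^sup>+ y\<in>ball x (sqrt t). ennreal ((norm (f (s, y)))\<^sup>2) \<partial>lebesgue) \<partial>lebesgue) = ?J"
    proof (rule cylinder_integral_eq[OF gm])
      show "AE s in lborel. 0 < s \<longrightarrow> s < t \<longrightarrow> (AE y in lborel. f (s, y) = g (s, y))"
        using eq by eventually_elim (auto intro: time_interval_downward[OF t])
    qed simp
    let ?A = "\<lambda>x t. ennreal_sqrt (ennreal (t powr (- real CARD('n) / 2)) *
            (\<integral>\<^sup>+ s\<in>{0<..<t}. (\<integral>\<^sup>+ y\<in>ball x (sqrt t). ennreal ((norm (f (s, y)))\<^sup>2) \<partial>lebesgue) \<partial>lebesgue))"
    have "?A x t \<le> (SUP t\<in>time_interval T. ?A x t)" by (rule SUP_upper[OF t])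
    also have "\<dots> \<le> (SUP x. SUP t\<in>time_interval T. ?A x t)" by (rule SUP_upper) simp
    also have "\<dots> \<le> ennreal N" unfolding N[symmetric] path_norm_def by simp
    finally have "ennreal (t powr (- real CARD('n) / 2)) * ?J \<le> ennreal (N\<^sup>2)"
      unfolding J by (rule le_of_ennreal_sqrt_le[OF _ N0])
    then have "ennreal (sqrt t ^ CARD('n)) * (ennreal (t powr (- real CARD('n) / 2)) * ?J) \<le> ennreal (sqrt t ^ CARD('n)) * ennreal (N\<^sup>2)"
      by (rule mult_left_mono) simp
    moreover have "ennreal (sqrt t ^ CARD('n)) * (ennreal (t powr (- real CARD('n) / 2)) * ?J) = ?J"
      unfolding powr_minus_half_nat[OF t0] mult.assoc[symmetric] using t0 by (simp add: ennreal_mult[symmetric])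
    moreover have "ennreal (sqrt t ^ CARD('n)) * ennreal (N\<^sup>2) = ennreal (N\<^sup>2 * sqrt t ^ CARD('n))"
      using t0 by (simp add: ennreal_mult[symmetric] mult.commute)
    ultimately show ?thesis by simp
  qed
  ultimately have "path_bounds T N N g" using gm N0 by (simp add: path_bounds_def)
  then show ?thesis using that eq by (simp add: N_def)
qed

lemma source_bound_product:
  fixes f g :: "'n::finite spacetime \<Rightarrow> complex"
  assumes f: "path_bounds T a a f" and g: "path_bounds T b b g"
  shows "source_bound T (a * b) (\<lambda>p. f p * g p)"
  unfolding source_bound_def
proof (intro conjI ballI allI)
  have [measurable]: "f \<in> borel_measurable borel" "g \<in> borel_measurable borel" and ab: "a \<ge> 0" "b \<ge> 0"
    using f g by (auto simp: path_bounds_def)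
  show "(\<lambda>p. f p * g p) \<in> borel_measurable borel" by measurable
  show "0 \<le> a * b" using ab by simp
  have "AE p in lborel. fst p \<in> time_interval T \<longrightarrow> norm (f p) * sqrt (fst p) \<le> a"
    "AE p in lborel. fst p \<in> time_interval T \<longrightarrow> norm (g p) * sqrt (fst p) \<le> b"
    using f g by (auto simp: path_bounds_def)
  then show "AE p in lborel. fst p \<in> time_interval T \<longrightarrow> norm (f p * g p) \<le> a * b / fst p"
  proof eventually_elim
    case (elim p)
    show ?case
    proof
      assume p: "fst p \<in> time_interval T"
      then have p0: "fst p > 0" by (simp add: time_interval_def)
      have "(norm (f p) * sqrt (fst p)) * (norm (g p) * sqrt (fst p)) \<le> a * b"
        using elim p ab by (intro mult_mono) (auto simp: p0 less_imp_le)
      moreover have "(norm (f p) * sqrt (fst p)) * (norm (g p) * sqrt (fst p)) = norm (f p * g p) * fst p"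
        using p0 by (simp add: norm_mult)
      ultimately show "norm (f p * g p) \<le> a * b / fst p" using p0 by (simp add: pos_le_divide_eq)
    qed
  qed
  fix t and x :: "real ^ 'n" assume t: "t \<in> time_interval T"
  then have t0: "t > 0" by (simp add: time_interval_def)
  have [measurable]: "ball x (sqrt t) \<in> sets borel" by simp
  let ?\<chi> = "\<lambda>p. before t p * indicator (ball x (sqrt t)) (snd p) :: ennreal"
  let ?I = "\<integral>\<^sup>+p. ?\<chi> p * ennreal (norm (f p * g p)) \<partial>lborel"
  have \<chi>2: "(?\<chi> p * ennreal (norm c))\<^sup>2 = ?\<chi> p * ennreal ((norm c)\<^sup>2)" for p and c :: complex
    by (auto simp: indicator_def ennreal_power)
  have "?I = (\<integral>\<^sup>+p. (?\<chi> p * ennreal (norm (f p))) * (?\<chi> p * ennreal (norm (g p))) \<partial>lborel)"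
    by (intro nn_integral_cong) (auto simp: indicator_def norm_mult ennreal_mult)
  then have "?I\<^sup>2 \<le> (\<integral>\<^sup>+p. (?\<chi> p * ennreal (norm (f p)))\<^sup>2 \<partial>lborel) * (\<integral>\<^sup>+p. (?\<chi> p * ennreal (norm (g p)))\<^sup>2 \<partial>lborel)"
    by (simp only:) (rule Cauchy_Schwarz_nn_integral; measurable)
  also have "\<dots> \<le> ennreal (a\<^sup>2 * sqrt t ^ CARD('n)) * ennreal (b\<^sup>2 * sqrt t ^ CARD('n))"
    unfolding \<chi>2 using f g t by (intro mult_mono) (auto simp: path_bounds_def)
  also have "\<dots> = (ennreal (a * b * sqrt t ^ CARD('n)))\<^sup>2"
    using ab t0 by (simp add: ennreal_mult[symmetric] ennreal_power power_mult_distrib power2_eq_square mult_ac)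
  finally have I2: "?I\<^sup>2 \<le> (ennreal (a * b * sqrt t ^ CARD('n)))\<^sup>2" .
  show "?I \<le> ennreal (a * b * sqrt t ^ CARD('n))"
  proof (cases ?I)
    case (real r)
    have c: "a * b * sqrt t ^ CARD('n) \<ge> 0" using ab t0 by simp
    from I2 have "ennreal (r\<^sup>2) \<le> ennreal ((a * b * sqrt t ^ CARD('n))\<^sup>2)"
      unfolding real(2) ennreal_power[OF real(1)] ennreal_power[OF c] .
    then have "r\<^sup>2 \<le> (a * b * sqrt t ^ CARD('n))\<^sup>2"
      by (rule ennreal_le_iff[THEN iffD1, rotated]) (rule zero_le_power2)
    then have "r \<le> a * b * sqrt t ^ CARD('n)" using c by (rule power2_le_imp_le)
    then show ?thesis unfolding real(2) by (rule ennreal_leI)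
  next
    case top
    have "(top :: ennreal)\<^sup>2 = top" unfolding power2_eq_square by (rule ennreal_top_mult[THEN trans]) simp
    moreover have "(ennreal (a * b * sqrt t ^ CARD('n)))\<^sup>2 = ennreal ((a * b * sqrt t ^ CARD('n))\<^sup>2)"
      using ab t0 by (intro ennreal_power) simp
    ultimately have False using I2 unfolding top by (simp only: top_unique ennreal_neq_top)
    then show ?thesis ..
  qed
qed

section \<open>The bilinear operator\<close>

lemma parabolic_multiplier_oseen: "\<exists>C. parabolic_multiplier (oseen_symbol j k (l :: 'n::finite)) C"
proof -
  obtain C where C: "C > 0" "\<forall>\<tau>>0. \<forall>x::real^'n. norm (multiplier_kernel (oseen_symbol j k l) \<tau> x) \<le> C / (sqrt \<tau> + norm x) ^ (CARD('n) + 1)"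
    using norm_oseen_gradient_le by blast
  have "parabolic_multiplier (oseen_symbol j k l) C"
    by unfold_locales (use C norm_oseen_symbol_le in \<open>auto simp: decay_weight_def divide_inverse power_inverse\<close>)
  then show ?thesis ..
qed

definition duhamel_bounded :: "(real \<Rightarrow> real ^ 'n::finite \<Rightarrow> complex) \<Rightarrow> real \<Rightarrow> bool" where
  "duhamel_bounded \<kappa> D \<longleftrightarrow>
     (\<forall>T M F t x. source_bound T M F \<longrightarrow> t \<in> time_interval T \<longrightarrow> norm (duhamel \<kappa> 0 F t x) \<le> D * M / sqrt t) \<and>
     (\<forall>T M F R a. source_bound T M F \<longrightarrow> R \<in> time_interval T \<longrightarrow>
       (cylinder_energy R a (duhamel \<kappa> 0 F))
       \<le> ennreal (D * M\<^sup>2 * sqrt R ^ CARD('n)))"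

lemma duhamel_boundedI:
  fixes \<kappa> :: "real \<Rightarrow> real ^ 'n::finite \<Rightarrow> complex"
  assumes sup: "\<And>T M F t x. source_bound T M F \<Longrightarrow> t \<in> time_interval T \<Longrightarrow> norm (duhamel \<kappa> 0 F t x) \<le> D1 * M / sqrt t"
    and L2: "\<And>T M F R a. source_bound T M F \<Longrightarrow> R \<in> time_interval T \<Longrightarrow>
       (cylinder_energy R a (duhamel \<kappa> 0 F))
       \<le> ennreal (D2 * M\<^sup>2 * sqrt R ^ CARD('n))"
    and D: "D1 \<le> D" "D2 \<le> D"
  shows "duhamel_bounded \<kappa> D"
  unfolding duhamel_bounded_def
proof (intro conjI allI impI)
  fix T M t x and F :: "'n spacetime \<Rightarrow> complex" assume s: "source_bound T M F" and t: "t \<in> time_interval T"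
  have "D1 * M / sqrt t \<le> D * M / sqrt t"
    using source_bound_nonneg[OF s] t D by (intro divide_right_mono mult_right_mono) (auto simp: time_interval_def)
  with sup[OF s t] show "norm (duhamel \<kappa> 0 F t x) \<le> D * M / sqrt t" by (rule order.trans)
next
  fix T M R a and F :: "'n spacetime \<Rightarrow> complex" assume s: "source_bound T M F" and R: "R \<in> time_interval T"
  have "D2 * M\<^sup>2 * sqrt R ^ CARD('n) \<le> D * M\<^sup>2 * sqrt R ^ CARD('n)"
    using R D by (intro mult_right_mono) (auto simp: time_interval_def)
  with L2[OF s R] show "(cylinder_energy R a (duhamel \<kappa> 0 F))
       \<le> ennreal (D * M\<^sup>2 * sqrt R ^ CARD('n))"
    by (rule order.trans[OF _ ennreal_leI])
qed

lemma duhamel_boundedD: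
  fixes \<kappa> :: "real \<Rightarrow> real ^ 'n::finite \<Rightarrow> complex"
  assumes "duhamel_bounded \<kappa> D" "source_bound T M F" "t \<in> time_interval T"
  shows "norm (duhamel \<kappa> 0 F t x) \<le> D * M / sqrt t"
    and "(cylinder_energy t a (duhamel \<kappa> 0 F))
       \<le> ennreal (D * M\<^sup>2 * sqrt t ^ CARD('n))"
  using assms unfolding duhamel_bounded_def by simp_all

lemma oseen_duhamel_bounded:
  "\<exists>D>0. \<forall>(j :: 'n::finite) k l. duhamel_bounded (oseen_gradient j k l) D"
proof -
  let ?P = "\<lambda>(q :: 'n \<times> 'n \<times> 'n) D. D > 0 \<and> duhamel_bounded (oseen_gradient (fst q) (fst (snd q)) (snd (snd q))) D"
  have "\<exists>D. ?P q D" for q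
  proof -
    obtain C where "parabolic_multiplier (oseen_symbol (fst q) (fst (snd q)) (snd (snd q))) C"
      using parabolic_multiplier_oseen by blast
    then interpret parabolic_multiplier "oseen_symbol (fst q) (fst (snd q)) (snd (snd q))" C .
    obtain D1 where D1: "D1 > 0" "\<And>T M F t x. source_bound T M F \<Longrightarrow> t \<in> time_interval T \<Longrightarrow>
       norm (duhamel \<kappa> 0 F t x) \<le> D1 * M / sqrt t" using norm_duhamel_le by blast
    obtain D2 where D2: "D2 > 0" "\<And>T M F R a. source_bound T M F \<Longrightarrow> R \<in> time_interval T \<Longrightarrow>
      (cylinder_energy R a (duhamel \<kappa> 0 F))
      \<le> ennreal (D2 * M\<^sup>2 * sqrt R ^ CARD('n))" using duhamel_cylinder_energy by blast
    have "duhamel_bounded \<kappa> (max D1 D2)" by (rule duhamel_boundedI[OF D1(2) D2(2)]) simp_all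
    then show ?thesis using D1(1) by (intro exI[of _ "max D1 D2"]) simp
  qed
  then obtain D where D: "\<And>q. ?P q (D q)" using choice[of ?P] by blast
  define S where "S = (\<Sum>q\<in>UNIV. D q)"
  have le: "D q \<le> S" for q unfolding S_def using D by (intro member_le_sum) (auto intro: less_imp_le)
  have "S > 0" using D le[of undefined] by (blast intro: less_le_trans)
  moreover have "duhamel_bounded (oseen_gradient j k l) S" for j k l :: 'n
  proof -
    have "duhamel_bounded (oseen_gradient j k l) (D (j, k, l))" using D[of "(j, k, l)"] by simp
    note b = duhamel_boundedD[OF this]
    show ?thesis by (rule duhamel_boundedI[OF b(1) b(2) le le])
  qed
  ultimately show ?thesis by blast
qed

lemma norm_vec_le_sum: "norm (w :: 'a::real_normed_vector ^ 'n::finite) \<le> (\<Sum>j\<in>UNIV. norm (w $ j))"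
  unfolding norm_vec_def by (rule L2_set_le_sum) simp

lemma bounded_linear_axis: "bounded_linear (axis j :: 'a::real_normed_vector \<Rightarrow> 'a ^ 'n::finite)"
proof (rule bounded_linear_intro[where K = 1])
  fix c :: 'a
  show "norm (axis j c :: 'a ^ 'n) \<le> norm c * 1"
    using norm_vec_le_sum[of "axis j c :: 'a ^ 'n"] by (simp add: axis_def if_distrib cong: if_cong)
qed (auto simp: axis_def vec_eq_iff)

lemma vec_lambda_eq_sum_axis: "(\<chi> j. c j) = (\<Sum>j\<in>UNIV. axis j (c j :: complex))"
  by (simp add: vec_eq_iff axis_def if_distrib sum.delta' cong: if_cong)

lemma
  fixes f :: "'n::finite \<Rightarrow> 'a \<Rightarrow> complex"
  assumes int: "\<And>j. integrable M (f j)"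
  shows integrable_vec_lambda: "integrable M (\<lambda>s. \<chi> j. f j s)"
    and integral_vec_lambda: "(\<integral>s. (\<chi> j. f j s) \<partial>M) = (\<chi> j. \<integral>s. f j s \<partial>M)"
proof -
  show i: "integrable M (\<lambda>s. \<chi> j. f j s)"
    unfolding vec_lambda_eq_sum_axis by (intro Bochner_Integration.integrable_sum integrable_bounded_linear[OF bounded_linear_axis] int)
  show "(\<integral>s. (\<chi> j. f j s) \<partial>M) = (\<chi> j. \<integral>s. f j s \<partial>M)"
    using integral_bounded_linear[OF bounded_linear_vec_nth i] by (simp add: vec_eq_iff)
qed

lemma
  fixes f g :: "'a::euclidean_space \<Rightarrow> 'b::euclidean_space"
  assumes g: "g \<in> borel_measurable borel" and eq: "AE y in lborel. f y = g y"
  shows integrable_lebesgue_iff_representative: "integrable lebesgue f \<longleftrightarrow> integrable lborel g"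
    and integral_lebesgue_representative: "(LINT y|lebesgue. f y) = (LINT y|lborel. g y)"
proof -
  have gl: "g \<in> borel_measurable lebesgue" using g by (intro measurable_completion) simp
  have eq': "AE y in lebesgue. g y = f y" using eq by (intro AE_completion) (auto elim!: eventually_mono)
  have fl: "f \<in> borel_measurable lebesgue" by (rule borel_measurable_AE[OF gl eq'])
  have "integrable lebesgue f \<longleftrightarrow> integrable lebesgue g"
    by (rule integrable_cong_AE[OF fl gl]) (use eq' in \<open>auto elim!: eventually_mono\<close>)
  then show "integrable lebesgue f \<longleftrightarrow> integrable lborel g"
    using g by (simp add: integrable_completion)
  have "(LINT y|lebesgue. f y) = (LINT y|lebesgue. g y)"
    by (rule integral_cong_AE[OF fl gl]) (use eq' in \<open>auto elim!: eventually_mono\<close>)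
  then show "(LINT y|lebesgue. f y) = (LINT y|lborel. g y)"
    using g by (simp add: integral_completion)
qed

text \<open>
  For almost every \<open>s\<close> the slices of \<open>u\<close> and \<open>v\<close> agree almost everywhere with those of the representatives,
  so the integrals over \<open>y\<close> agree. Absolute convergence over space-time then gives, by
  Fubini's theorem, the convergence of the iterated integrals and their value, at every point \<open>(t, x)\<close>.
\<close>
lemma
  fixes u v :: "'n::finite spacetime \<Rightarrow> complex ^ 'n"
  assumes f: "\<And>l. path_bounds T (a l) (a l) (f l)" and g: "\<And>k. path_bounds T (b k) (b k) (g k)"
    and uf: "\<And>l. AE s in lborel. s \<in> time_interval T \<longrightarrow> (AE y in lborel. u (s, y) $ l = f l (s, y))"
    and vg: "\<And>k. AE s in lborel. s \<in> time_interval T \<longrightarrow> (AE y in lborel. v (s, y) $ k = g k (s, y))"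
    and t: "t \<in> time_interval T"
  shows bilinear_op_converges_of_representatives: "bilinear_op_converges u v t x"
    and bilinear_op_eq_duhamel: "bilinear_op u v (t, x)
      = (\<chi> j. \<Sum>k\<in>UNIV. \<Sum>l\<in>UNIV. duhamel (oseen_gradient j k l) 0 (\<lambda>p. f l p * g k p) t x)"
proof -
  define F where "F l k p = f l p * g k p" for l k p
  have source: "source_bound T (a l * b k) (F l k)" for l k
    unfolding F_def by (rule source_bound_product[OF f g])
  note [measurable] = borel_measurable_source[OF source]
  let ?\<kappa> = "\<lambda>j k l. multiplier_kernel (oseen_symbol j k l)"
  define I where "I j k l p = before t p *\<^sub>R (?\<kappa> j k l (t - fst p + 0) (x - snd p) * F l k p)"
    for j k l and p :: "'n spacetime"
  have I_meas [measurable]: "I j k l \<in> borel_measurable borel" for j k l unfolding I_def by measurable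
  have I_int: "integrable (lborel \<Otimes>\<^sub>M lborel) (I j k l)" for j k l
  proof -
    obtain C where "parabolic_multiplier (oseen_symbol j k l) C" using parabolic_multiplier_oseen by blast
    then interpret parabolic_multiplier "oseen_symbol j k l" C .
    have "integrable lborel (integrand 0 (F l k) t x)" by (rule integrable_integrand[OF source t]) simp
    then show ?thesis unfolding lborel_prod integrand_def[abs_def] I_def[abs_def] .
  qed
  define J where "J j k l s = (LINT y|lborel. I j k l (s, y))" for j k l s
  have J_int: "integrable lborel (J j k l)" for j k l
    unfolding J_def by (rule lborel_pair.integrable_fst'[OF I_int])
  have J_duhamel: "(LINT s|lborel. J j k l s) = duhamel (?\<kappa> j k l) 0 (F l k) t x" for j k l
    using lborel_pair.integral_fst'[OF I_int[of j k l]] unfolding J_def by (simp add: lborel_prod duhamel_def I_def[abs_def])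
  let ?\<alpha> = "\<lambda>s y. tensor (u (s, y)) (v (s, y))"
  let ?K = "\<lambda>j k l s y. partial_deriv l (oseen_kernel (t - s) j k) (x - y) * ?\<alpha> s y $ l $ k"
  have I_slice_meas: "(\<lambda>y. I j k l (s, y)) \<in> borel_measurable borel" for j k l s
  proof -
    have "I j k l \<in> borel_measurable (borel \<Otimes>\<^sub>M borel)" unfolding borel_prod by (rule I_meas)
    then show ?thesis by measurable
  qed
  have "AE s in lborel. \<forall>l. s \<in> time_interval T \<longrightarrow> (AE y in lborel. u (s, y) $ l = f l (s, y))"
    by (rule AE_all_countable[THEN iffD2]) (use uf in blast)
  moreover have "AE s in lborel. \<forall>k. s \<in> time_interval T \<longrightarrow> (AE y in lborel. v (s, y) $ k = g k (s, y))"
    by (rule AE_all_countable[THEN iffD2]) (use vg in blast)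
  moreover have "AE s in lborel. \<forall>j k l. integrable lborel (\<lambda>y. I j k l (s, y))"
    by (intro AE_all_countable[THEN iffD2] allI lborel_pair.AE_integrable_fst'[OF I_int])
  ultimately have slices: "AE s in lborel. s \<in> {0<..<t} \<longrightarrow> (\<forall>j k l. integrable lebesgue (?K j k l s) \<and> (LINT y|lebesgue. ?K j k l s y) = J j k l s)"
  proof eventually_elim
    case (elim s)
    show ?case
    proof (intro impI allI)
      fix j k l assume s: "s \<in> {0<..<t}"
      then have sT: "s \<in> time_interval T" by (intro time_interval_downward[OF t]) auto
      have "AE y in lborel. u (s, y) $ l = f l (s, y)" "AE y in lborel. v (s, y) $ k = g k (s, y)"
        using elim(1,2) sT by blast+
      then have "AE y in lborel. ?K j k l s y = I j k l (s, y)"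
      proof eventually_elim
        case (elim y)
        then show ?case using s by (simp add: I_def F_def tensor_def partial_deriv_oseen_kernel)
      qed
      note rep = I_slice_meas this
      show "integrable lebesgue (?K j k l s) \<and> (LINT y|lebesgue. ?K j k l s y) = J j k l s"
        using integrable_lebesgue_iff_representative[OF rep] integral_lebesgue_representative[OF rep] elim(3)
        by (simp add: J_def)
    qed
  qed
  define W where "W s = (\<chi> j. \<Sum>k\<in>UNIV. \<Sum>l\<in>UNIV. J j k l s)" for s
  have W_int: "integrable lborel W" and W_eq: "(LINT s|lborel. W s) = (\<chi> j. \<Sum>k\<in>UNIV. \<Sum>l\<in>UNIV. duhamel (?\<kappa> j k l) 0 (F l k) t x)"
  proof -
    have ij: "integrable lborel (\<lambda>s. \<Sum>k\<in>UNIV. \<Sum>l\<in>UNIV. J j k l s)" for j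
      by (intro Bochner_Integration.integrable_sum J_int)
    show "integrable lborel W" unfolding W_def by (rule integrable_vec_lambda[OF ij])
    have "(LINT s|lborel. W s) = (\<chi> j. LINT s|lborel. (\<Sum>k\<in>UNIV. \<Sum>l\<in>UNIV. J j k l s))"
      unfolding W_def by (rule integral_vec_lambda[OF ij])
    then show "(LINT s|lborel. W s) = (\<chi> j. \<Sum>k\<in>UNIV. \<Sum>l\<in>UNIV. duhamel (?\<kappa> j k l) 0 (F l k) t x)"
      by (simp add: Bochner_Integration.integral_sum Bochner_Integration.integrable_sum J_int J_duhamel)
  qed
  have J0: "J j k l s = 0" if "s \<notin> {0<..<t}" for j k l s
    using that by (simp add: J_def I_def)
  have rep: "AE s in lborel. indicator {0<..<t} s *\<^sub>R heat_leray_div (t - s) (?\<alpha> s) x = W s"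
    using slices
  proof eventually_elim
    case (elim s)
    then show ?case
      by (cases "s \<in> {0<..<t}") (auto simp: heat_leray_div_def W_def J0 vec_eq_iff)
  qed
  have W_meas: "W \<in> borel_measurable borel" using W_int by auto
  have op: "bilinear_op u v (t, x) = (LINT s|lborel. W s)"
    unfolding bilinear_op_def set_lebesgue_integral_def prod.case by (rule integral_lebesgue_representative[OF W_meas rep])
  then show "bilinear_op u v (t, x)
      = (\<chi> j. \<Sum>k\<in>UNIV. \<Sum>l\<in>UNIV. duhamel (oseen_gradient j k l) 0 (\<lambda>p. f l p * g k p) t x)"
    unfolding W_eq F_def[abs_def] .
  have "set_integrable lebesgue {0<..<t} (\<lambda>s. heat_leray_div (t - s) (?\<alpha> s) x)"
    unfolding set_integrable_def integrable_lebesgue_iff_representative[OF W_meas rep] by (rule W_int)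
  moreover have "AE s in lebesgue_on {0<..<t}. heat_leray_div_converges (t - s) (?\<alpha> s) x"
  proof -
    have "AE s in lborel. s \<in> {0<..<t} \<longrightarrow> heat_leray_div_converges (t - s) (?\<alpha> s) x"
      using slices by eventually_elim (auto simp: heat_leray_div_converges_def)
    then have "AE s in lebesgue. s \<in> {0<..<t} \<longrightarrow> heat_leray_div_converges (t - s) (?\<alpha> s) x" by (rule AE_completion)
    then show ?thesis by (simp add: AE_restrict_space_iff)
  qed
  ultimately show "bilinear_op_converges u v t x" unfolding bilinear_op_converges_def by simp
qed

lemma ennreal_sqrt_mono: "a \<le> b \<Longrightarrow> ennreal_sqrt a \<le> ennreal_sqrt b"
  by (auto simp: ennreal_sqrt_def top_unique intro!: ennreal_leI enn2real_mono simp: less_top)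

text \<open>
  Monotonicity of the essential supremum needs the smaller function to be measurable. For the components this
  follows from the finiteness of their norms, since the essential supremum of a non-measurable function is \<open>top\<close>.
\<close>
lemma path_norm_component_le:
  fixes u :: "'n::finite spacetime \<Rightarrow> complex ^ 'n"
  assumes u: "(\<lambda>p. u p $ l) \<in> path_space T"
  shows "path_norm T (\<lambda>p. u p $ l) \<le> path_norm T u"
proof -
  let ?L = "lebesgue_on (time_interval T)"
  let ?\<psi>l = "\<lambda>t. esssup lebesgue (\<lambda>x. ennreal (norm (sqrt t *\<^sub>R (u (t, x) $ l))))"
  let ?\<psi> = "\<lambda>t. esssup lebesgue (\<lambda>x. ennreal (norm (sqrt t *\<^sub>R u (t, x))))"
  have fin: "path_norm T (\<lambda>p. u p $ l) < top" using u by (simp add: path_space_def)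
  have "esssup ?L ?\<psi>l \<le> path_norm T (\<lambda>p. u p $ l)" unfolding path_norm_def by simp
  then have fin': "esssup ?L ?\<psi>l < top" using fin by (rule le_less_trans)
  have "esssup ?L ?\<psi>l \<le> esssup ?L ?\<psi>"
  proof (rule esssup_AE_mono)
    show "?\<psi>l \<in> borel_measurable ?L"
    proof (rule ccontr)
      assume "?\<psi>l \<notin> borel_measurable ?L"
      from fin'[unfolded esssup_non_measurable[OF this]] show False by simp
    qed
    show "AE t in ?L. ?\<psi>l t \<le> ?\<psi> t"
      using esssup_AE[of ?\<psi>l ?L]
    proof eventually_elim
      case (elim t)
      then have "?\<psi>l t < top" using fin' by (rule le_less_trans)
      have "(\<lambda>x. ennreal (norm (sqrt t *\<^sub>R (u (t, x) $ l)))) \<in> borel_measurable lebesgue"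
      proof (rule ccontr)
        assume "(\<lambda>x. ennreal (norm (sqrt t *\<^sub>R (u (t, x) $ l)))) \<notin> borel_measurable lebesgue"
        from \<open>?\<psi>l t < top\<close>[unfolded esssup_non_measurable[OF this]] show False by simp
      qed
      then show ?case
        by (rule esssup_mono) (auto intro!: ennreal_leI mult_left_mono Finite_Cartesian_Product.norm_nth_le)
    qed
  qed
  moreover have "(SUP x. SUP t\<in>time_interval T.
          ennreal_sqrt (ennreal (t powr (- real CARD('n) / 2)) *
            (\<integral>\<^sup>+ s\<in>{0<..<t}. (\<integral>\<^sup>+ y\<in>ball x (sqrt t). ennreal ((norm (u (s, y) $ l))\<^sup>2) \<partial>lebesgue) \<partial>lebesgue)))
     \<le> (SUP x. SUP t\<in>time_interval T.
          ennreal_sqrt (ennreal (t powr (- real CARD('n) / 2)) *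
            (\<integral>\<^sup>+ s\<in>{0<..<t}. (\<integral>\<^sup>+ y\<in>ball x (sqrt t). ennreal ((norm (u (s, y)))\<^sup>2) \<partial>lebesgue) \<partial>lebesgue)))"
    by (intro SUP_mono' ennreal_sqrt_mono mult_left_mono nn_integral_mono mult_right_mono ennreal_leI power_mono Finite_Cartesian_Product.norm_nth_le) auto
  ultimately show ?thesis unfolding path_norm_def by (rule add_mono)
qed

lemma path_bounds_dominated:
  fixes f :: "'n::finite spacetime \<Rightarrow> 'b::euclidean_space" and g :: "'n spacetime \<Rightarrow> 'c::euclidean_space"
  assumes g: "path_bounds T a b g" and f: "f \<in> borel_measurable borel" and le: "\<And>p. norm (f p) \<le> norm (g p)"
  shows "path_bounds T a b f"
  unfolding path_bounds_def
proof (intro conjI ballI allI)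
  have "AE p in lborel. fst p \<in> time_interval T \<longrightarrow> norm (g p) * sqrt (fst p) \<le> a" using g by (simp add: path_bounds_def)
  then show "AE p in lborel. fst p \<in> time_interval T \<longrightarrow> norm (f p) * sqrt (fst p) \<le> a"
  proof eventually_elim
    case (elim p)
    show ?case
    proof
      assume p: "fst p \<in> time_interval T"
      then have "norm (f p) * sqrt (fst p) \<le> norm (g p) * sqrt (fst p)"
        using le by (intro mult_right_mono) (auto simp: time_interval_def)
      also have "\<dots> \<le> a" using elim p by simp
      finally show "norm (f p) * sqrt (fst p) \<le> a" .
    qed
  qed
  fix t and x :: "real ^ 'n" assume t: "t \<in> time_interval T"
  have "(\<integral>\<^sup>+p. before t p * indicator (ball x (sqrt t)) (snd p) * ennreal ((norm (f p))\<^sup>2) \<partial>lborel)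
    \<le> (\<integral>\<^sup>+p. before t p * indicator (ball x (sqrt t)) (snd p) * ennreal ((norm (g p))\<^sup>2) \<partial>lborel)"
    by (intro nn_integral_mono mult_left_mono ennreal_leI power_mono le) auto
  also have "\<dots> \<le> ennreal (b\<^sup>2 * sqrt t ^ CARD('n))" using g t by (simp add: path_bounds_def)
  finally show "(\<integral>\<^sup>+p. before t p * indicator (ball x (sqrt t)) (snd p) * ennreal ((norm (f p))\<^sup>2) \<partial>lborel)
    \<le> ennreal (b\<^sup>2 * sqrt t ^ CARD('n))" .
qed (use g f in \<open>auto simp: path_bounds_def\<close>)

lemma borel_measurable_vec_lambda:
  fixes f :: "'n::finite \<Rightarrow> 'a \<Rightarrow> complex"
  assumes [measurable]: "\<And>j. f j \<in> borel_measurable M"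
  shows "(\<lambda>s. \<chi> j. f j s) \<in> borel_measurable M"
proof -
  have [measurable]: "(axis j :: complex \<Rightarrow> complex ^ 'n) \<in> borel_measurable borel" for j
    by (intro borel_measurable_continuous_onI linear_continuous_on bounded_linear_axis)
  show ?thesis unfolding vec_lambda_eq_sum_axis by measurable
qed

text \<open>
  The constants come from summing over the \<open>n^3\<close> triples \<open>(j, k, l)\<close>, for the \<open>L\<^sup>2\<close> part with the
  Cauchy-Schwarz inequality for finite sums.
\<close>
lemma path_bounds_duhamel:
  fixes F :: "'n::finite \<Rightarrow> 'n \<Rightarrow> 'n spacetime \<Rightarrow> complex"
  assumes D: "D > 0" "\<And>(j :: 'n) k l. duhamel_bounded (oseen_gradient j k l) D"
    and F: "\<And>l k. source_bound T (M l k) (F l k)" and M: "\<And>l k. M l k \<le> P"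
  shows "path_bounds T (real (CARD('n) ^ 3) * D * P) (real (CARD('n) ^ 3) * sqrt D * P)
    (\<lambda>p. \<chi> j. \<Sum>k\<in>UNIV. \<Sum>l\<in>UNIV. duhamel (oseen_gradient j k l) 0 (F l k) (fst p) (snd p))"
proof -
  let ?N = "real (CARD('n) ^ 3)"
  define V where "V q p = duhamel (oseen_gradient (fst q) (fst (snd q)) (snd (snd q))) 0 (F (snd (snd q)) (fst (snd q))) (fst p) (snd p)"
    for q :: "'n \<times> 'n \<times> 'n" and p
  define w where "w p = (\<chi> j. \<Sum>k\<in>UNIV. \<Sum>l\<in>UNIV. V (j, k, l) p)" for p
  have card: "card (UNIV :: ('n \<times> 'n \<times> 'n) set) = CARD('n) ^ 3"
    by (simp add: power3_eq_cube)
  have M0: "M l k \<ge> 0" for l k by (rule source_bound_nonneg[OF F])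
  have P0: "P \<ge> 0" using order.trans[OF M0 M] .
  have V_meas [measurable]: "V q \<in> borel_measurable borel" for q
    unfolding V_def[abs_def] using borel_measurable_source[OF F] by (intro borel_measurable_duhamel_pair borel_measurable_multiplier_kernel) auto
  have w_meas: "w \<in> borel_measurable borel" unfolding w_def[abs_def] by (rule borel_measurable_vec_lambda) measurable
  have norm_w: "norm (w p) \<le> (\<Sum>q\<in>UNIV. norm (V q p))" for p
  proof -
    have "norm (w p) \<le> (\<Sum>j\<in>UNIV. norm (w p $ j))" by (rule norm_vec_le_sum)
    also have "\<dots> \<le> (\<Sum>j\<in>UNIV. \<Sum>k\<in>UNIV. \<Sum>l\<in>UNIV. norm (V (j, k, l) p))"
      unfolding w_def by (intro sum_mono) (simp, intro order.trans[OF norm_sum] sum_mono norm_sum)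
    also have "\<dots> = (\<Sum>q\<in>UNIV. norm (V q p))"
      by (simp add: sum.cartesian_product UNIV_Times_UNIV[symmetric] case_prod_beta' del: UNIV_Times_UNIV)
    finally show ?thesis .
  qed
  have V_sup: "norm (V q (t, x)) \<le> D * P / sqrt t" if t: "t \<in> time_interval T" for q t x
  proof -
    have "norm (V q (t, x)) \<le> D * M (snd (snd q)) (fst (snd q)) / sqrt t"
      using duhamel_boundedD(1)[OF D(2) F t] by (simp add: V_def)
    also have "\<dots> \<le> D * P / sqrt t"
      using t D(1) M by (intro divide_right_mono mult_left_mono) (auto simp: time_interval_def)
    finally show ?thesis .
  qed
  have sup: "norm (w (t, x)) * sqrt t \<le> ?N * D * P" if t: "t \<in> time_interval T" for t x
  proof -
    have t0: "t > 0" using t by (simp add: time_interval_def)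
    have "norm (w (t, x)) \<le> (\<Sum>q\<in>(UNIV :: ('n \<times> 'n \<times> 'n) set). D * P / sqrt t)"
      using norm_w by (rule order.trans) (intro sum_mono V_sup t)
    also have "\<dots> = ?N * D * P / sqrt t" by (simp add: power3_eq_cube)
    finally show ?thesis using t0 by (simp add: pos_le_divide_eq)
  qed
  have L2: "(\<integral>\<^sup>+p. before t p * indicator (ball x (sqrt t)) (snd p) * ennreal ((norm (w p))\<^sup>2) \<partial>lborel)
      \<le> ennreal ((?N * sqrt D * P)\<^sup>2 * sqrt t ^ CARD('n))" if t: "t \<in> time_interval T" for t x
  proof -
    have t0: "t > 0" using t by (simp add: time_interval_def)
    have B [measurable]: "ball x (sqrt t) \<in> sets borel" by simp
    let ?\<chi> = "\<lambda>p. before t p * indicator (ball x (sqrt t)) (snd p) :: ennreal"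
    have cyl: "(\<integral>\<^sup>+p. ?\<chi> p * ennreal ((norm (V q p))\<^sup>2) \<partial>lborel) \<le> ennreal (D * P\<^sup>2 * sqrt t ^ CARD('n))" for q
    proof -
      have Vp: "V q \<in> borel_measurable (borel \<Otimes>\<^sub>M borel)" unfolding borel_prod by (rule V_meas)
      have "(\<integral>\<^sup>+p. ?\<chi> p * ennreal ((norm (V q p))\<^sup>2) \<partial>lborel)
        = (\<integral>\<^sup>+s. \<integral>\<^sup>+y. indicator {0<..<t} s * (indicator (ball x (sqrt t)) y * ennreal ((norm (V q (s, y)))\<^sup>2)) \<partial>lborel \<partial>lborel)"
      proof (subst nn_integral_lborel_pair_fst)
        show "(\<lambda>p. ?\<chi> p * ennreal ((norm (V q p))\<^sup>2)) \<in> borel_measurable borel" by measurable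
      qed (simp add: mult.assoc)
      also have "\<dots> = (\<integral>\<^sup>+s. indicator {0<..<t} s * (\<integral>\<^sup>+y. indicator (ball x (sqrt t)) y * ennreal ((norm (V q (s, y)))\<^sup>2) \<partial>lborel) \<partial>lborel)"
      proof (intro nn_integral_cong nn_integral_cmult)
        fix s
        have "(\<lambda>y. V q (s, y)) \<in> borel_measurable borel" using Vp by measurable
        then show "(\<lambda>y. indicator (ball x (sqrt t)) y * ennreal ((norm (V q (s, y)))\<^sup>2)) \<in> borel_measurable lborel" by measurable
      qed
      also have "\<dots> \<le> ennreal (D * (M (snd (snd q)) (fst (snd q)))\<^sup>2 * sqrt t ^ CARD('n))"
        unfolding V_def fst_conv snd_conv by (rule duhamel_boundedD(2)[OF D(2) F t])
      also have "\<dots> \<le> ennreal (D * P\<^sup>2 * sqrt t ^ CARD('n))"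
        using t0 D(1) M M0 by (intro ennreal_leI mult_right_mono mult_left_mono power_mono) auto
      finally show ?thesis .
    qed
    have "(\<integral>\<^sup>+p. ?\<chi> p * ennreal ((norm (w p))\<^sup>2) \<partial>lborel) \<le> (\<integral>\<^sup>+p. ennreal ?N * (\<Sum>q\<in>UNIV. ?\<chi> p * ennreal ((norm (V q p))\<^sup>2)) \<partial>lborel)"
    proof (rule nn_integral_mono)
      fix p
      have "(norm (w p))\<^sup>2 \<le> (\<Sum>q\<in>UNIV. norm (V q p))\<^sup>2" by (rule power_mono[OF norm_w]) simp
      also have "\<dots> \<le> (\<Sum>q\<in>UNIV. (norm (V q p))\<^sup>2) * real (card (UNIV :: ('n \<times> 'n \<times> 'n) set))"
        by (rule sum_squared_le_sum_of_squares)
      finally have "ennreal ((norm (w p))\<^sup>2) \<le> ennreal (?N * (\<Sum>q\<in>UNIV. (norm (V q p))\<^sup>2))"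
        unfolding card by (intro ennreal_leI) (simp only: mult.commute)
      also have "\<dots> = ennreal ?N * (\<Sum>q\<in>UNIV. ennreal ((norm (V q p))\<^sup>2))"
        by (subst ennreal_mult) (auto simp: sum_nonneg)
      finally have "?\<chi> p * ennreal ((norm (w p))\<^sup>2) \<le> ?\<chi> p * (ennreal ?N * (\<Sum>q\<in>UNIV. ennreal ((norm (V q p))\<^sup>2)))"
        by (rule mult_left_mono) simp
      also have "\<dots> = ennreal ?N * (\<Sum>q\<in>UNIV. ?\<chi> p * ennreal ((norm (V q p))\<^sup>2))"
        by (simp only: sum_distrib_left mult_ac)
      finally show "?\<chi> p * ennreal ((norm (w p))\<^sup>2) \<le> ennreal ?N * (\<Sum>q\<in>UNIV. ?\<chi> p * ennreal ((norm (V q p))\<^sup>2))" .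
    qed
    also have "\<dots> = ennreal ?N * (\<integral>\<^sup>+p. (\<Sum>q\<in>UNIV. ?\<chi> p * ennreal ((norm (V q p))\<^sup>2)) \<partial>lborel)"
      by (rule nn_integral_cmult) measurable
    also have "(\<integral>\<^sup>+p. (\<Sum>q\<in>UNIV. ?\<chi> p * ennreal ((norm (V q p))\<^sup>2)) \<partial>lborel) = (\<Sum>q\<in>UNIV. \<integral>\<^sup>+p. ?\<chi> p * ennreal ((norm (V q p))\<^sup>2) \<partial>lborel)"
      by (rule nn_integral_sum) measurable
    also have "\<dots> \<le> (\<Sum>q\<in>(UNIV :: ('n \<times> 'n \<times> 'n) set). ennreal (D * P\<^sup>2 * sqrt t ^ CARD('n)))"
      by (intro sum_mono cyl)
    also have "\<dots> = ennreal (?N * (D * P\<^sup>2 * sqrt t ^ CARD('n)))"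
      using D(1) t0 by (subst sum_ennreal) (simp_all add: power3_eq_cube)
    also have "ennreal ?N * ennreal (?N * (D * P\<^sup>2 * sqrt t ^ CARD('n))) = ennreal ((?N * sqrt D * P)\<^sup>2 * sqrt t ^ CARD('n))"
    proof -
      have "?N * (?N * (D * P\<^sup>2 * sqrt t ^ CARD('n))) = (?N * sqrt D * P)\<^sup>2 * sqrt t ^ CARD('n)"
      proof -
        have sq: "(sqrt D)\<^sup>2 = D" using D(1) by simp
        show ?thesis unfolding power_mult_distrib sq by (simp only: power2_eq_square mult_ac)
      qed
      moreover have "0 \<le> ?N" "0 \<le> ?N * (D * P\<^sup>2 * sqrt t ^ CARD('n))" using D(1) t0 by auto
      ultimately show ?thesis by (simp only: ennreal_mult[symmetric])
    qed
    finally show ?thesis by (simp add: mult_left_mono)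
  qed
  have "AE p in lborel. fst p \<in> time_interval T \<longrightarrow> norm (w p) * sqrt (fst p) \<le> ?N * D * P"
  proof (rule AE_I2, rule impI)
    fix p :: "'n spacetime" assume "fst p \<in> time_interval T"
    then show "norm (w p) * sqrt (fst p) \<le> ?N * D * P" using sup[of "fst p" "snd p"] by simp
  qed
  moreover have "0 \<le> ?N * D * P" "0 \<le> ?N * sqrt D * P" using D(1) P0 by auto
  ultimately have "path_bounds T (?N * D * P) (?N * sqrt D * P) w"
    unfolding path_bounds_def using w_meas L2 by blast
  then show ?thesis by (simp add: w_def[abs_def] V_def)
qed

theorem theorem2p4:
  fixes T :: ereal
  assumes "0 < T"
  shows
    "(\<forall>u\<in>path_space_vec T. \<forall>v\<in>path_space_vec T.
        (\<forall>t\<in>time_interval T. \<forall>x. bilinear_op_converges u v t x) \<and>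
        bilinear_op u v \<in> (path_space_vec T :: (real \<times> (real ^ 'n::finite) \<Rightarrow> complex ^ 'n) set)) \<and>
     (\<exists>C::real. C > 0 \<and>
        (\<forall>u\<in>path_space_vec T. \<forall>v\<in>(path_space_vec T :: (real \<times> (real ^ 'n) \<Rightarrow> complex ^ 'n) set).
           path_norm T (bilinear_op u v) \<le> ennreal C * path_norm T u * path_norm T v))"
proof -
  let ?n = "CARD('n)" and ?N = "real (CARD('n) ^ 3)"
  obtain D where D: "D > 0" "\<And>(j :: 'n) k l. duhamel_bounded (oseen_gradient j k l) D"
    using oseen_duhamel_bounded[where 'n='n] by blast
  define C where "C = (?N * D + ?N * sqrt D) * real (?n ^ 2)"
  have main: "(\<forall>t\<in>time_interval T. \<forall>x. bilinear_op_converges u v t x) \<and> bilinear_op u v \<in> path_space_vec T \<and>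
      path_norm T (bilinear_op u v) \<le> ennreal C * path_norm T u * path_norm T v"
    if u: "u \<in> path_space_vec T" and v: "v \<in> path_space_vec T" for u v :: "'n spacetime \<Rightarrow> complex ^ 'n"
  proof -
    let ?a = "\<lambda>l. enn2real (path_norm T (\<lambda>p. u p $ l))" and ?b = "\<lambda>k. enn2real (path_norm T (\<lambda>p. v p $ k))"
    have ul: "(\<lambda>p. u p $ l) \<in> path_space T" and vl: "(\<lambda>p. v p $ l) \<in> path_space T" for l
      using u v by (auto simp: path_space_vec_def)
    have "\<forall>l. \<exists>f. path_bounds T (?a l) (?a l) f \<and> (AE s in lborel. s \<in> time_interval T \<longrightarrow> (AE y in lborel. u (s, y) $ l = f (s, y)))"
      using path_space_representative[OF ul] by blast
    from choice[OF this] obtain f where f: "\<And>l. path_bounds T (?a l) (?a l) (f l)"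
      and uf: "\<And>l. AE s in lborel. s \<in> time_interval T \<longrightarrow> (AE y in lborel. u (s, y) $ l = f l (s, y))" by blast
    have "\<forall>l. \<exists>g. path_bounds T (?b l) (?b l) g \<and> (AE s in lborel. s \<in> time_interval T \<longrightarrow> (AE y in lborel. v (s, y) $ l = g (s, y)))"
      using path_space_representative[OF vl] by blast
    from choice[OF this] obtain g where g: "\<And>l. path_bounds T (?b l) (?b l) (g l)"
      and vg: "\<And>l. AE s in lborel. s \<in> time_interval T \<longrightarrow> (AE y in lborel. v (s, y) $ l = g l (s, y))" by blast
    (* A common bound for the products of the norms of all pairs of components. *)
    define P where "P = (\<Sum>l\<in>UNIV. \<Sum>k\<in>UNIV. ?a l * ?b k)"
    have P: "?a l * ?b k \<le> P" for l k
    proof -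
      have "?a l * ?b k \<le> (\<Sum>k\<in>UNIV. ?a l * ?b k)" by (rule member_le_sum) auto
      also have "\<dots> \<le> P" unfolding P_def by (rule member_le_sum) (auto intro: sum_nonneg)
      finally show ?thesis .
    qed
    let ?w = "\<lambda>p. \<chi> j. \<Sum>k\<in>UNIV. \<Sum>l\<in>UNIV. duhamel (oseen_gradient j k l) 0 (\<lambda>p. f l p * g k p) (fst p) (snd p)"
    have w: "path_bounds T (?N * D * P) (?N * sqrt D * P) ?w"
      by (rule path_bounds_duhamel[OF D source_bound_product[OF f g] P])
    have eq: "bilinear_op u v (t, x) = ?w (t, x)" if "t \<in> time_interval T" for t x
      using bilinear_op_eq_duhamel[OF f g uf vg that] by simp
    have "(\<lambda>p. bilinear_op u v p $ j) \<in> path_space T" for j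
    proof (rule path_space_of_path_bounds[OF assms])
      have "(\<lambda>p. ?w p $ j) \<in> borel_measurable borel"
        using w by (intro borel_measurable_continuous_on[OF linear_continuous_on[OF bounded_linear_vec_nth]]) (simp add: path_bounds_def)
      then show "path_bounds T (?N * D * P) (?N * sqrt D * P) (\<lambda>p. ?w p $ j)"
        by (rule path_bounds_dominated[OF w]) (rule Finite_Cartesian_Product.norm_nth_le)
    qed (simp add: eq)
    then have mem: "bilinear_op u v \<in> path_space_vec T" by (simp add: path_space_vec_def)
    have "path_norm T (bilinear_op u v) \<le> ennreal (?N * D * P + ?N * sqrt D * P)"
      by (rule path_norm_le[OF w eq])
    also have "?N * D * P + ?N * sqrt D * P = (?N * D + ?N * sqrt D) * P" by (simp add: distrib_right)
    also have "ennreal \<dots> = ennreal (?N * D + ?N * sqrt D) * ennreal P"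
      using D(1) by (intro ennreal_mult) (auto simp: P_def intro!: sum_nonneg)
    also have "ennreal P \<le> of_nat (?n ^ 2) * (path_norm T u * path_norm T v)"
    proof -
      have "ennreal (?a l) = path_norm T (\<lambda>p. u p $ l)" "ennreal (?b l) = path_norm T (\<lambda>p. v p $ l)" for l
        using ul[of l] vl[of l] by (auto simp: path_space_def)
      then have ab: "ennreal (?a l) \<le> path_norm T u" "ennreal (?b l) \<le> path_norm T v" for l
        using path_norm_component_le[OF ul] path_norm_component_le[OF vl] by simp_all
      have "ennreal P = (\<Sum>l\<in>UNIV. \<Sum>k\<in>UNIV. ennreal (?a l) * ennreal (?b k))"
        unfolding P_def by (simp add: sum_ennreal[symmetric] sum_nonneg ennreal_mult)
      also have "\<dots> \<le> (\<Sum>l\<in>(UNIV::'n set). \<Sum>k\<in>(UNIV::'n set). path_norm T u * path_norm T v)"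
        by (intro sum_mono mult_mono ab) auto
      also have "\<dots> = of_nat (?n ^ 2) * (path_norm T u * path_norm T v)"
        by (simp add: power2_eq_square mult.assoc)
      finally show ?thesis .
    qed
    also have "ennreal (?N * D + ?N * sqrt D) * (of_nat (?n ^ 2) * (path_norm T u * path_norm T v)) = ennreal C * path_norm T u * path_norm T v"
    proof -
      have "ennreal C = ennreal (?N * D + ?N * sqrt D) * of_nat (?n ^ 2)"
        unfolding C_def using D(1) by (subst ennreal_mult) (auto simp: ennreal_of_nat_eq_real_of_nat)
      then show ?thesis by (simp only: mult.assoc)
    qed
    finally have "path_norm T (bilinear_op u v) \<le> ennreal C * path_norm T u * path_norm T v" by (simp add: mult_left_mono)
    with mem bilinear_op_converges_of_representatives[OF f g uf vg] show ?thesis by blast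
  qed
  have "C > 0" unfolding C_def using D(1) by (intro mult_pos_pos add_pos_pos) auto
  with main show ?thesis by blast
qed

end
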